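(* Let $K$ be a unital commutative ring and let $A$ be an associative unital $K$-superalgebra which is free as a $K$-module with a $K$-basis containing the identity. Let $\mathcal{W}=A_2^4\oplus A_0^2$ and let $\mathfrak{st}(2,2,A)^{\sharp}=\mathfrak{st}(2,2,A)\oplus\mathcal{W}$ be the Lie superalgebra with bracket $[(x,w_1),(y,w_2)]=\big([x,y],\psi(x,y)\big)$, where $\psi$ is the super 2-cocycle on $\mathfrak{st}(2,2,A)$ specified in the context. Then the central extension \[ 0\to\mathcal{W}\to\mathfrak{st}(2,2,A)^{\sharp}\xrightarrow{\ \pi\ }\mathfrak{st}(2,2,A)\to 0, \] with $\pi$ the projection, is universal.
   Context: $K$ is regarded as concentrated in even degree; $A=A_{\bar 0}\oplus A_{\bar 1}$ is $\mathbb{Z}/2$-graded and $|a|$ denotes the degree of a homogeneous element. Lie superalgebras: a Lie superalgebra over $K$ is a $\mathbb{Z}/2$-graded $K$-module $L$ with an even $K$-bilinear bracket such that $[x,y]=-(-1)^{|x||y|}[y,x]$, $[x_{\bar 0},x_{\bar 0}]=0$ for $x_{\bar 0}\in L_{\bar 0}$, and $(-1)^{|x||z|}[[x,y],z]+(-1)^{|x||y|}[[y,z],x]+(-1)^{|y||z|}[[z,x],y]=0$ for homogeneous $x,y,z$. A central extension of $L$ is a surjective (even) Lie superalgebra homomorphism $M\to L$ whose kernel lies in the centre of $M$. It is universal if for every central extension $\tau\colon M'\to L$ there is a unique Lie superalgebra homomorphism $\rho\colon M\to M'$ whose composite with $\tau$ is the given map $M\to L$. Steinberg Lie superalgebra $\mathfrak{st}(2,2,A)$: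 indices $1,2$ are even ($|i|=\bar 0$) and $3,4$ are odd ($|i|=\bar 1$). It is the Lie superalgebra over $K$ generated by homogeneous elements $F_{ij}(a)$, $1\le i\ne j\le 4$, $a\in A$ homogeneous, of degree $|F_{ij}(a)|=|i|+|j|+|a|$, subject to: $a\mapsto F_{ij}(a)$ is $K$-linear; $[F_{ij}(a),F_{jk}(b)]=F_{ik}(ab)$ for distinct $i,j,k$; $[F_{ij}(a),F_{kl}(b)]=0$ for $j\ne k$, $i\ne l$. Put $H_{ij}(a,b)=[F_{ij}(a),F_{ji}(b)]$, let $\mathcal{H}$ be the subalgebra generated by all $H_{ij}(a,b)$, and $F_{ij}(A)=\{F_{ij}(a):a\in A\}$. As a $K$-module, $\mathfrak{st}(2,2,A)=\mathcal{H}\oplus\bigoplus_{1\le i\ne j\le 4}F_{ij}(A)$. For an integer $r\ge 0$, $A_r=A/\mathcal{I}_r$, where $\mathcal{I}_r$ is the graded ideal of $A$ generated by all $ra$ and all $ab-(-1)^{|a||b|}ba$; $\bar a$ is the class of $a$. $\mathcal{W}=A_2^4\oplus A_0^2$ is the direct sum of four copies of $A_2$ (positions $1$ to $4$) and two copies of $A_0$ (positions $5,6$), and $\epsilon_r$ denotes the inclusion of the $r$-th summand. Partition the set $S_4$ of quadruples $(i,j,k,l)$ of distinct elements of $\{1,2,3,4\}$ into the six classes $\{(i,j,k,l),(k,j,i,l),(i,l,k,j),(k,l,i,j)\}$ (the cosets of $\{(1,2,3,4),(3,2,1,4),(1,4,3,2),(3,4,1,2)\}$), labelled $P_1,\dots,P_6$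 so that $P_5=\{(1,3,2,4),(1,4,2,3),(2,3,1,4),(2,4,1,3)\}$ and $P_6=\{(3,1,4,2),(3,2,4,1),(4,1,3,2),(4,2,3,1)\}$ (the order of the other four is immaterial). Put $\theta((i,j,k,l))=r$ if $(i,j,k,l)\in P_r$. Define $\sigma\colon S_4\to\{-1,1\}$ by $\sigma=1$ on $P_1,\dots,P_4$; $\sigma=1$ on $(1,3,2,4),(2,4,1,3)$ and $\sigma=-1$ on $(1,4,2,3),(2,3,1,4)$; $\sigma=1$ on $(3,1,4,2),(4,2,3,1)$ and $\sigma=-1$ on $(3,2,4,1),(4,1,3,2)$. The map $\psi\colon\mathfrak{st}(2,2,A)\times\mathfrak{st}(2,2,A)\to\mathcal{W}$ is the $K$-bilinear map with, for homogeneous $a,b\in A$, $\psi\big(F_{ij}(a),F_{kl}(b)\big)=\epsilon_{\theta((i,j,k,l))}(\overline{ab})$ if $(i,j,k,l)\in P_1,P_2,P_3,P_4$; $\psi\big(F_{ij}(a),F_{kl}(b)\big)=(-1)^{|b|}\sigma((i,j,k,l))\,\epsilon_{\theta((i,j,k,l))}(\overline{ab})$ if $(i,j,k,l)\in P_5$ or $P_6$; $\psi\big(F_{ij}(a),F_{kl}(b)\big)=0$ if $i,j,k,l$ are not all distinct; and $\psi(x,y)=0$ if $x$ or $y$ belongs to $\mathcal{H}$. *)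

theory Defs
  imports "HOL-Algebra.Module" "HOL-Algebra.QuotRing" "HOL-Library.Z2"
begin

section \<open>Superalgebras and Lie superalgebras\<close>

text \<open>Degrees live in the two-element field \<^typ>\<open>bit\<close>. For a Lie superalgebra the field \<open>mult\<close> of the
  ring record is the bracket, and the field \<open>one\<close> is never used.\<close>

record ('k, 'm) supermodule = "('k, 'm) module" +
  grade :: "bit \<Rightarrow> 'm set"

abbreviation (input) bracket :: "('m, 'z) ring_scheme \<Rightarrow> 'm \<Rightarrow> 'm \<Rightarrow> 'm"
  where "bracket L x y \<equiv> x \<otimes>\<^bsub>L\<^esub> y"

definition ksgn :: "bit \<Rightarrow> int"
  where "ksgn p = (if p = 0 then 1 else - 1)"

locale graded_module = module K M
  for K :: "('k, 'y) ring_scheme" and M :: "('k, 'm, 'z) supermodule_scheme" +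
  assumes grade_submodule: "submodule (grade M p) K M"
    and grade_direct_sum: "x \<in> carrier M \<Longrightarrow>
      \<exists>!(y, z). y \<in> grade M 0 \<and> z \<in> grade M 1 \<and> x = y \<oplus>\<^bsub>M\<^esub> z"

locale superalgebra = graded_module K A + ring A
  for K :: "('k, 'y) ring_scheme" and A :: "('k, 'a, 'z) supermodule_scheme" +
  assumes smult_mult_left: "\<lbrakk>k \<in> carrier K; a \<in> carrier A; b \<in> carrier A\<rbrakk> \<Longrightarrow>
      (k \<odot>\<^bsub>A\<^esub> a) \<otimes>\<^bsub>A\<^esub> b = k \<odot>\<^bsub>A\<^esub> (a \<otimes>\<^bsub>A\<^esub> b)"
    and smult_mult_right: "\<lbrakk>k \<in> carrier K; a \<in> carrier A; b \<in> carrier A\<rbrakk> \<Longrightarrow>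
      a \<otimes>\<^bsub>A\<^esub> (k \<odot>\<^bsub>A\<^esub> b) = k \<odot>\<^bsub>A\<^esub> (a \<otimes>\<^bsub>A\<^esub> b)"
    and mult_even: "\<lbrakk>a \<in> grade A p; b \<in> grade A q\<rbrakk> \<Longrightarrow> a \<otimes>\<^bsub>A\<^esub> b \<in> grade A (p + q)"
    and one_even: "\<one>\<^bsub>A\<^esub> \<in> grade A 0"

definition module_basis ::
    "('k, 'y) ring_scheme \<Rightarrow> ('k, 'm, 'z) module_scheme \<Rightarrow> 'm set \<Rightarrow> bool"
  where "module_basis K M B \<longleftrightarrow> B \<subseteq> carrier M \<and>
    (\<forall>x\<in>carrier M. \<exists>!c. c \<in> B \<rightarrow>\<^sub>E carrier K \<and> finite {b \<in> B. c b \<noteq> \<zero>\<^bsub>K\<^esub>} \<and>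
      x = finsum M (\<lambda>b. c b \<odot>\<^bsub>M\<^esub> b) {b \<in> B. c b \<noteq> \<zero>\<^bsub>K\<^esub>})"

locale lie_superalgebra = graded_module K L
  for K :: "('k, 'y) ring_scheme" and L :: "('k, 'l, 'z) supermodule_scheme" +
  assumes bracket_closed: "\<lbrakk>x \<in> carrier L; y \<in> carrier L\<rbrakk> \<Longrightarrow> bracket L x y \<in> carrier L"
    and bracket_add_left: "\<lbrakk>x \<in> carrier L; y \<in> carrier L; z \<in> carrier L\<rbrakk> \<Longrightarrow>
      bracket L (x \<oplus>\<^bsub>L\<^esub> y) z = bracket L x z \<oplus>\<^bsub>L\<^esub> bracket L y z"
    and bracket_add_right: "\<lbrakk>x \<in> carrier L; y \<in> carrier L; z \<in> carrier L\<rbrakk> \<Longrightarrow>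
      bracket L x (y \<oplus>\<^bsub>L\<^esub> z) = bracket L x y \<oplus>\<^bsub>L\<^esub> bracket L x z"
    and bracket_smult_left: "\<lbrakk>k \<in> carrier K; x \<in> carrier L; y \<in> carrier L\<rbrakk> \<Longrightarrow>
      bracket L (k \<odot>\<^bsub>L\<^esub> x) y = k \<odot>\<^bsub>L\<^esub> bracket L x y"
    and bracket_smult_right: "\<lbrakk>k \<in> carrier K; x \<in> carrier L; y \<in> carrier L\<rbrakk> \<Longrightarrow>
      bracket L x (k \<odot>\<^bsub>L\<^esub> y) = k \<odot>\<^bsub>L\<^esub> bracket L x y"
    and bracket_even: "\<lbrakk>x \<in> grade L p; y \<in> grade L q\<rbrakk> \<Longrightarrow> bracket L x y \<in> grade L (p + q)"
    and bracket_skew: "\<lbrakk>x \<in> grade L p; y \<in> grade L q\<rbrakk> \<Longrightarrow>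
      bracket L x y = \<ominus>\<^bsub>L\<^esub> ([ksgn (p * q)] \<cdot>\<^bsub>L\<^esub> bracket L y x)"
    and bracket_alternating: "x \<in> grade L 0 \<Longrightarrow> bracket L x x = \<zero>\<^bsub>L\<^esub>"
    and super_jacobi: "\<lbrakk>x \<in> grade L p; y \<in> grade L q; z \<in> grade L r\<rbrakk> \<Longrightarrow>
      [ksgn (p * r)] \<cdot>\<^bsub>L\<^esub> bracket L (bracket L x y) z \<oplus>\<^bsub>L\<^esub>
      [ksgn (p * q)] \<cdot>\<^bsub>L\<^esub> bracket L (bracket L y z) x \<oplus>\<^bsub>L\<^esub>
      [ksgn (q * r)] \<cdot>\<^bsub>L\<^esub> bracket L (bracket L z x) y = \<zero>\<^bsub>L\<^esub>"

definition lie_super_hom ::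
    "('k, 'y) ring_scheme \<Rightarrow> ('k, 'l, 'z) supermodule_scheme \<Rightarrow>
      ('k, 'm, 'w) supermodule_scheme \<Rightarrow> ('l \<Rightarrow> 'm) set"
  where "lie_super_hom K L M = {f \<in> carrier L \<rightarrow> carrier M.
    (\<forall>x\<in>carrier L. \<forall>y\<in>carrier L. f (x \<oplus>\<^bsub>L\<^esub> y) = f x \<oplus>\<^bsub>M\<^esub> f y) \<and>
    (\<forall>k\<in>carrier K. \<forall>x\<in>carrier L. f (k \<odot>\<^bsub>L\<^esub> x) = k \<odot>\<^bsub>M\<^esub> f x) \<and>
    (\<forall>x\<in>carrier L. \<forall>y\<in>carrier L. f (bracket L x y) = bracket M (f x) (f y)) \<and>
    (\<forall>p. f ` grade L p \<subseteq> grade M p)}"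

definition lie_center :: "('k, 'l, 'z) supermodule_scheme \<Rightarrow> 'l set"
  where "lie_center L = {z \<in> carrier L. \<forall>x\<in>carrier L. bracket L z x = \<zero>\<^bsub>L\<^esub>}"

definition lie_subalgebra ::
    "('k, 'y) ring_scheme \<Rightarrow> ('k, 'l, 'z) supermodule_scheme \<Rightarrow> 'l set \<Rightarrow> bool"
  where "lie_subalgebra K L N \<longleftrightarrow>
    submodule N K L \<and> (\<forall>x\<in>N. \<forall>y\<in>N. bracket L x y \<in> N)"

definition lie_generated ::
    "('k, 'y) ring_scheme \<Rightarrow> ('k, 'l, 'z) supermodule_scheme \<Rightarrow> 'l set \<Rightarrow> 'l set"
  where "lie_generated K L S = \<Inter> {N. S \<subseteq> N \<and> lie_subalgebra K L N}"

definition central_extension ::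
    "('k, 'y) ring_scheme \<Rightarrow> ('k, 'm, 'z) supermodule_scheme \<Rightarrow>
      ('k, 'l, 'w) supermodule_scheme \<Rightarrow> ('m \<Rightarrow> 'l) \<Rightarrow> bool"
  where "central_extension K M L \<pi> \<longleftrightarrow>
    lie_superalgebra K M \<and> lie_superalgebra K L \<and>
    \<pi> \<in> lie_super_hom K M L \<and> \<pi> ` carrier M = carrier L \<and> a_kernel M L \<pi> \<subseteq> lie_center M"

text \<open>A formula cannot quantify over types, so the type of the elements of the competing extensions is a
  parameter; a theorem in which it is a free type variable covers extensions of every size.\<close>

definition universal_central_extension ::
    "'n itself \<Rightarrow> ('k, 'y) ring_scheme \<Rightarrow> ('k, 'm, 'z) supermodule_scheme \<Rightarrow>
      ('k, 'l, 'w) supermodule_scheme \<Rightarrow> ('m \<Rightarrow> 'l) \<Rightarrow> bool"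
  where "universal_central_extension _ K M L \<pi> \<longleftrightarrow>
    central_extension K M L \<pi> \<and>
    (\<forall>(M' :: ('k, 'n) supermodule) \<tau>. central_extension K M' L \<tau> \<longrightarrow>
      (\<exists>!\<rho>. \<rho> \<in> lie_super_hom K M M' \<inter> extensional (carrier M) \<and>
        (\<forall>x\<in>carrier M. \<tau> (\<rho> x) = \<pi> x)))"


section \<open>Lie superalgebras given by generators and relations\<close>

datatype ('k, 'x) lie_term =
    Gen 'x
  | Zero
  | Add "('k, 'x) lie_term" "('k, 'x) lie_term"
  | Smult 'k "('k, 'x) lie_term"
  | Br "('k, 'x) lie_term" "('k, 'x) lie_term"

inductive_set lie_terms :: "('k, 'y) ring_scheme \<Rightarrow> 'x set \<Rightarrow> ('k, 'x) lie_term set"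
  for K and G where
  gen: "x \<in> G \<Longrightarrow> Gen x \<in> lie_terms K G"
| zero: "Zero \<in> lie_terms K G"
| add: "\<lbrakk>s \<in> lie_terms K G; t \<in> lie_terms K G\<rbrakk> \<Longrightarrow> Add s t \<in> lie_terms K G"
| smult: "\<lbrakk>k \<in> carrier K; t \<in> lie_terms K G\<rbrakk> \<Longrightarrow> Smult k t \<in> lie_terms K G"
| br: "\<lbrakk>s \<in> lie_terms K G; t \<in> lie_terms K G\<rbrakk> \<Longrightarrow> Br s t \<in> lie_terms K G"

inductive homog_term ::
    "('k, 'y) ring_scheme \<Rightarrow> 'x set \<Rightarrow> ('x \<Rightarrow> bit) \<Rightarrow> bit \<Rightarrow> ('k, 'x) lie_term \<Rightarrow> bool"
  for K and G and d where
  gen: "x \<in> G \<Longrightarrow> homog_term K G d (d x) (Gen x)"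
| zero: "homog_term K G d p Zero"
| add: "\<lbrakk>homog_term K G d p s; homog_term K G d p t\<rbrakk> \<Longrightarrow> homog_term K G d p (Add s t)"
| smult: "\<lbrakk>k \<in> carrier K; homog_term K G d p t\<rbrakk> \<Longrightarrow> homog_term K G d p (Smult k t)"
| br: "\<lbrakk>homog_term K G d p s; homog_term K G d q t\<rbrakk> \<Longrightarrow> homog_term K G d (p + q) (Br s t)"

text \<open>The sign \<open>(-1)\<^sup>p\<close> as an element of \<open>K\<close>.\<close>

definition ksign :: "('k, 'y) ring_scheme \<Rightarrow> bit \<Rightarrow> 'k"
  where "ksign K p = [ksgn p] \<cdot>\<^bsub>K\<^esub> \<one>\<^bsub>K\<^esub>"

text \<open>The least congruence on terms that contains the relations \<open>R\<close> and makes the quotient a Lie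
  superalgebra over \<open>K\<close>.\<close>

inductive_set lie_cong ::
    "('k, 'y) ring_scheme \<Rightarrow> 'x set \<Rightarrow> ('x \<Rightarrow> bit) \<Rightarrow> (('k, 'x) lie_term \<times> ('k, 'x) lie_term) set \<Rightarrow>
      (('k, 'x) lie_term \<times> ('k, 'x) lie_term) set"
  for K and G and d and R where
  rel: "\<lbrakk>(s, t) \<in> R; s \<in> lie_terms K G; t \<in> lie_terms K G\<rbrakk> \<Longrightarrow> (s, t) \<in> lie_cong K G d R"
| refl: "t \<in> lie_terms K G \<Longrightarrow> (t, t) \<in> lie_cong K G d R"
| sym: "(s, t) \<in> lie_cong K G d R \<Longrightarrow> (t, s) \<in> lie_cong K G d R"
| trans: "\<lbrakk>(s, t) \<in> lie_cong K G d R; (t, u) \<in> lie_cong K G d R\<rbrakk> \<Longrightarrow> (s, u) \<in> lie_cong K G d R"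
| cong_add: "\<lbrakk>(s, s') \<in> lie_cong K G d R; (t, t') \<in> lie_cong K G d R\<rbrakk> \<Longrightarrow>
    (Add s t, Add s' t') \<in> lie_cong K G d R"
| cong_smult: "\<lbrakk>k \<in> carrier K; (t, t') \<in> lie_cong K G d R\<rbrakk> \<Longrightarrow>
    (Smult k t, Smult k t') \<in> lie_cong K G d R"
| cong_br: "\<lbrakk>(s, s') \<in> lie_cong K G d R; (t, t') \<in> lie_cong K G d R\<rbrakk> \<Longrightarrow>
    (Br s t, Br s' t') \<in> lie_cong K G d R"
| add_assoc: "\<lbrakk>s \<in> lie_terms K G; t \<in> lie_terms K G; u \<in> lie_terms K G\<rbrakk> \<Longrightarrow>
    (Add (Add s t) u, Add s (Add t u)) \<in> lie_cong K G d R"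
| add_comm: "\<lbrakk>s \<in> lie_terms K G; t \<in> lie_terms K G\<rbrakk> \<Longrightarrow> (Add s t, Add t s) \<in> lie_cong K G d R"
| add_zero: "t \<in> lie_terms K G \<Longrightarrow> (Add t Zero, t) \<in> lie_cong K G d R"
| add_neg: "t \<in> lie_terms K G \<Longrightarrow> (Add t (Smult (\<ominus>\<^bsub>K\<^esub> \<one>\<^bsub>K\<^esub>) t), Zero) \<in> lie_cong K G d R"
| smult_add_left: "\<lbrakk>k \<in> carrier K; l \<in> carrier K; t \<in> lie_terms K G\<rbrakk> \<Longrightarrow>
    (Smult (k \<oplus>\<^bsub>K\<^esub> l) t, Add (Smult k t) (Smult l t)) \<in> lie_cong K G d R"
| smult_add_right: "\<lbrakk>k \<in> carrier K; s \<in> lie_terms K G; t \<in> lie_terms K G\<rbrakk> \<Longrightarrow>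
    (Smult k (Add s t), Add (Smult k s) (Smult k t)) \<in> lie_cong K G d R"
| smult_smult: "\<lbrakk>k \<in> carrier K; l \<in> carrier K; t \<in> lie_terms K G\<rbrakk> \<Longrightarrow>
    (Smult (k \<otimes>\<^bsub>K\<^esub> l) t, Smult k (Smult l t)) \<in> lie_cong K G d R"
| smult_one: "t \<in> lie_terms K G \<Longrightarrow> (Smult \<one>\<^bsub>K\<^esub> t, t) \<in> lie_cong K G d R"
| br_add_left: "\<lbrakk>s \<in> lie_terms K G; t \<in> lie_terms K G; u \<in> lie_terms K G\<rbrakk> \<Longrightarrow>
    (Br (Add s t) u, Add (Br s u) (Br t u)) \<in> lie_cong K G d R"
| br_add_right: "\<lbrakk>s \<in> lie_terms K G; t \<in> lie_terms K G; u \<in> lie_terms K G\<rbrakk> \<Longrightarrow>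
    (Br s (Add t u), Add (Br s t) (Br s u)) \<in> lie_cong K G d R"
| br_smult_left: "\<lbrakk>k \<in> carrier K; s \<in> lie_terms K G; t \<in> lie_terms K G\<rbrakk> \<Longrightarrow>
    (Br (Smult k s) t, Smult k (Br s t)) \<in> lie_cong K G d R"
| br_smult_right: "\<lbrakk>k \<in> carrier K; s \<in> lie_terms K G; t \<in> lie_terms K G\<rbrakk> \<Longrightarrow>
    (Br s (Smult k t), Smult k (Br s t)) \<in> lie_cong K G d R"
| skew: "\<lbrakk>homog_term K G d p s; homog_term K G d q t\<rbrakk> \<Longrightarrow>
    (Br s t, Smult (\<ominus>\<^bsub>K\<^esub> ksign K (p * q)) (Br t s)) \<in> lie_cong K G d R"
| alternating: "homog_term K G d 0 t \<Longrightarrow> (Br t t, Zero) \<in> lie_cong K G d R"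
| jacobi: "\<lbrakk>homog_term K G d p s; homog_term K G d q t; homog_term K G d r u\<rbrakk> \<Longrightarrow>
    (Add (Smult (ksign K (p * r)) (Br (Br s t) u))
      (Add (Smult (ksign K (p * q)) (Br (Br t u) s))
        (Smult (ksign K (q * r)) (Br (Br u s) t))), Zero) \<in> lie_cong K G d R"

text \<open>The generators are homogeneous, so the class of a homogeneous term is homogeneous; the relations
  in \<open>R\<close> are meant to relate homogeneous terms of equal degree.\<close>

definition presented_lie_superalgebra ::
    "('k, 'y) ring_scheme \<Rightarrow> 'x set \<Rightarrow> ('x \<Rightarrow> bit) \<Rightarrow> (('k, 'x) lie_term \<times> ('k, 'x) lie_term) set \<Rightarrow>
      ('k, ('k, 'x) lie_term set) supermodule"
  where "presented_lie_superalgebra K G d R = (let r = lie_cong K G d R in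
    \<lparr>carrier = lie_terms K G // r,
     mult = (\<lambda>S T. \<Union>s\<in>S. \<Union>t\<in>T. r `` {Br s t}),
     one = undefined,
     zero = r `` {Zero},
     add = (\<lambda>S T. \<Union>s\<in>S. \<Union>t\<in>T. r `` {Add s t}),
     smult = (\<lambda>k T. \<Union>t\<in>T. r `` {Smult k t}),
     grade = (\<lambda>p. {r `` {t} |t. homog_term K G d p t})\<rparr>)"


section \<open>The Steinberg Lie superalgebra \<open>st(2,2,A)\<close>\<close>

abbreviation idx :: "nat set"
  where "idx \<equiv> {1..4}"

definition ipar :: "nat \<Rightarrow> bit"
  where "ipar i = (if i \<le> 2 then 0 else 1)"

text \<open>The generator \<open>(i, j, p, a)\<close> stands for \<open>F\<^sub>i\<^sub>j(a)\<close> with \<open>a\<close> homogeneous of degree \<open>p\<close>. The degree is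
  recorded because \<open>0\<close> is homogeneous of both degrees.\<close>

type_synonym 'a st_gen = "nat \<times> nat \<times> bit \<times> 'a"

definition st_gens :: "('k, 'a, 'z) supermodule_scheme \<Rightarrow> 'a st_gen set"
  where "st_gens A = {(i, j, p, a). i \<in> idx \<and> j \<in> idx \<and> i \<noteq> j \<and> a \<in> grade A p}"

fun st_deg :: "'a st_gen \<Rightarrow> bit"
  where "st_deg (i, j, p, a) = ipar i + ipar j + p"

inductive_set st_rels ::
    "('k, 'y) ring_scheme \<Rightarrow> ('k, 'a, 'z) supermodule_scheme \<Rightarrow>
      (('k, 'a st_gen) lie_term \<times> ('k, 'a st_gen) lie_term) set"
  for K and A where
  gen_add: "\<lbrakk>i \<in> idx; j \<in> idx; i \<noteq> j; a \<in> grade A p; b \<in> grade A p\<rbrakk> \<Longrightarrow>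
    (Gen (i, j, p, a \<oplus>\<^bsub>A\<^esub> b), Add (Gen (i, j, p, a)) (Gen (i, j, p, b))) \<in> st_rels K A"
| gen_smult: "\<lbrakk>i \<in> idx; j \<in> idx; i \<noteq> j; k \<in> carrier K; a \<in> grade A p\<rbrakk> \<Longrightarrow>
    (Gen (i, j, p, k \<odot>\<^bsub>A\<^esub> a), Smult k (Gen (i, j, p, a))) \<in> st_rels K A"
| br_chain: "\<lbrakk>i \<in> idx; j \<in> idx; k \<in> idx; distinct [i, j, k]; a \<in> grade A p; b \<in> grade A q\<rbrakk> \<Longrightarrow>
    (Br (Gen (i, j, p, a)) (Gen (j, k, q, b)), Gen (i, k, p + q, a \<otimes>\<^bsub>A\<^esub> b)) \<in> st_rels K A"
| br_zero: "\<lbrakk>i \<in> idx; j \<in> idx; i \<noteq> j; k \<in> idx; l \<in> idx; k \<noteq> l; j \<noteq> k; i \<noteq> l;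
      a \<in> grade A p; b \<in> grade A q\<rbrakk> \<Longrightarrow>
    (Br (Gen (i, j, p, a)) (Gen (k, l, q, b)), Zero) \<in> st_rels K A"

type_synonym ('k, 'a) st_elem = "('k, 'a st_gen) lie_term set"

definition st22 ::
    "('k, 'y) ring_scheme \<Rightarrow> ('k, 'a, 'z) supermodule_scheme \<Rightarrow> ('k, ('k, 'a) st_elem) supermodule"
  where "st22 K A = presented_lie_superalgebra K (st_gens A) st_deg (st_rels K A)"

definition stF ::
    "('k, 'y) ring_scheme \<Rightarrow> ('k, 'a, 'z) supermodule_scheme \<Rightarrow> nat \<Rightarrow> nat \<Rightarrow> bit \<Rightarrow> 'a \<Rightarrow>
      ('k, 'a) st_elem"
  where "stF K A i j p a = lie_cong K (st_gens A) st_deg (st_rels K A) `` {Gen (i, j, p, a)}"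

definition stH ::
    "('k, 'y) ring_scheme \<Rightarrow> ('k, 'a, 'z) supermodule_scheme \<Rightarrow> ('k, 'a) st_elem set"
  where "stH K A = lie_generated K (st22 K A)
    {bracket (st22 K A) (stF K A i j p a) (stF K A j i q b) | i j p a q b.
      i \<in> idx \<and> j \<in> idx \<and> i \<noteq> j \<and> a \<in> grade A p \<and> b \<in> grade A q}"


section \<open>The module \<open>W\<close>\<close>

text \<open>All generators below may be taken homogeneous, so the generated ideal is graded.\<close>

definition super_comm_ideal :: "nat \<Rightarrow> ('k, 'a, 'z) supermodule_scheme \<Rightarrow> 'a set"
  where "super_comm_ideal r A = Idl\<^bsub>A\<^esub> ({[r] \<cdot>\<^bsub>A\<^esub> a | a. a \<in> carrier A} \<union>
    {a \<otimes>\<^bsub>A\<^esub> b \<ominus>\<^bsub>A\<^esub> [ksgn (p * q)] \<cdot>\<^bsub>A\<^esub> (b \<otimes>\<^bsub>A\<^esub> a) | a b p q. a \<in> grade A p \<and> b \<in> grade A q})"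

definition super_quot :: "('k, 'a, 'z) supermodule_scheme \<Rightarrow> 'a set \<Rightarrow> ('k, 'a set) supermodule"
  where "super_quot A I = \<lparr>
    carrier = carrier (A Quot I),
    mult = mult (A Quot I),
    one = one (A Quot I),
    zero = zero (A Quot I),
    add = add (A Quot I),
    smult = (\<lambda>k S. \<Union>a\<in>S. I +>\<^bsub>A\<^esub> (k \<odot>\<^bsub>A\<^esub> a)),
    grade = (\<lambda>p. {I +>\<^bsub>A\<^esub> a | a. a \<in> grade A p})\<rparr>"

definition Aquot :: "nat \<Rightarrow> ('k, 'a, 'z) supermodule_scheme \<Rightarrow> ('k, 'a set) supermodule"
  where "Aquot r A = super_quot A (super_comm_ideal r A)"

text \<open>\<open>Wsummand A r\<close> is the \<open>r\<close>-th summand of \<open>W\<close>, which is \<open>A\<^sub>2\<close> for \<open>r = 1, \<dots>, 4\<close> and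
  \<open>A\<^sub>0\<close> for \<open>r = 5, 6\<close>.\<close>

definition Wsummand :: "('k, 'a, 'z) supermodule_scheme \<Rightarrow> nat \<Rightarrow> ('k, 'a set) supermodule"
  where "Wsummand A r = Aquot (if r \<le> 4 then 2 else 0) A"

definition Wmod :: "('k, 'a, 'z) supermodule_scheme \<Rightarrow> ('k, nat \<Rightarrow> 'a set) supermodule"
  where "Wmod A = \<lparr>
    carrier = (\<Pi>\<^sub>E r\<in>{1..6}. carrier (Wsummand A r)),
    mult = undefined,
    one = undefined,
    zero = (\<lambda>r\<in>{1..6}. \<zero>\<^bsub>Wsummand A r\<^esub>),
    add = (\<lambda>v w. \<lambda>r\<in>{1..6}. v r \<oplus>\<^bsub>Wsummand A r\<^esub> w r),
    smult = (\<lambda>k w. \<lambda>r\<in>{1..6}. k \<odot>\<^bsub>Wsummand A r\<^esub> w r),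
    grade = (\<lambda>p. \<Pi>\<^sub>E r\<in>{1..6}. grade (Wsummand A r) p)\<rparr>"

definition Winj :: "('k, 'a, 'z) supermodule_scheme \<Rightarrow> nat \<Rightarrow> 'a set \<Rightarrow> nat \<Rightarrow> 'a set"
  where "Winj A r x = (\<lambda>s\<in>{1..6}. if s = r then x else \<zero>\<^bsub>Wsummand A s\<^esub>)"

definition Wclass :: "('k, 'a, 'z) supermodule_scheme \<Rightarrow> nat \<Rightarrow> 'a \<Rightarrow> 'a set"
  where "Wclass A r a = super_comm_ideal (if r \<le> 4 then 2 else 0) A +>\<^bsub>A\<^esub> a"


section \<open>The cocycle and the extension\<close>

type_synonym quad = "nat \<times> nat \<times> nat \<times> nat"

fun quad_coset :: "quad \<Rightarrow> quad set"
  where "quad_coset (i, j, k, l) = {(i, j, k, l), (k, j, i, l), (i, l, k, j), (k, l, i, j)}"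

text \<open>The order of the first four classes is an arbitrary choice.\<close>

definition quad_class :: "nat \<Rightarrow> quad set"
  where "quad_class r =
    (if r = 1 then quad_coset (1, 2, 3, 4)
     else if r = 2 then quad_coset (1, 2, 4, 3)
     else if r = 3 then quad_coset (2, 1, 3, 4)
     else if r = 4 then quad_coset (2, 1, 4, 3)
     else if r = 5 then quad_coset (1, 3, 2, 4)
     else if r = 6 then quad_coset (3, 1, 4, 2)
     else {})"

definition quad_theta :: "quad \<Rightarrow> nat"
  where "quad_theta t = (THE r. t \<in> quad_class r)"

definition quad_sigma :: "quad \<Rightarrow> int"
  where "quad_sigma t =
    (if t \<in> {(1, 4, 2, 3), (2, 3, 1, 4), (3, 2, 4, 1), (4, 1, 3, 2)} then - 1 else 1)"

definition is_psi ::
    "('k, 'y) ring_scheme \<Rightarrow> ('k, 'a, 'z) supermodule_scheme \<Rightarrow>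
      (('k, 'a) st_elem \<Rightarrow> ('k, 'a) st_elem \<Rightarrow> nat \<Rightarrow> 'a set) \<Rightarrow> bool"
  where "is_psi K A \<psi> \<longleftrightarrow> (let L = st22 K A; W = Wmod A in
    (\<forall>x\<in>carrier L. \<forall>y\<in>carrier L. \<psi> x y \<in> carrier W) \<and>
    (\<forall>x\<in>carrier L. \<forall>y\<in>carrier L. \<forall>z\<in>carrier L.
      \<psi> (x \<oplus>\<^bsub>L\<^esub> y) z = \<psi> x z \<oplus>\<^bsub>W\<^esub> \<psi> y z \<and> \<psi> x (y \<oplus>\<^bsub>L\<^esub> z) = \<psi> x y \<oplus>\<^bsub>W\<^esub> \<psi> x z) \<and>
    (\<forall>k\<in>carrier K. \<forall>x\<in>carrier L. \<forall>y\<in>carrier L.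
      \<psi> (k \<odot>\<^bsub>L\<^esub> x) y = k \<odot>\<^bsub>W\<^esub> \<psi> x y \<and> \<psi> x (k \<odot>\<^bsub>L\<^esub> y) = k \<odot>\<^bsub>W\<^esub> \<psi> x y) \<and>
    (\<forall>i\<in>idx. \<forall>j\<in>idx. \<forall>k\<in>idx. \<forall>l\<in>idx. \<forall>p q. \<forall>a\<in>grade A p. \<forall>b\<in>grade A q.
      i \<noteq> j \<longrightarrow> k \<noteq> l \<longrightarrow>
      \<psi> (stF K A i j p a) (stF K A k l q b) =
        (if \<not> distinct [i, j, k, l] then \<zero>\<^bsub>W\<^esub>
         else let t = (i, j, k, l); r = quad_theta t; w = Winj A r (Wclass A r (a \<otimes>\<^bsub>A\<^esub> b))
           in if r \<le> 4 then w else [(ksgn q * quad_sigma t)] \<cdot>\<^bsub>W\<^esub> w)) \<and>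
    (\<forall>x\<in>carrier L. \<forall>y\<in>carrier L. x \<in> stH K A \<or> y \<in> stH K A \<longrightarrow> \<psi> x y = \<zero>\<^bsub>W\<^esub>))"

text \<open>Such a map exists, and its values on the carrier are unique, because \<open>st(2,2,A)\<close> is the direct sum of
  \<open>H\<close> and the modules \<open>F\<^sub>i\<^sub>j(A) \<cong> A\<close>.\<close>

definition st_psi ::
    "('k, 'y) ring_scheme \<Rightarrow> ('k, 'a, 'z) supermodule_scheme \<Rightarrow>
      ('k, 'a) st_elem \<Rightarrow> ('k, 'a) st_elem \<Rightarrow> nat \<Rightarrow> 'a set"
  where "st_psi K A = (SOME \<psi>. is_psi K A \<psi>)"

definition st22_sharp ::
    "('k, 'y) ring_scheme \<Rightarrow> ('k, 'a, 'z) supermodule_scheme \<Rightarrow>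
      ('k, ('k, 'a) st_elem \<times> (nat \<Rightarrow> 'a set)) supermodule"
  where "st22_sharp K A = (let L = st22 K A; W = Wmod A in
    \<lparr>carrier = carrier L \<times> carrier W,
     mult = (\<lambda>(x, v) (y, w). (bracket L x y, st_psi K A x y)),
     one = undefined,
     zero = (\<zero>\<^bsub>L\<^esub>, \<zero>\<^bsub>W\<^esub>),
     add = (\<lambda>(x, v) (y, w). (x \<oplus>\<^bsub>L\<^esub> y, v \<oplus>\<^bsub>W\<^esub> w)),
     smult = (\<lambda>k (x, v). (k \<odot>\<^bsub>L\<^esub> x, k \<odot>\<^bsub>W\<^esub> v)),
     grade = (\<lambda>p. grade L p \<times> grade W p)\<rparr>)"

end

theory Submission
  imports Defs
begin

text \<open>
  The Steinberg Lie superalgebra \<open>L\<close> is generated by the root elements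
  \<open>F\<^sub>i\<^sub>j(a)\<close>, and every one of them is a bracket of two others:
  \<open>F\<^sub>i\<^sub>j(a) = [F\<^sub>i\<^sub>k(a), F\<^sub>k\<^sub>j(1)]\<close>. In a central
  extension \<open>\<tau>: M \<rightarrow> L\<close> the bracket of two elements depends only on
  their images (\<open>beta_eq\<close>). The brackets of lifts of
  \<open>F\<^sub>i\<^sub>k(a)\<close> and \<open>F\<^sub>k\<^sub>j(1)\<close> are therefore
  canonical lifts of the root elements, and the Jacobi identity shows that they satisfy all
  defining relations but one: for four distinct indices the bracket of lifts of
  \<open>F\<^sub>i\<^sub>j(a)\<close> and \<open>F\<^sub>k\<^sub>l(b)\<close> is a central element
  that need not vanish.

  The Jacobi identity also determines how this element can behave. Splitting one root element
  through an index of the other exchanges the rows \<open>i, k\<close> or the columns \<open>j,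
  l\<close>. Up to known signs the element thus depends only on the class of \<open>(i, j, k,
  l)\<close> and on the product \<open>a b\<close> (\<open>beta_quad\<close>), it is unchanged
  when neighbouring factors of a product are exchanged (\<open>quad_bracket_trace\<close>), and it
  is killed by 2 if the two rows have different parity (\<open>quad_bracket_torsion\<close>).
  These are the relations of the six summands of \<open>W\<close>, four copies of
  \<open>A\<^sub>2\<close> and two copies of \<open>A\<^sub>0\<close>
  (\<open>quad_inv_ideal\<close>).

  That these relations are the only ones amounts to \<open>\<psi>\<close> being a cocycle.
  Sending \<open>F\<^sub>i\<^sub>j(a)\<close> to a matrix unit represents \<open>L\<close> by
  supermatrices over \<open>A\<close>, whose supertraces vanish in the supercommutative quotients
  \<open>A\<^sub>2\<close> and \<open>A\<^sub>0\<close> (\<open>mat_rep_supertraceless\<close>).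
  Under this representation the component of \<open>\<psi>\<close> for a class with rows
  \<open>{i, k}\<close> and columns \<open>{j, l}\<close> is the polarised determinant of the
  two-by-two block with these rows and columns. Multiplying a block by a matrix on either side
  changes its determinant, to first order, by the trace of that matrix. Hence the cocycle identity
  reduces to the vanishing of the supertrace (\<open>block_cocycle\<close>). In the last two
  classes the blocks are homogeneous, which controls the signs; in the first four there are no
  signs, because \<open>2 = 0\<close>. The matrix formula gives \<open>\<psi>\<close> because
  \<open>L\<close> is spanned by \<open>H\<close>, which acts by diagonal matrices, and the root
  spaces (\<open>st_span\<close>).

  For the universal property, a Lie word in the root elements is evaluated both in the extension by
  \<open>W\<close> and in \<open>M\<close>. Words that agree in \<open>L\<close> have values that
  differ by a point on the graph of a map from \<open>W\<close> to the centre of \<open>M\<close>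
  (\<open>cong_central_graph\<close>). So words that agree in the extension agree in
  \<open>M\<close>, and sending the first value to the second is a homomorphism. It is defined
  everywhere because the root elements generate the extension: the values of \<open>\<psi>\<close>
  fill \<open>W\<close>. It is unique because a homomorphism over \<open>L\<close> is forced on
  brackets of lifts.
\<close>

section \<open>Signs and homogeneous components\<close>

text \<open>The default rewriting of sums and products of bits into Boolean operations would hide
  the exponents of \<open>-1\<close>.\<close>

declare add_bit_eq_xor [simp del] mult_bit_eq_and [simp del]

lemma bit_add_self [simp]: "(p::bit) + p = 0"
  by (cases p) simp_all

lemma bit_add_self_left [simp]: "(p::bit) + (p + q) = q"
  by (cases p; cases q) simp_all

text \<open>The sign \<open>(-1)\<^sup>p\<close> acting on a module. Keeping \<open>p\<close> as
  an argument, instead of an integer coefficient, lets exponents be added and compared in the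
  field of two elements.\<close>

definition sg :: "('m, 'z) ring_scheme \<Rightarrow> bit \<Rightarrow> 'm \<Rightarrow> 'm"
  where "sg M p x = (if p = 0 then x else \<ominus>\<^bsub>M\<^esub> x)"

lemma sg_0 [simp]: "sg M 0 x = x"
  by (simp add: sg_def)

lemma sg_1: "sg M 1 x = \<ominus>\<^bsub>M\<^esub> x"
  by (simp add: sg_def)

context abelian_group
begin

lemma ksgn_pow: "x \<in> carrier G \<Longrightarrow> [ksgn p] \<cdot> x = sg G p x"
  by (cases p) (auto simp: ksgn_def sg_def add.int_pow_neg)

lemma sg_closed [simp, intro]: "x \<in> carrier G \<Longrightarrow> sg G p x \<in> carrier G"
  by (simp add: sg_def)

lemma sg_sg [simp]: "x \<in> carrier G \<Longrightarrow> sg G p (sg G q x) = sg G (p + q) x"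
  by (cases p; cases q) (auto simp: sg_def)

lemma sg_add: "\<lbrakk>x \<in> carrier G; y \<in> carrier G\<rbrakk> \<Longrightarrow> sg G p (x \<oplus> y) = sg G p x \<oplus> sg G p y"
  by (cases p) (auto simp: sg_def minus_add a_comm)

lemma sg_zero [simp]: "sg G p \<zero> = \<zero>"
  by (simp add: sg_def)

lemma minus_sg: "x \<in> carrier G \<Longrightarrow> \<ominus> sg G p x = sg G (p + 1) x"
  by (cases p) (auto simp: sg_def)

lemma sg_cancel: "x \<in> carrier G \<Longrightarrow> sg G p x \<oplus> sg G (p + 1) x = \<zero>"
  by (cases p) (auto simp: sg_def r_neg l_neg)

lemma sg_eq_iff: "\<lbrakk>x \<in> carrier G; y \<in> carrier G\<rbrakk> \<Longrightarrow> sg G p x = y \<longleftrightarrow> x = sg G p y"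
  by (cases p) (auto simp: sg_def)

lemma eq_minus_iff: "\<lbrakk>x \<in> carrier G; y \<in> carrier G\<rbrakk> \<Longrightarrow> x \<ominus> y = \<zero> \<longleftrightarrow> x = y"
  by (metis a_minus_def minus_equality minus_minus r_neg a_inv_closed)

end

text \<open>The other degree is written \<open>p + 1\<close>, so that one definition serves both
  components.\<close>

definition gpart :: "('k, 'm, 'z) supermodule_scheme \<Rightarrow> bit \<Rightarrow> 'm \<Rightarrow> 'm"
  where "gpart M p x = (THE y. y \<in> grade M p \<and> (\<exists>z\<in>grade M (p + 1). x = y \<oplus>\<^bsub>M\<^esub> z))"

text \<open>The difference of two decompositions of one element is homogeneous of both degrees, so
  a trivial intersection already forces uniqueness.\<close>

lemma graded_moduleI:
  assumes "module K M" and sub: "\<And>p. submodule (grade M p) K M"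
    and ex: "\<And>x. x \<in> carrier M \<Longrightarrow> \<exists>y\<in>grade M 0. \<exists>z\<in>grade M 1. x = y \<oplus>\<^bsub>M\<^esub> z"
    and disj: "\<And>y. \<lbrakk>y \<in> grade M 0; y \<in> grade M 1\<rbrakk> \<Longrightarrow> y = \<zero>\<^bsub>M\<^esub>"
  shows "graded_module K M"
proof -
  interpret module K M by fact
  note E = submoduleE[OF sub]
  have uniq: "y = y' \<and> z = z'" if "y \<in> grade M 0" "z \<in> grade M 1" "y' \<in> grade M 0" "z' \<in> grade M 1"
     "y \<oplus>\<^bsub>M\<^esub> z = y' \<oplus>\<^bsub>M\<^esub> z'" for y z y' z'
  proof -
    have c: "y \<in> carrier M" "z \<in> carrier M" "y' \<in> carrier M" "z' \<in> carrier M"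
      using that E(1) by blast+
    have eq: "y \<ominus>\<^bsub>M\<^esub> y' = z' \<ominus>\<^bsub>M\<^esub> z"
    proof -
      have "y \<ominus>\<^bsub>M\<^esub> y' = ((y \<oplus>\<^bsub>M\<^esub> z) \<ominus>\<^bsub>M\<^esub> z) \<ominus>\<^bsub>M\<^esub> y'"
        using c by (simp add: a_minus_def M.a_assoc M.r_neg)
      also have "\<dots> = ((y' \<oplus>\<^bsub>M\<^esub> z') \<ominus>\<^bsub>M\<^esub> z) \<ominus>\<^bsub>M\<^esub> y'" using that by simp
      also have "\<dots> = (z' \<ominus>\<^bsub>M\<^esub> z) \<oplus>\<^bsub>M\<^esub> (y' \<ominus>\<^bsub>M\<^esub> y')"
        using c by (simp add: a_minus_def M.a_ac)
      also have "\<dots> = z' \<ominus>\<^bsub>M\<^esub> z" using c by (simp add: a_minus_def M.r_neg)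
      finally show ?thesis .
    qed
    have "y \<ominus>\<^bsub>M\<^esub> y' \<in> grade M 0" "z' \<ominus>\<^bsub>M\<^esub> z \<in> grade M 1"
      using that E by (auto simp: a_minus_def)
    then have "y \<ominus>\<^bsub>M\<^esub> y' = \<zero>\<^bsub>M\<^esub>" "z' \<ominus>\<^bsub>M\<^esub> z = \<zero>\<^bsub>M\<^esub>"
      using eq disj by auto
    then show ?thesis using c by (simp add: M.eq_minus_iff)
  qed
  show ?thesis
  proof (intro graded_module.intro graded_module_axioms.intro)
    fix x assume "x \<in> carrier M"
    from ex[OF this] obtain y z where "y \<in> grade M 0" "z \<in> grade M 1" "x = y \<oplus>\<^bsub>M\<^esub> z" by blast
    then show "\<exists>!(y, z). y \<in> grade M 0 \<and> z \<in> grade M 1 \<and> x = y \<oplus>\<^bsub>M\<^esub> z"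
      by (intro ex1I[of _ "(y, z)"]) (auto dest: uniq)
  qed (use sub \<open>module K M\<close> in auto)
qed

context graded_module
begin

lemmas grade_submoduleE = submoduleE[OF grade_submodule]

lemma grade_carrier: "x \<in> grade M p \<Longrightarrow> x \<in> carrier M"
  using grade_submoduleE(1) by blast

lemma grade_zero [simp]: "\<zero>\<^bsub>M\<^esub> \<in> grade M p"
proof -
  obtain x where x: "x \<in> grade M p" using grade_submoduleE(2) by blast
  then have "\<zero>\<^bsub>K\<^esub> \<odot>\<^bsub>M\<^esub> x \<in> grade M p" by (intro grade_submoduleE(4)) auto
  then show ?thesis using grade_carrier[OF x] by simp
qed

lemma grade_add [simp]: "\<lbrakk>x \<in> grade M p; y \<in> grade M p\<rbrakk> \<Longrightarrow> x \<oplus>\<^bsub>M\<^esub> y \<in> grade M p"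
  by (rule grade_submoduleE(5))

lemma grade_smult [simp]: "\<lbrakk>k \<in> carrier K; y \<in> grade M p\<rbrakk> \<Longrightarrow> k \<odot>\<^bsub>M\<^esub> y \<in> grade M p"
  by (rule grade_submoduleE(4))

lemma grade_minus [simp]: "x \<in> grade M p \<Longrightarrow> \<ominus>\<^bsub>M\<^esub> x \<in> grade M p"
  by (rule grade_submoduleE(3))

lemma grade_sg [simp]: "x \<in> grade M p \<Longrightarrow> sg M q x \<in> grade M p"
  by (simp add: sg_def)

lemma gpart_unique:
  assumes "y \<in> grade M p" "z \<in> grade M (p + 1)" "x = y \<oplus>\<^bsub>M\<^esub> z"
  shows "gpart M p x = y"
proof -
  note c = assms(1,2)[THEN grade_carrier]
  have x: "x \<in> carrier M" using c assms(3) by simp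
  obtain w where w: "\<And>a b. \<lbrakk>a \<in> grade M 0; b \<in> grade M 1; x = a \<oplus>\<^bsub>M\<^esub> b\<rbrakk> \<Longrightarrow> (a, b) = w"
    using grade_direct_sum[OF x] by blast
  have "y' = y" if h: "y' \<in> grade M p" "z' \<in> grade M (p + 1)" "x = y' \<oplus>\<^bsub>M\<^esub> z'" for y' z'
  proof (cases p)
    case zero
    then have "(y, z) = w" "(y', z') = w" using assms h by (auto intro!: w simp del: bit_not_zero_iff)
    then show ?thesis by auto
  next
    case one
    have "x = z \<oplus>\<^bsub>M\<^esub> y" "x = z' \<oplus>\<^bsub>M\<^esub> y'"
      using M.a_comm[OF c] M.a_comm[OF h(1,2)[THEN grade_carrier]] assms(3) h(3) by (simp_all only:)
    moreover have "z \<in> grade M 0" "y \<in> grade M 1" "z' \<in> grade M 0" "y' \<in> grade M 1"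
      using assms(1,2) h(1,2) one by simp_all
    ultimately have "(z, y) = w" "(z', y') = w" using w by blast+
    then show ?thesis by auto
  qed
  then show ?thesis unfolding gpart_def using assms(3) c by - (rule the_equality, use assms(1,2) in blast, blast)
qed

lemma gpart_decomp: 
  assumes "x \<in> carrier M"
  shows "gpart M p x \<in> grade M p" "gpart M 0 x \<oplus>\<^bsub>M\<^esub> gpart M 1 x = x"
proof -
  from grade_direct_sum[OF assms] obtain y z where
    yz: "y \<in> grade M 0" "z \<in> grade M 1" "x = y \<oplus>\<^bsub>M\<^esub> z" by auto
  note c = yz(1,2)[THEN grade_carrier]
  have 0: "gpart M 0 x = y" by (rule gpart_unique[OF yz(1) _ yz(3)]) (simp add: yz(2))
  have 1: "gpart M 1 x = z" 
    by (rule gpart_unique[of z 1 y]) (use yz(1,2) M.a_comm[OF c] yz(3) in simp_all)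
  show "gpart M p x \<in> grade M p" using yz(1,2) by (cases p) (simp_all add: 0 1)
  show "gpart M 0 x \<oplus>\<^bsub>M\<^esub> gpart M 1 x = x" unfolding 0 1 by (rule yz(3)[symmetric])
qed

lemma gpart_grade [simp]: "x \<in> carrier M \<Longrightarrow> gpart M p x \<in> grade M p"
  by (rule gpart_decomp)

lemma gpart_closed [simp]: "x \<in> carrier M \<Longrightarrow> gpart M p x \<in> carrier M"
  using gpart_grade grade_carrier by blast

lemma gpart_decomp': "x \<in> carrier M \<Longrightarrow> gpart M p x \<oplus>\<^bsub>M\<^esub> gpart M (p + 1) x = x"
  using gpart_decomp(2)[of x] M.a_comm[OF gpart_closed gpart_closed, of x x 0 1]
  by (cases p) simp_all

lemma gpart_homog:
  assumes "x \<in> grade M q"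
  shows "gpart M p x = (if p = q then x else \<zero>\<^bsub>M\<^esub>)"
proof (cases "p = q")
  case True
  then show ?thesis
    using gpart_unique[of x p "\<zero>\<^bsub>M\<^esub>"] assms grade_carrier[OF assms] by simp
next
  case False
  then have "q = p + 1" by (cases p; cases q) simp_all
  with False show ?thesis
    using gpart_unique[of "\<zero>\<^bsub>M\<^esub>" p x] assms grade_carrier[OF assms] by simp
qed

lemma gpart_add:
  assumes [simp]: "x \<in> carrier M" "y \<in> carrier M"
  shows "gpart M p (x \<oplus>\<^bsub>M\<^esub> y) = gpart M p x \<oplus>\<^bsub>M\<^esub> gpart M p y"
proof (rule gpart_unique)
  show "x \<oplus>\<^bsub>M\<^esub> y = gpart M p x \<oplus>\<^bsub>M\<^esub> gpart M p y \<oplus>\<^bsub>M\<^esub> (gpart M (p + 1) x \<oplus>\<^bsub>M\<^esub> gpart M (p + 1) y)"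
  proof -
    have "x \<oplus>\<^bsub>M\<^esub> y = (gpart M p x \<oplus>\<^bsub>M\<^esub> gpart M (p + 1) x) \<oplus>\<^bsub>M\<^esub> (gpart M p y \<oplus>\<^bsub>M\<^esub> gpart M (p + 1) y)"
      by (simp only: gpart_decomp' assms)
    then show ?thesis by (simp only: M.a_ac gpart_closed assms M.a_closed)
  qed
qed simp_all

lemma gpart_smult:
  assumes [simp]: "k \<in> carrier K" "x \<in> carrier M"
  shows "gpart M p (k \<odot>\<^bsub>M\<^esub> x) = k \<odot>\<^bsub>M\<^esub> gpart M p x"
proof (rule gpart_unique)
  show "k \<odot>\<^bsub>M\<^esub> x = k \<odot>\<^bsub>M\<^esub> gpart M p x \<oplus>\<^bsub>M\<^esub> k \<odot>\<^bsub>M\<^esub> gpart M (p + 1) x"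
    using gpart_decomp'[of x p] by (simp del: bit_add_self flip: smult_r_distr)
qed simp_all

lemma smult_sg: "\<lbrakk>k \<in> carrier K; x \<in> carrier M\<rbrakk> \<Longrightarrow> k \<odot>\<^bsub>M\<^esub> sg M p x = sg M p (k \<odot>\<^bsub>M\<^esub> x)"
  by (simp add: sg_def smult_r_minus)

lemma ksign_smult: "x \<in> carrier M \<Longrightarrow> ksign K p \<odot>\<^bsub>M\<^esub> x = sg M p x"
  by (cases p) (simp_all add: ksign_def R.ksgn_pow sg_def smult_l_minus)

lemma ksign_closed [simp]: "ksign K p \<in> carrier K"
  by (simp add: ksign_def)

end

section \<open>Lie superalgebras\<close>

context lie_superalgebra
begin

lemma bracket_zero_left [simp]: "x \<in> carrier L \<Longrightarrow> bracket L \<zero>\<^bsub>L\<^esub> x = \<zero>\<^bsub>L\<^esub>"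
  using bracket_smult_left[of "\<zero>\<^bsub>K\<^esub>" "\<zero>\<^bsub>L\<^esub>" x] bracket_closed by simp

lemma bracket_zero_right [simp]: "x \<in> carrier L \<Longrightarrow> bracket L x \<zero>\<^bsub>L\<^esub> = \<zero>\<^bsub>L\<^esub>"
  using bracket_smult_right[of "\<zero>\<^bsub>K\<^esub>" x "\<zero>\<^bsub>L\<^esub>"] bracket_closed by simp

lemma bracket_minus_left: "\<lbrakk>x \<in> carrier L; y \<in> carrier L\<rbrakk> \<Longrightarrow>
    bracket L (\<ominus>\<^bsub>L\<^esub> x) y = \<ominus>\<^bsub>L\<^esub> bracket L x y"
  using bracket_smult_left[of "\<ominus>\<^bsub>K\<^esub> \<one>\<^bsub>K\<^esub>" x y] bracket_closed by (simp add: smult_l_minus)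

lemma bracket_minus_right: "\<lbrakk>x \<in> carrier L; y \<in> carrier L\<rbrakk> \<Longrightarrow>
    bracket L x (\<ominus>\<^bsub>L\<^esub> y) = \<ominus>\<^bsub>L\<^esub> bracket L x y"
  using bracket_smult_right[of "\<ominus>\<^bsub>K\<^esub> \<one>\<^bsub>K\<^esub>" x y] bracket_closed by (simp add: smult_l_minus)

lemma bracket_sg_right: "\<lbrakk>x \<in> carrier L; y \<in> carrier L\<rbrakk> \<Longrightarrow>
    bracket L x (sg L p y) = sg L p (bracket L x y)"
  by (simp add: sg_def bracket_minus_right)

declare bracket_closed [simp, intro]

lemma skew: "\<lbrakk>x \<in> grade L p; y \<in> grade L q\<rbrakk> \<Longrightarrow> bracket L x y = sg L (p * q + 1) (bracket L y x)"
  using bracket_skew[of x p y q] grade_carrier[of x] grade_carrier[of y]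
  by (simp add: M.ksgn_pow M.minus_sg)

lemma jacobi:
  assumes "x \<in> grade L p" "y \<in> grade L q" "z \<in> grade L r"
  shows "sg L (p * r) (bracket L (bracket L x y) z) \<oplus>\<^bsub>L\<^esub>
      sg L (p * q) (bracket L (bracket L y z) x) \<oplus>\<^bsub>L\<^esub>
      sg L (q * r) (bracket L (bracket L z x) y) = \<zero>\<^bsub>L\<^esub>"
  using super_jacobi[OF assms] assms[THEN grade_carrier] by (simp add: M.ksgn_pow)

text \<open>The cyclic identity, solved for its first term: bracketing with a homogeneous element
  is a superderivation. All later computations use this form.\<close>

lemma jacobi_deriv:
  assumes x: "x \<in> grade L p" and y: "y \<in> grade L q" and z: "z \<in> grade L r"
  shows "bracket L (bracket L x y) z =
    bracket L x (bracket L y z) \<oplus>\<^bsub>L\<^esub> sg L (p * q + 1) (bracket L y (bracket L x z))"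
proof -
  have c[simp]: "x \<in> carrier L" "y \<in> carrier L" "z \<in> carrier L"
    using assms by (auto dest: grade_carrier)
  have 1: "bracket L (bracket L y z) x = sg L ((q + r) * p + 1) (bracket L x (bracket L y z))"
    using assms by (intro skew bracket_even)
  have a: "bracket L (bracket L z x) y = sg L ((r + p) * q + 1) (bracket L y (bracket L z x))"
    using assms by (intro skew bracket_even)
  have b: "bracket L z x = sg L (r * p + 1) (bracket L x z)" using assms by (intro skew)
  have 2: "bracket L (bracket L z x) y = sg L ((r + p) * q + 1 + (r * p + 1)) (bracket L y (bracket L x z))"
    by (subst a) (simp add: b bracket_sg_right)
  have J: "sg L (p * r) (bracket L (bracket L x y) z) \<oplus>\<^bsub>L\<^esub>
      (sg L (p * q + (q + r) * p + 1) (bracket L x (bracket L y z)) \<oplus>\<^bsub>L\<^esub>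
      sg L (q * r + (r + p) * q + 1 + r * p + 1) (bracket L y (bracket L x z))) = \<zero>\<^bsub>L\<^esub>"
    using jacobi[OF assms] by (simp add: 1 2 M.a_assoc add.assoc)
  define u v w where "u = bracket L (bracket L x y) z" and "v = bracket L x (bracket L y z)"
    and "w = bracket L y (bracket L x z)"
  have uvw: "u \<in> carrier L" "v \<in> carrier L" "w \<in> carrier L" by (auto simp: u_def v_def w_def)
  from J have "\<ominus>\<^bsub>L\<^esub> sg L (p * r) u = sg L (p * q + (q + r) * p + 1) v \<oplus>\<^bsub>L\<^esub>
      sg L (q * r + (r + p) * q + 1 + r * p + 1) w"
    unfolding u_def[symmetric] v_def[symmetric] w_def[symmetric]
    using uvw by (intro M.minus_equality) (auto simp: M.a_comm)
  then have "sg L (p * r + 1) (sg L (p * r + 1) u) = sg L (p * r + 1) (sg L (p * q + (q + r) * p + 1) v \<oplus>\<^bsub>L\<^esub>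
      sg L (q * r + (r + p) * q + 1 + r * p + 1) w)"
    using uvw by (simp add: M.minus_sg)
  then have "u = sg L (p * r + 1 + (p * q + (q + r) * p + 1)) v \<oplus>\<^bsub>L\<^esub>
     sg L (p * r + 1 + (q * r + (r + p) * q + 1 + r * p + 1)) w"
    using uvw by (simp add: M.sg_add)
  moreover have "p * r + 1 + (p * q + (q + r) * p + 1) = 0"
    "p * r + 1 + (q * r + (r + p) * q + 1 + r * p + 1) = p * q + 1"
    by (cases p; cases q; cases r; simp)+
  ultimately show ?thesis by (simp add: u_def v_def w_def add.commute)
qed

end

section \<open>Presented Lie superalgebras\<close>

text \<open>The homogeneous part of a term. A bracket is bilinear, so its part of degree
  \<open>p\<close> collects the brackets of parts whose degrees add up to \<open>p\<close>. The
  parts serve to show that the grading of a presented Lie superalgebra is direct.\<close>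

fun term_part :: "('x \<Rightarrow> bit) \<Rightarrow> bit \<Rightarrow> ('k, 'x) lie_term \<Rightarrow> ('k, 'x) lie_term"
  where "term_part d p (Gen x) = (if d x = p then Gen x else Zero)"
  | "term_part d p Zero = Zero"
  | "term_part d p (Add s t) = Add (term_part d p s) (term_part d p t)"
  | "term_part d p (Smult k t) = Smult k (term_part d p t)"
  | "term_part d p (Br s t) = Add (Br (term_part d 0 s) (term_part d p t)) (Br (term_part d 1 s) (term_part d (p + 1) t))"

locale lie_presentation =
  fixes K :: "('k, 'y) ring_scheme" and G :: "'x set" and d :: "'x \<Rightarrow> bit"
    and R :: "(('k, 'x) lie_term \<times> ('k, 'x) lie_term) set"
  assumes cring_K: "cring K"
    and rel_homog: "\<lbrakk>(s, t) \<in> R; s \<in> lie_terms K G; t \<in> lie_terms K G\<rbrakk> \<Longrightarrow>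
      \<exists>p. homog_term K G d p s \<and> homog_term K G d p t"
begin

abbreviation T where "T \<equiv> lie_terms K G"
abbreviation homog where "homog \<equiv> homog_term K G d"
abbreviation r where "r \<equiv> lie_cong K G d R"
abbreviation P where "P \<equiv> presented_lie_superalgebra K G d R"

definition cls where "cls t = r `` {t}"

sublocale R: cring K by (rule cring_K)

lemma ksign_closed [simp]: "ksign K p \<in> carrier K"
  by (simp add: ksign_def)

declare lie_terms.intros [simp, intro]

lemma homog_terms: "homog p t \<Longrightarrow> t \<in> T"
  by (induction rule: homog_term.induct) auto

lemma cong_terms: "(s, t) \<in> r \<Longrightarrow> s \<in> T \<and> t \<in> T"
proof (induction rule: lie_cong.induct)
  case (skew p s q t)
  then show ?case using skew[THEN homog_terms] by simp
next
  case (alternating t)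
  then show ?case using alternating[THEN homog_terms] by simp
next
  case (jacobi p s q t r u)
  then show ?case using jacobi[THEN homog_terms] by simp
qed simp_all

lemma equiv_cong: "equiv T r"
proof (rule equivI)
  show "r \<subseteq> T \<times> T" using cong_terms by auto
  show "refl_on T r" using cong_terms by (auto simp: refl_on_def intro: lie_cong.refl)
  show "sym r" by (auto simp: sym_def intro: lie_cong.sym)
  show "trans r" by (auto simp: trans_def intro: lie_cong.trans)
qed

lemma cls_eq_iff: "\<lbrakk>s \<in> T; t \<in> T\<rbrakk> \<Longrightarrow> cls s = cls t \<longleftrightarrow> (s, t) \<in> r"
  using eq_equiv_class_iff[OF equiv_cong] by (simp add: cls_def)

lemma cls_eqI: "(s, t) \<in> r \<Longrightarrow> cls s = cls t"
  using cls_eq_iff cong_terms by blast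

lemma carrier_P: "carrier P = cls ` T"
  by (auto simp: presented_lie_superalgebra_def Let_def cls_def quotient_def)

lemma cls_closed [simp]: "t \<in> T \<Longrightarrow> cls t \<in> carrier P"
  by (simp add: carrier_P)

lemma cls_cases:
  assumes "x \<in> carrier P" obtains t where "t \<in> T" "x = cls t"
  using assms by (auto simp: carrier_P)

lemma grade_P: "grade P p = {cls t |t. homog p t}"
  by (simp add: presented_lie_superalgebra_def Let_def cls_def)

lemma grade_P_I: "homog p t \<Longrightarrow> cls t \<in> grade P p"
  by (auto simp: grade_P)

lemma grade_P_E:
  assumes "x \<in> grade P p" obtains t where "homog p t" "x = cls t"
  using assms by (auto simp: grade_P)

lemma zero_P: "\<zero>\<^bsub>P\<^esub> = cls Zero"
  by (simp add: presented_lie_superalgebra_def Let_def cls_def)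

lemma add_P:
  assumes "s \<in> T" "t \<in> T" shows "cls s \<oplus>\<^bsub>P\<^esub> cls t = cls (Add s t)"
proof -
  have "congruent2 r r (\<lambda>s t. r `` {Add s t})"
    by (rule congruent2I') (rule equiv_class_eq[OF equiv_cong lie_cong.cong_add])
  from UN_equiv_class2[OF equiv_cong equiv_cong this assms] show ?thesis
    by (simp add: presented_lie_superalgebra_def cls_def Let_def)
qed

lemma br_P:
  assumes "s \<in> T" "t \<in> T" shows "bracket P (cls s) (cls t) = cls (Br s t)"
proof -
  have "congruent2 r r (\<lambda>s t. r `` {Br s t})"
    by (rule congruent2I') (rule equiv_class_eq[OF equiv_cong lie_cong.cong_br])
  from UN_equiv_class2[OF equiv_cong equiv_cong this assms] show ?thesis
    by (simp add: presented_lie_superalgebra_def cls_def Let_def)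
qed

lemma smult_P:
  assumes "k \<in> carrier K" "t \<in> T" shows "k \<odot>\<^bsub>P\<^esub> cls t = cls (Smult k t)"
proof -
  have "congruent r (\<lambda>t. r `` {Smult k t})"
    by (rule congruentI) (rule equiv_class_eq[OF equiv_cong lie_cong.cong_smult[OF assms(1)]])
  from UN_equiv_class[OF equiv_cong this assms(2)] show ?thesis
    by (simp add: presented_lie_superalgebra_def cls_def Let_def)
qed

lemmas cls_ops = zero_P add_P br_P smult_P

lemma module_P: "module K P"
proof (rule moduleI)
  show "abelian_group P"
  proof (rule abelian_groupI)
    show "\<exists>y\<in>carrier P. y \<oplus>\<^bsub>P\<^esub> x = \<zero>\<^bsub>P\<^esub>" if x: "x \<in> carrier P" for x
      using x
    proof (cases rule: cls_cases)
      case (1 t)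
      have "(Add (Smult (\<ominus>\<^bsub>K\<^esub> \<one>\<^bsub>K\<^esub>) t) t, Zero) \<in> r"
        using 1 by (blast intro: lie_cong.trans[OF lie_cong.add_comm] lie_cong.add_neg)
      then show ?thesis
        using 1 by (intro bexI[of _ "cls (Smult (\<ominus>\<^bsub>K\<^esub> \<one>\<^bsub>K\<^esub>) t)"]) (auto simp: cls_ops cls_eq_iff)
    qed
    show "\<zero>\<^bsub>P\<^esub> \<oplus>\<^bsub>P\<^esub> x = x" if x: "x \<in> carrier P" for x
      using x
    proof (cases rule: cls_cases)
      case (1 t)
      have "(Add Zero t, t) \<in> r"
        using 1 by (blast intro: lie_cong.trans[OF lie_cong.add_comm] lie_cong.add_zero)
      then show ?thesis
        using 1 by (auto simp: cls_ops cls_eq_iff)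
    qed
  qed (((elim cls_cases)?; simp add: cls_ops cls_eq_iff lie_cong.add_assoc lie_cong.add_comm)+)
qed (((elim cls_cases)?; simp add: cls_ops cls_eq_iff cring_K
    lie_cong.smult_add_left lie_cong.smult_add_right lie_cong.smult_smult lie_cong.smult_one)+)

sublocale P: module K P by (rule module_P)

lemma term_part_homog: "t \<in> T \<Longrightarrow> homog p (term_part d p t)"
proof (induction t arbitrary: p rule: lie_terms.induct)
  case (gen x)
  then show ?case using homog_term.gen[of x G K d] by (auto intro: homog_term.zero)
next
  case (br s t)
  have "homog (0 + p) (Br (term_part d 0 s) (term_part d p t))"
    "homog (1 + (p + 1)) (Br (term_part d 1 s) (term_part d (p + 1) t))"
    by (intro homog_term.br br)+
  then show ?case by (auto intro: homog_term.add simp: add.commute)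
qed (auto intro: homog_term.intros)

lemma term_part_terms [simp]: "t \<in> T \<Longrightarrow> term_part d p t \<in> T"
  using term_part_homog homog_terms by blast

lemma minus_cls: "t \<in> T \<Longrightarrow> \<ominus>\<^bsub>P\<^esub> cls t = cls (Smult (\<ominus>\<^bsub>K\<^esub> \<one>\<^bsub>K\<^esub>) t)"
  using P.smult_l_minus[of "\<one>\<^bsub>K\<^esub>" "cls t"] by (simp flip: smult_P)

lemma bracket_P_closed [simp]: "\<lbrakk>x \<in> carrier P; y \<in> carrier P\<rbrakk> \<Longrightarrow> bracket P x y \<in> carrier P"
  by (auto elim!: cls_cases simp: cls_ops)

lemma bracket_P_add_left: "\<lbrakk>x \<in> carrier P; y \<in> carrier P; z \<in> carrier P\<rbrakk> \<Longrightarrow>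
      bracket P (x \<oplus>\<^bsub>P\<^esub> y) z = bracket P x z \<oplus>\<^bsub>P\<^esub> bracket P y z"
  by (elim cls_cases) (simp add: cls_ops cls_eq_iff lie_cong.br_add_left)

lemma bracket_P_add_right: "\<lbrakk>x \<in> carrier P; y \<in> carrier P; z \<in> carrier P\<rbrakk> \<Longrightarrow>
      bracket P x (y \<oplus>\<^bsub>P\<^esub> z) = bracket P x y \<oplus>\<^bsub>P\<^esub> bracket P x z"
  by (elim cls_cases) (simp add: cls_ops cls_eq_iff lie_cong.br_add_right)

lemma bracket_P_smult_left: "\<lbrakk>k \<in> carrier K; x \<in> carrier P; y \<in> carrier P\<rbrakk> \<Longrightarrow>
      bracket P (k \<odot>\<^bsub>P\<^esub> x) y = k \<odot>\<^bsub>P\<^esub> bracket P x y"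
  by (elim cls_cases) (simp add: cls_ops cls_eq_iff lie_cong.br_smult_left)

lemma bracket_P_smult_right: "\<lbrakk>k \<in> carrier K; x \<in> carrier P; y \<in> carrier P\<rbrakk> \<Longrightarrow>
      bracket P x (k \<odot>\<^bsub>P\<^esub> y) = k \<odot>\<^bsub>P\<^esub> bracket P x y"
  by (elim cls_cases) (simp add: cls_ops cls_eq_iff lie_cong.br_smult_right)

lemma bracket_P_zero [simp]:
  "x \<in> carrier P \<Longrightarrow> bracket P \<zero>\<^bsub>P\<^esub> x = \<zero>\<^bsub>P\<^esub>" "x \<in> carrier P \<Longrightarrow> bracket P x \<zero>\<^bsub>P\<^esub> = \<zero>\<^bsub>P\<^esub>"
  using bracket_P_smult_left[of "\<zero>\<^bsub>K\<^esub>" "\<zero>\<^bsub>P\<^esub>" x] bracket_P_smult_right[of "\<zero>\<^bsub>K\<^esub>" x "\<zero>\<^bsub>P\<^esub>"] by auto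

definition class_part where "class_part p t = cls (term_part d p t)"

lemma class_part_closed [simp]: "t \<in> T \<Longrightarrow> class_part p t \<in> carrier P"
  by (simp add: class_part_def)

lemma class_part_simps:
  "class_part p Zero = \<zero>\<^bsub>P\<^esub>"
  "\<lbrakk>s \<in> T; t \<in> T\<rbrakk> \<Longrightarrow> class_part p (Add s t) = class_part p s \<oplus>\<^bsub>P\<^esub> class_part p t"
  "\<lbrakk>k \<in> carrier K; t \<in> T\<rbrakk> \<Longrightarrow> class_part p (Smult k t) = k \<odot>\<^bsub>P\<^esub> class_part p t"
  "\<lbrakk>s \<in> T; t \<in> T\<rbrakk> \<Longrightarrow> class_part p (Br s t) =
     bracket P (class_part 0 s) (class_part p t) \<oplus>\<^bsub>P\<^esub> bracket P (class_part 1 s) (class_part (p + 1) t)"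
  by (simp_all add: class_part_def cls_ops)

lemma class_part_homog: "homog q t \<Longrightarrow> class_part p t = (if p = q then cls t else \<zero>\<^bsub>P\<^esub>)"
proof (induction arbitrary: p rule: homog_term.induct)
  case (gen x)
  then show ?case by (auto simp: class_part_def zero_P)
next
  case (zero p)
  then show ?case by (auto simp: class_part_def zero_P)
next
  case (add q s t)
  then have "s \<in> T" "t \<in> T" using homog_terms by auto
  then show ?case using add.IH by (auto simp: class_part_simps add_P)
next
  case (smult k q t)
  then have "t \<in> T" using homog_terms by auto
  then show ?case using smult by (auto simp: class_part_simps smult_P)
next
  case (br q1 s q2 t)
  then have "s \<in> T" "t \<in> T" using homog_terms by auto
  then show ?case using br.IH
    by (cases q1; cases q2; cases p) (auto simp: class_part_simps br_P)
qed

lemma class_part_cong_homog: "\<lbrakk>homog q s; homog q t; (s, t) \<in> r\<rbrakk> \<Longrightarrow> class_part p s = class_part p t"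
  by (auto simp: class_part_homog cls_eqI)

text \<open>Each generating congruence is either linear in its terms, and then passes to parts, or
  relates homogeneous terms of one degree, whose parts are the whole term or zero.\<close>

lemma class_part_cong: "(s, t) \<in> r \<Longrightarrow> class_part n s = class_part n t"
proof (induction arbitrary: n rule: lie_cong.induct)
  case (rel s t)
  then show ?case using rel_homog[OF rel] class_part_cong_homog lie_cong.rel[OF rel] by blast
next
  case (cong_add s s' t t')
  then show ?case using cong_terms by (simp add: class_part_simps)
next
  case (cong_smult k t t')
  then show ?case using cong_terms by (simp add: class_part_simps)
next
  case (cong_br s s' t t')
  then show ?case using cong_terms by (simp add: class_part_simps)
next
  case (skew p s q t)
  have 1: "homog (p + q) (Br s t)" and "homog (q + p) (Br t s)" by (intro homog_term.br skew)+
  then have 2: "homog (p + q) (Smult (\<ominus>\<^bsub>K\<^esub> ksign K (p * q)) (Br t s))"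
    by (intro homog_term.smult) (simp_all add: add.commute)
  show ?case by (rule class_part_cong_homog[OF 1 2 lie_cong.skew[OF skew]])
next
  case (alternating t)
  show ?case
    by (rule class_part_cong_homog[OF _ _ lie_cong.alternating[OF alternating]])
      (use homog_term.br[OF alternating alternating] in \<open>auto intro: homog_term.zero\<close>)
next
  case (jacobi p s q t r u)
  have "homog (p + q + r) (Br (Br s t) u)" "homog (q + r + p) (Br (Br t u) s)"
    "homog (r + p + q) (Br (Br u s) t)"
    by (intro homog_term.br jacobi)+
  then show ?case
    by (intro class_part_cong_homog[OF _ _ lie_cong.jacobi[OF jacobi], where q = "p + q + r"] homog_term.intros(2-4))
      (simp_all add: add_ac)
qed (auto simp: class_part_simps P.M.a_ac P.M.r_neg P.smult_l_distr P.smult_r_distr P.smult_assoc1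
    bracket_P_add_left bracket_P_add_right bracket_P_smult_left bracket_P_smult_right P.smult_l_minus)

lemma class_part_decomp: "t \<in> T \<Longrightarrow> class_part 0 t \<oplus>\<^bsub>P\<^esub> class_part 1 t = cls t"
proof (induction rule: lie_terms.induct)
  case (gen x)
  then show ?case by (cases "d x") (auto simp: class_part_def zero_P[symmetric])
next
  case zero
  then show ?case by (simp add: class_part_simps zero_P[symmetric])
next
  case (add s t)
  have "class_part 0 (Add s t) \<oplus>\<^bsub>P\<^esub> class_part 1 (Add s t) =
     (class_part 0 s \<oplus>\<^bsub>P\<^esub> class_part 1 s) \<oplus>\<^bsub>P\<^esub> (class_part 0 t \<oplus>\<^bsub>P\<^esub> class_part 1 t)"
    using add.hyps by (simp add: class_part_simps P.M.a_ac)
  then show ?case using add by (simp add: add_P)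
next
  case (smult k t)
  then show ?case by (simp add: class_part_simps smult_P[symmetric] flip: P.smult_r_distr)
next
  case (br s t)
  have "class_part 0 (Br s t) \<oplus>\<^bsub>P\<^esub> class_part 1 (Br s t) =
     bracket P (class_part 0 s \<oplus>\<^bsub>P\<^esub> class_part 1 s) (class_part 0 t \<oplus>\<^bsub>P\<^esub> class_part 1 t)"
    using br.hyps by (simp add: class_part_simps bracket_P_add_left bracket_P_add_right P.M.a_ac)
  then show ?case using br by (simp add: br_P)
qed

text \<open>All axioms hold by construction, except that the grading is direct: if an element is
  the class of an even and of an odd term, its even part is at once the element itself and
  zero.\<close>

theorem lie_superalgebra_P: "lie_superalgebra K P"
proof -
  interpret gm: graded_module K P
  proof (rule graded_moduleI[OF module_P])
    show "submodule (grade P p) K P" for p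
    proof (rule P.submoduleI)
      show "grade P p \<subseteq> carrier P" by (auto simp: grade_P homog_terms)
      show "\<zero>\<^bsub>P\<^esub> \<in> grade P p" by (simp add: zero_P grade_P_I homog_term.zero)
      show "a \<oplus>\<^bsub>P\<^esub> b \<in> grade P p" if "a \<in> grade P p" "b \<in> grade P p" for a b
        using that by (elim grade_P_E) (simp add: add_P homog_terms grade_P_I homog_term.add)
      show sm: "k \<odot>\<^bsub>P\<^esub> a \<in> grade P p" if "k \<in> carrier K" "a \<in> grade P p" for k a
        using that by (elim grade_P_E) (simp add: smult_P homog_terms grade_P_I homog_term.smult)
      show "\<ominus>\<^bsub>P\<^esub> a \<in> grade P p" if "a \<in> grade P p" for a
        using that by (elim grade_P_E) (simp add: minus_cls homog_terms grade_P_I homog_term.smult)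
    qed
    show "\<exists>y\<in>grade P 0. \<exists>z\<in>grade P 1. x = y \<oplus>\<^bsub>P\<^esub> z" if "x \<in> carrier P" for x
      using that
    proof (cases rule: cls_cases)
      case (1 t)
      then show ?thesis using class_part_decomp[of t] term_part_homog[of t]
        by (intro bexI[of _ "class_part 0 t"] bexI[of _ "class_part 1 t"]) (auto simp: grade_P class_part_def)
    qed
    show "y = \<zero>\<^bsub>P\<^esub>" if y: "y \<in> grade P 0" "y \<in> grade P 1" for y
    proof -
      obtain s t where st: "homog 0 s" "homog 1 t" "y = cls s" "y = cls t"
        using y unfolding grade_P by auto
      then have "(s, t) \<in> r" using cls_eq_iff homog_terms by blast
      then have "class_part 0 s = class_part 0 t" by (rule class_part_cong)
      then show ?thesis using st by (simp add: class_part_homog)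
    qed
  qed
  have ksgn: "[ksgn p] \<cdot>\<^bsub>P\<^esub> x = ksign K p \<odot>\<^bsub>P\<^esub> x" if "x \<in> carrier P" for p x
    using that by (simp add: P.M.ksgn_pow gm.ksign_smult)
  show ?thesis
  proof (intro lie_superalgebra.intro lie_superalgebra_axioms.intro gm.graded_module_axioms)
    fix x y p q assume "x \<in> grade P p" "y \<in> grade P q"
    then obtain s t where st: "homog p s" "homog q t" "x = cls s" "y = cls t"
      unfolding grade_P by auto
    note c = st(1,2)[THEN homog_terms]
    show "bracket P x y \<in> grade P (p + q)"
      using st c by (auto simp: grade_P br_P intro: homog_term.br)
    have "bracket P x y = (\<ominus>\<^bsub>K\<^esub> ksign K (p * q)) \<odot>\<^bsub>P\<^esub> bracket P y x"
      using st c lie_cong.skew[OF st(1,2)] by (simp add: cls_ops cls_eq_iff)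
    then show "bracket P x y = \<ominus>\<^bsub>P\<^esub> ([ksgn (p * q)] \<cdot>\<^bsub>P\<^esub> bracket P y x)"
      using c st by (simp add: ksgn P.smult_l_minus)
  next
    fix x assume "x \<in> grade P 0"
    then obtain s where st: "homog 0 s" "x = cls s"
      unfolding grade_P by auto
    then show "bracket P x x = \<zero>\<^bsub>P\<^esub>"
      using lie_cong.alternating[OF st(1)] homog_terms[OF st(1)] by (simp add: cls_ops cls_eq_iff)
  next
    fix x y z p q r' assume "x \<in> grade P p" "y \<in> grade P q" "z \<in> grade P r'"
    then obtain s t u where st: "homog p s" "homog q t" "homog r' u" "x = cls s" "y = cls t" "z = cls u"
      unfolding grade_P by auto
    note c = st(1-3)[THEN homog_terms]
    show "[ksgn (p * r')] \<cdot>\<^bsub>P\<^esub> bracket P (bracket P x y) z \<oplus>\<^bsub>P\<^esub>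
      [ksgn (p * q)] \<cdot>\<^bsub>P\<^esub> bracket P (bracket P y z) x \<oplus>\<^bsub>P\<^esub>
      [ksgn (q * r')] \<cdot>\<^bsub>P\<^esub> bracket P (bracket P z x) y = \<zero>\<^bsub>P\<^esub>"
      using c lie_cong.jacobi[OF st(1-3)] unfolding st(4-6)
      by (simp add: ksgn P.M.a_assoc) (simp add: cls_ops cls_eq_iff)
  qed (simp_all add: bracket_P_add_left bracket_P_add_right bracket_P_smult_left bracket_P_smult_right)
qed

end

section \<open>Evaluation of terms\<close>

fun eval_term :: "('k, 'l, 'z) supermodule_scheme \<Rightarrow> ('x \<Rightarrow> 'l) \<Rightarrow> ('k, 'x) lie_term \<Rightarrow> 'l"
  where "eval_term L g (Gen x) = g x"
  | "eval_term L g Zero = \<zero>\<^bsub>L\<^esub>"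
  | "eval_term L g (Add s t) = eval_term L g s \<oplus>\<^bsub>L\<^esub> eval_term L g t"
  | "eval_term L g (Smult k t) = k \<odot>\<^bsub>L\<^esub> eval_term L g t"
  | "eval_term L g (Br s t) = bracket L (eval_term L g s) (eval_term L g t)"

context lie_superalgebra
begin

lemma eval_term_homog:
  assumes "\<And>x. x \<in> G \<Longrightarrow> g x \<in> grade L (d x)" and "homog_term K G d p t"
  shows "eval_term L g t \<in> grade L p"
  using assms(2) by (induction rule: homog_term.induct) (auto intro: assms(1) bracket_even)

lemma eval_term_closed:
  assumes "\<And>x. x \<in> G \<Longrightarrow> g x \<in> carrier L" and "t \<in> lie_terms K G"
  shows "eval_term L g t \<in> carrier L"
  using assms(2) by (induction rule: lie_terms.induct) (auto intro: assms(1))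

lemma center_carrier: "z \<in> lie_center L \<Longrightarrow> z \<in> carrier L"
  by (simp add: lie_center_def)

lemma center_bracket: "\<lbrakk>z \<in> lie_center L; x \<in> carrier L\<rbrakk> \<Longrightarrow> bracket L z x = \<zero>\<^bsub>L\<^esub>"
  by (simp add: lie_center_def)

lemma bracket_decomp_left: "\<lbrakk>x \<in> carrier L; y \<in> carrier L\<rbrakk> \<Longrightarrow>
    bracket L x y = bracket L (gpart L 0 x) y \<oplus>\<^bsub>L\<^esub> bracket L (gpart L 1 x) y"
  by (metis bracket_add_left gpart_closed gpart_decomp(2))

lemma bracket_decomp_right: "\<lbrakk>x \<in> carrier L; y \<in> carrier L\<rbrakk> \<Longrightarrow>
    bracket L y x = bracket L y (gpart L 0 x) \<oplus>\<^bsub>L\<^esub> bracket L y (gpart L 1 x)"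
  by (metis bracket_add_right gpart_closed gpart_decomp(2))

text \<open>The centre is defined by brackets from the left, and skew-symmetry holds for
  homogeneous elements only. Against a homogeneous element the two components of a central element
  bracket into different degrees, so both brackets vanish.\<close>

lemma center_bracket_right:
  assumes z: "z \<in> lie_center L" and x: "x \<in> carrier L"
  shows "bracket L x z = \<zero>\<^bsub>L\<^esub>"
proof -
  note zc = center_carrier[OF z]
  have hom: "bracket L y (gpart L q z) = \<zero>\<^bsub>L\<^esub>" if y: "y \<in> grade L p" for y p q
  proof -
    note yc = grade_carrier[OF y]
    have "\<zero>\<^bsub>L\<^esub> = gpart L (q + p) (bracket L z y)"
      using center_bracket[OF z yc] gpart_homog[OF grade_zero, of "q + p"] by simp
    also have "\<dots> = gpart L (q + p) (bracket L (gpart L 0 z) y) \<oplus>\<^bsub>L\<^esub> gpart L (q + p) (bracket L (gpart L 1 z) y)"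
      using yc zc by (simp add: bracket_decomp_left[of z y] gpart_add)
    also have "\<dots> = bracket L (gpart L q z) y"
      using gpart_homog[OF bracket_even[OF gpart_grade[OF zc, of 0] y], of "q + p"]
        gpart_homog[OF bracket_even[OF gpart_grade[OF zc, of 1] y], of "q + p"] yc zc
      by (cases q; cases p) simp_all
    finally have "bracket L (gpart L q z) y = \<zero>\<^bsub>L\<^esub>" by simp
    then show ?thesis using skew[OF y gpart_grade[OF zc]] yc zc by simp
  qed
  show ?thesis
    using x zc hom[OF gpart_grade[OF x]] by (simp add: bracket_decomp_left[of x z]
        bracket_decomp_right[of z "gpart L _ x"])
qed

lemma bracket_mod_center:
  assumes "x \<in> carrier L" "x' \<in> carrier L" "y \<in> carrier L" "y' \<in> carrier L"
    and "x \<ominus>\<^bsub>L\<^esub> x' \<in> lie_center L" "y \<ominus>\<^bsub>L\<^esub> y' \<in> lie_center L"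
  shows "bracket L x y = bracket L x' y'"
proof -
  have "bracket L x y \<ominus>\<^bsub>L\<^esub> bracket L x' y = \<zero>\<^bsub>L\<^esub>"
    using center_bracket[OF assms(5), of y] assms(1-4)
    by (simp add: a_minus_def bracket_add_left bracket_minus_left)
  moreover have "bracket L x' y \<ominus>\<^bsub>L\<^esub> bracket L x' y' = \<zero>\<^bsub>L\<^esub>"
    using center_bracket_right[OF assms(6), of x'] assms(1-4)
    by (simp add: a_minus_def bracket_add_right bracket_minus_right)
  ultimately show ?thesis using assms(1-4) by (simp add: M.eq_minus_iff)
qed

end

text \<open>Brackets do not see central corrections, and the axioms of a Lie superalgebra hold
  exactly in both algebras. So if two families of elements satisfy the relations up to pairs from
  a central submodule \<open>N\<close> of the product, evaluating congruent terms gives pairs that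
  differ by an element of \<open>N\<close>. For \<open>N = 0\<close> this is the universal
  property of the presentation; for the graph of a map between central submodules it compares two
  central extensions.\<close>

lemma eval_term_cong_mod_center:
  assumes L1: "lie_superalgebra K L1" and L2: "lie_superalgebra K L2"
    and g1: "\<And>x. x \<in> G \<Longrightarrow> g1 x \<in> grade L1 (d x)" and g2: "\<And>x. x \<in> G \<Longrightarrow> g2 x \<in> grade L2 (d x)"
    and N_zero: "(\<zero>\<^bsub>L1\<^esub>, \<zero>\<^bsub>L2\<^esub>) \<in> N"
    and N_add: "\<And>u v u' v'. \<lbrakk>(u, v) \<in> N; (u', v') \<in> N\<rbrakk> \<Longrightarrow> (u \<oplus>\<^bsub>L1\<^esub> u', v \<oplus>\<^bsub>L2\<^esub> v') \<in> N"
    and N_smult: "\<And>k u v. \<lbrakk>k \<in> carrier K; (u, v) \<in> N\<rbrakk> \<Longrightarrow> (k \<odot>\<^bsub>L1\<^esub> u, k \<odot>\<^bsub>L2\<^esub> v) \<in> N"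
    and N_center: "\<And>u v. (u, v) \<in> N \<Longrightarrow> u \<in> lie_center L1 \<and> v \<in> lie_center L2"
    and rel: "\<And>s t. \<lbrakk>(s, t) \<in> R; s \<in> lie_terms K G; t \<in> lie_terms K G\<rbrakk> \<Longrightarrow>
      (eval_term L1 g1 s \<ominus>\<^bsub>L1\<^esub> eval_term L1 g1 t, eval_term L2 g2 s \<ominus>\<^bsub>L2\<^esub> eval_term L2 g2 t) \<in> N"
    and pres: "lie_presentation K G d R"
    and st: "(s, t) \<in> lie_cong K G d R"
  shows "(eval_term L1 g1 s \<ominus>\<^bsub>L1\<^esub> eval_term L1 g1 t, eval_term L2 g2 s \<ominus>\<^bsub>L2\<^esub> eval_term L2 g2 t) \<in> N"
proof -
  interpret lie_presentation K G d R by fact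
  interpret L1: lie_superalgebra K L1 by fact
  interpret L2: lie_superalgebra K L2 by fact
  let ?f = "eval_term L1 g1" and ?h = "eval_term L2 g2"
  have f[simp]: "t \<in> T \<Longrightarrow> ?f t \<in> carrier L1" for t
    by (rule L1.eval_term_closed) (auto dest: g1 L1.grade_carrier)
  have h[simp]: "t \<in> T \<Longrightarrow> ?h t \<in> carrier L2" for t
    by (rule L2.eval_term_closed) (auto dest: g2 L2.grade_carrier)
  have eqN: "(?f s \<ominus>\<^bsub>L1\<^esub> ?f t, ?h s \<ominus>\<^bsub>L2\<^esub> ?h t) \<in> N" if "s \<in> T" "t \<in> T" "?f s = ?f t" "?h s = ?h t" for s t
  proof -
    have "?f s \<ominus>\<^bsub>L1\<^esub> ?f t = \<zero>\<^bsub>L1\<^esub>" "?h s \<ominus>\<^bsub>L2\<^esub> ?h t = \<zero>\<^bsub>L2\<^esub>"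
      using that by (simp_all add: L1.M.eq_minus_iff L2.M.eq_minus_iff)
    then show ?thesis using N_zero by simp
  qed
  have lh1: "homog p t \<Longrightarrow> ?f t \<in> grade L1 p" and lh2: "homog p t \<Longrightarrow> ?h t \<in> grade L2 p" for p t
    using L1.eval_term_homog[of G g1 d] L2.eval_term_homog[of G g2 d] g1 g2 by blast+
  have minus_diff1: "\<ominus>\<^bsub>K\<^esub> \<one>\<^bsub>K\<^esub> \<odot>\<^bsub>L1\<^esub> (x \<ominus>\<^bsub>L1\<^esub> y) = y \<ominus>\<^bsub>L1\<^esub> x" if "x \<in> carrier L1" "y \<in> carrier L1" for x y
    using that by (simp add: L1.smult_l_minus a_minus_def L1.M.minus_add L1.M.a_comm)
  have minus_diff2: "\<ominus>\<^bsub>K\<^esub> \<one>\<^bsub>K\<^esub> \<odot>\<^bsub>L2\<^esub> (x \<ominus>\<^bsub>L2\<^esub> y) = y \<ominus>\<^bsub>L2\<^esub> x" if "x \<in> carrier L2" "y \<in> carrier L2" for x y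
    using that by (simp add: L2.smult_l_minus a_minus_def L2.M.minus_add L2.M.a_comm)
  have "s \<in> T \<and> t \<in> T" using cong_terms[OF st] .
  from st show ?thesis
  proof (induction rule: lie_cong.induct)
    case (rel s t)
    then show ?case by (rule assms(9))
  next
    case (sym s t)
    then have "s \<in> T" "t \<in> T" using cong_terms by auto
    then show ?case using N_smult[OF _ sym.IH, of "\<ominus>\<^bsub>K\<^esub> \<one>\<^bsub>K\<^esub>"] by (simp add: minus_diff1 minus_diff2)
  next
    case (trans s t u)
    then have c: "s \<in> T" "t \<in> T" "u \<in> T" using cong_terms by auto
    have "(?f s \<ominus>\<^bsub>L1\<^esub> ?f t) \<oplus>\<^bsub>L1\<^esub> (?f t \<ominus>\<^bsub>L1\<^esub> ?f u) = ?f s \<ominus>\<^bsub>L1\<^esub> ?f u"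
      using c by (simp add: a_minus_def L1.M.a_assoc) (simp add: L1.M.l_neg flip: L1.M.a_assoc)
    moreover have "(?h s \<ominus>\<^bsub>L2\<^esub> ?h t) \<oplus>\<^bsub>L2\<^esub> (?h t \<ominus>\<^bsub>L2\<^esub> ?h u) = ?h s \<ominus>\<^bsub>L2\<^esub> ?h u"
      using c by (simp add: a_minus_def L2.M.a_assoc) (simp add: L2.M.l_neg flip: L2.M.a_assoc)
    ultimately show ?case using N_add[OF trans.IH] by simp
  next
    case (cong_add s s' t t')
    then have c: "s \<in> T" "t \<in> T" "s' \<in> T" "t' \<in> T" using cong_terms by auto
    have "(?f s \<ominus>\<^bsub>L1\<^esub> ?f s') \<oplus>\<^bsub>L1\<^esub> (?f t \<ominus>\<^bsub>L1\<^esub> ?f t') = ?f (Add s t) \<ominus>\<^bsub>L1\<^esub> ?f (Add s' t')"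
      using c by (simp add: a_minus_def L1.M.minus_add L1.M.a_ac)
    moreover have "(?h s \<ominus>\<^bsub>L2\<^esub> ?h s') \<oplus>\<^bsub>L2\<^esub> (?h t \<ominus>\<^bsub>L2\<^esub> ?h t') = ?h (Add s t) \<ominus>\<^bsub>L2\<^esub> ?h (Add s' t')"
      using c by (simp add: a_minus_def L2.M.minus_add L2.M.a_ac)
    ultimately show ?case using N_add[OF cong_add.IH] by simp
  next
    case (cong_smult k t t')
    then have c: "t \<in> T" "t' \<in> T" using cong_terms by auto
    show ?case using N_smult[OF cong_smult(1) cong_smult.IH] c cong_smult(1)
      by (simp add: a_minus_def L1.smult_r_distr L1.smult_r_minus L2.smult_r_distr L2.smult_r_minus)
  next
    case (cong_br s s' t t')
    then have c: "s \<in> T" "t \<in> T" "s' \<in> T" "t' \<in> T" using cong_terms by auto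
    show ?case
      by (rule eqN) (use c N_center[OF cong_br.IH(1)] N_center[OF cong_br.IH(2)] in
        \<open>auto intro: L1.bracket_mod_center L2.bracket_mod_center\<close>)
  next
    case (skew p s q t)
    note c = skew[THEN homog_terms]
    show ?case
      by (rule eqN) (use c L1.skew[OF skew[THEN lh1]] L2.skew[OF skew[THEN lh2]] in
       \<open>simp_all add: L1.smult_l_minus L1.ksign_smult L1.M.minus_sg L2.smult_l_minus L2.ksign_smult L2.M.minus_sg\<close>)
  next
    case (alternating t)
    show ?case
      by (rule eqN) (use alternating homog_terms L1.bracket_alternating[OF lh1] L2.bracket_alternating[OF lh2]
        in auto)
  next
    case (jacobi p s q t r u)
    note c = jacobi[THEN homog_terms]
    show ?case
      by (rule eqN) (use c L1.jacobi[OF jacobi[THEN lh1]] L2.jacobi[OF jacobi[THEN lh2]] in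
       \<open>simp_all add: L1.ksign_smult L2.ksign_smult L1.M.a_assoc L2.M.a_assoc\<close>)
  qed (rule eqN; simp add: L1.M.a_ac L2.M.a_ac L1.smult_l_minus L2.smult_l_minus
     L1.M.r_neg L2.M.r_neg L1.smult_l_distr L2.smult_l_distr L1.smult_r_distr L2.smult_r_distr
     L1.smult_assoc1 L2.smult_assoc1 L1.bracket_add_left L2.bracket_add_left
     L1.bracket_add_right L2.bracket_add_right L1.bracket_smult_left L2.bracket_smult_left
     L1.bracket_smult_right L2.bracket_smult_right)+
qed

section \<open>Quotients by graded ideals\<close>

context superalgebra
begin

lemma mult_sg_left: "\<lbrakk>x \<in> carrier A; y \<in> carrier A\<rbrakk> \<Longrightarrow> sg A p x \<otimes>\<^bsub>A\<^esub> y = sg A p (x \<otimes>\<^bsub>A\<^esub> y)"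
  by (simp add: sg_def l_minus)

lemma mult_sg_right: "\<lbrakk>x \<in> carrier A; y \<in> carrier A\<rbrakk> \<Longrightarrow> x \<otimes>\<^bsub>A\<^esub> sg A p y = sg A p (x \<otimes>\<^bsub>A\<^esub> y)"
  by (simp add: sg_def r_minus)

lemma gpart_mult:
  assumes [simp]: "x \<in> carrier A" "y \<in> carrier A"
  shows "gpart A p (x \<otimes>\<^bsub>A\<^esub> y) = gpart A 0 x \<otimes>\<^bsub>A\<^esub> gpart A p y \<oplus>\<^bsub>A\<^esub> gpart A 1 x \<otimes>\<^bsub>A\<^esub> gpart A (p + 1) y"
proof -
  have e: "gpart A p (gpart A q x \<otimes>\<^bsub>A\<^esub> gpart A r y) =
      (if p = q + r then gpart A q x \<otimes>\<^bsub>A\<^esub> gpart A r y else \<zero>\<^bsub>A\<^esub>)" for q r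
    by (rule gpart_homog) (simp add: mult_even)
  have "gpart A p (x \<otimes>\<^bsub>A\<^esub> y) =
    gpart A p ((gpart A 0 x \<oplus>\<^bsub>A\<^esub> gpart A 1 x) \<otimes>\<^bsub>A\<^esub> (gpart A p y \<oplus>\<^bsub>A\<^esub> gpart A (p + 1) y))"
    by (simp add: gpart_decomp gpart_decomp')
  also have "\<dots> = gpart A 0 x \<otimes>\<^bsub>A\<^esub> gpart A p y \<oplus>\<^bsub>A\<^esub> gpart A 1 x \<otimes>\<^bsub>A\<^esub> gpart A (p + 1) y"
    by (simp add: l_distr r_distr gpart_add e)
  finally show ?thesis .
qed

end

locale graded_ideal = superalgebra K A + ideal I A
  for K :: "('k, 'y) ring_scheme" and A :: "('k, 'a, 'z) supermodule_scheme" and I +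
  assumes gpart_ideal: "a \<in> I \<Longrightarrow> gpart A p a \<in> I"
begin

abbreviation c where "c a \<equiv> I +>\<^bsub>A\<^esub> a"
abbreviation Q where "Q \<equiv> super_quot A I"

lemma c_eq_iff: "\<lbrakk>a \<in> carrier A; b \<in> carrier A\<rbrakk> \<Longrightarrow> c a = c b \<longleftrightarrow> a \<ominus>\<^bsub>A\<^esub> b \<in> I"
  using quotient_eq_iff_same_a_r_cos[OF is_ideal] by simp

lemma carrier_Q: "carrier Q = c ` carrier A"
  by (auto simp: super_quot_def FactRing_simps)

lemma c_closed [simp]: "a \<in> carrier A \<Longrightarrow> c a \<in> carrier Q"
  by (simp add: carrier_Q)

lemma Q_cases:
  assumes "x \<in> carrier Q" obtains a where "a \<in> carrier A" "x = c a"
  using assms by (auto simp: carrier_Q)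

lemma grade_Q: "grade Q p = c ` grade A p"
  by (auto simp: super_quot_def)

lemma c_add [simp]: "\<lbrakk>a \<in> carrier A; b \<in> carrier A\<rbrakk> \<Longrightarrow> c a \<oplus>\<^bsub>Q\<^esub> c b = c (a \<oplus>\<^bsub>A\<^esub> b)"
  by (simp add: super_quot_def FactRing_def a_rcos_sum)

lemma c_mult [simp]: "\<lbrakk>a \<in> carrier A; b \<in> carrier A\<rbrakk> \<Longrightarrow> c a \<otimes>\<^bsub>Q\<^esub> c b = c (a \<otimes>\<^bsub>A\<^esub> b)"
  by (simp add: super_quot_def FactRing_def rcoset_mult_add)

lemma zero_Q: "\<zero>\<^bsub>Q\<^esub> = c \<zero>\<^bsub>A\<^esub>"
  by (simp add: super_quot_def FactRing_def a_coset_add_zero a_subset)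

lemma one_Q: "\<one>\<^bsub>Q\<^esub> = c \<one>\<^bsub>A\<^esub>"
  by (simp add: super_quot_def FactRing_def)

lemma c_zero_iff: "a \<in> carrier A \<Longrightarrow> c a = \<zero>\<^bsub>Q\<^esub> \<longleftrightarrow> a \<in> I"
  by (simp add: zero_Q c_eq_iff a_minus_def)

lemma smult_ideal: "\<lbrakk>k \<in> carrier K; a \<in> I\<rbrakk> \<Longrightarrow> k \<odot>\<^bsub>A\<^esub> a \<in> I"
  using I_l_closed[of a "k \<odot>\<^bsub>A\<^esub> \<one>\<^bsub>A\<^esub>"] by (simp add: smult_mult_left a_Hcarr)

lemma c_smult [simp]:
  assumes "k \<in> carrier K" "a \<in> carrier A" shows "k \<odot>\<^bsub>Q\<^esub> c a = c (k \<odot>\<^bsub>A\<^esub> a)"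
proof -
  have const: "c (k \<odot>\<^bsub>A\<^esub> b) = c (k \<odot>\<^bsub>A\<^esub> a)" if "b \<in> c a" for b
  proof -
    have b: "b \<in> carrier A" using that assms a_r_coset_subset_G[OF a_subset] by blast
    have "c b = c a" using a_repr_independence[OF that assms(2)] a_subgroup by simp
    then have "k \<odot>\<^bsub>A\<^esub> (b \<ominus>\<^bsub>A\<^esub> a) \<in> I" using smult_ideal assms b c_eq_iff by simp
    then show ?thesis using assms b by (simp add: c_eq_iff a_minus_def smult_r_distr smult_r_minus)
  qed
  have "a \<in> c a" using assms by (simp add: a_rcos_self)
  then have "(\<Union>b\<in>c a. c (k \<odot>\<^bsub>A\<^esub> b)) = c (k \<odot>\<^bsub>A\<^esub> a)"
    using const by (intro SUP_eq_const) blast+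
  then show ?thesis by (simp add: super_quot_def)
qed

text \<open>Only the grading needs an argument: if a coset has an even representative
  \<open>a\<close> and an odd one \<open>b\<close>, then \<open>a\<close> is the even part of
  \<open>a - b\<close> and so lies in the ideal.\<close>

lemma superalgebra_Q: "superalgebra K Q"
proof -
  have ag: "abelian_group Q"
  proof (rule abelian_groupI)
    show "\<exists>y\<in>carrier Q. y \<oplus>\<^bsub>Q\<^esub> x = \<zero>\<^bsub>Q\<^esub>" if "x \<in> carrier Q" for x
      using that
    proof (cases rule: Q_cases)
      case (1 a)
      then show ?thesis by (intro bexI[of _ "c (\<ominus>\<^bsub>A\<^esub> a)"]) (simp_all add: zero_Q l_neg)
    qed
  qed (((elim Q_cases)?; simp add: zero_Q a_ac)+)
  have mod: "module K Q"
    by (rule moduleI[OF R.is_cring ag])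
      ((elim Q_cases; simp add: smult_l_distr smult_r_distr smult_assoc1)+)
  have rng: "ring Q"
  proof (rule ringI[OF ag])
    show "monoid Q"
      by (rule monoidI) (((elim Q_cases)?; simp add: one_Q m_assoc)+)
  qed ((elim Q_cases; simp add: l_distr r_distr)+)
  interpret Q: module K Q by (rule mod)
  have minus: "\<ominus>\<^bsub>Q\<^esub> c a = c (\<ominus>\<^bsub>A\<^esub> a)" if "a \<in> carrier A" for a
    using that by (intro Q.M.minus_equality) (simp_all add: zero_Q l_neg)
  have gr: "graded_module K Q"
  proof (rule graded_moduleI[OF mod])
    show "submodule (grade Q p) K Q" for p
    proof (rule Q.submoduleI)
      show "\<zero>\<^bsub>Q\<^esub> \<in> grade Q p" by (auto simp: zero_Q grade_Q)
    qed (auto simp: grade_Q grade_carrier minus)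
    show "\<exists>y\<in>grade Q 0. \<exists>z\<in>grade Q 1. x = y \<oplus>\<^bsub>Q\<^esub> z" if "x \<in> carrier Q" for x
      using that
    proof (cases rule: Q_cases)
      case (1 a)
      then show ?thesis
        by (intro bexI[of _ "c (gpart A 0 a)"] bexI[of _ "c (gpart A 1 a)"])
          (auto simp: grade_Q gpart_decomp)
    qed
    show "y = \<zero>\<^bsub>Q\<^esub>" if y: "y \<in> grade Q 0" "y \<in> grade Q 1" for y
    proof -
      obtain a b where ab: "a \<in> grade A 0" "b \<in> grade A 1" "y = c a" "y = c b"
        using y by (auto simp: grade_Q)
      note car = ab(1,2)[THEN grade_carrier]
      have "a \<ominus>\<^bsub>A\<^esub> b \<in> I" using ab car c_eq_iff[of a b] by simp
      then have "gpart A 0 (a \<ominus>\<^bsub>A\<^esub> b) \<in> I" by (rule gpart_ideal)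
      also have "gpart A 0 (a \<ominus>\<^bsub>A\<^esub> b) = a"
        using ab car by (simp add: a_minus_def gpart_add gpart_homog[of a 0] gpart_homog[of "\<ominus>\<^bsub>A\<^esub> b" 1])
      finally show ?thesis using ab car by (simp add: c_zero_iff)
    qed
  qed
  show ?thesis
  proof (intro superalgebra.intro gr rng superalgebra_axioms.intro)
    show "\<one>\<^bsub>Q\<^esub> \<in> grade Q 0" by (simp add: one_Q grade_Q one_even)
    show "x \<otimes>\<^bsub>Q\<^esub> y \<in> grade Q (p + q)" if "x \<in> grade Q p" "y \<in> grade Q q" for x y p q
      using that by (auto simp: grade_Q grade_carrier mult_even)
  qed ((elim Q_cases; simp add: smult_mult_left smult_mult_right)+)
qed

lemma sg_c: 
  assumes a: "a \<in> carrier A" shows "sg Q p (c a) = c (sg A p a)"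
proof -
  interpret Q: superalgebra K Q by (rule superalgebra_Q)
  have "\<ominus>\<^bsub>Q\<^esub> c a = c (\<ominus>\<^bsub>A\<^esub> a)"
    using a by (intro Q.M.minus_equality) (simp_all add: zero_Q l_neg)
  then show ?thesis by (simp add: sg_def)
qed

end

subsection \<open>The ideals \<open>I\<^sub>r\<close>\<close>

context superalgebra
begin

definition super_comm_gens :: "nat \<Rightarrow> 'a set" where
  "super_comm_gens r = {[r] \<cdot>\<^bsub>A\<^esub> a | a. a \<in> carrier A} \<union>
    {a \<otimes>\<^bsub>A\<^esub> b \<ominus>\<^bsub>A\<^esub> [ksgn (p * q)] \<cdot>\<^bsub>A\<^esub> (b \<otimes>\<^bsub>A\<^esub> a) | a b p q. a \<in> grade A p \<and> b \<in> grade A q}"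

lemma super_comm_gens_carrier: "super_comm_gens r \<subseteq> carrier A"
  by (auto simp: super_comm_gens_def ksgn_pow grade_carrier)

lemma super_comm_ideal_eq: "super_comm_ideal r A = Idl\<^bsub>A\<^esub> super_comm_gens r"
  by (simp add: super_comm_ideal_def super_comm_gens_def)

lemma ideal_super_comm: "ideal (super_comm_ideal r A) A"
  unfolding super_comm_ideal_eq by (rule genideal_ideal[OF super_comm_gens_carrier])

lemma super_comm_mem: "\<lbrakk>a \<in> grade A p; b \<in> grade A q\<rbrakk> \<Longrightarrow>
    a \<otimes>\<^bsub>A\<^esub> b \<ominus>\<^bsub>A\<^esub> sg A (p * q) (b \<otimes>\<^bsub>A\<^esub> a) \<in> super_comm_ideal r A"
  unfolding super_comm_ideal_eq
  by (rule subsetD[OF genideal_self[OF super_comm_gens_carrier]])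
    (auto simp: super_comm_gens_def ksgn_pow[symmetric] grade_carrier)

lemma pow_mem: "a \<in> carrier A \<Longrightarrow> [r] \<cdot>\<^bsub>A\<^esub> a \<in> super_comm_ideal r A"
  unfolding super_comm_ideal_eq
  by (rule subsetD[OF genideal_self[OF super_comm_gens_carrier]])
    (auto simp: super_comm_gens_def)

lemma super_comm_minimal:
  "\<lbrakk>ideal J A; super_comm_gens r \<subseteq> J\<rbrakk> \<Longrightarrow> super_comm_ideal r A \<subseteq> J"
  unfolding super_comm_ideal_eq by (rule genideal_minimal)

lemma gpart_pow: "a \<in> carrier A \<Longrightarrow> gpart A p ([(r::nat)] \<cdot>\<^bsub>A\<^esub> a) = [r] \<cdot>\<^bsub>A\<^esub> gpart A p a"
proof (induction r)
  case 0
  then show ?case using gpart_homog[OF grade_zero, of p p] by simp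
next
  case (Suc r)
  then show ?case by (simp add: gpart_add)
qed

text \<open>The elements of the ideal whose components lie in it form an ideal again, and this
  ideal contains the generators: supercommutators are homogeneous, and multiplication by an
  integer commutes with taking components.\<close>

lemma graded_ideal_super_comm: "graded_ideal K A (super_comm_ideal r A)"
proof -
  let ?I = "super_comm_ideal r A"
  interpret I: ideal ?I A by (rule ideal_super_comm)
  define J where "J = {a \<in> ?I. \<forall>p. gpart A p a \<in> ?I}"
  have J: "ideal J A"
  proof (rule idealI[OF ring_axioms])
    show "subgroup J (add_monoid A)"
    proof (rule add.subgroupI)
      show "J \<subseteq> carrier A" using I.a_Hcarr by (auto simp: J_def)
      show "J \<noteq> {}" using gpart_homog[OF grade_zero, of _ 0] by (auto simp: J_def intro!: exI[of _ "\<zero>\<^bsub>A\<^esub>"])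
      show "\<ominus>\<^bsub>A\<^esub> a \<in> J" if "a \<in> J" for a
        using that gpart_smult[of "\<ominus>\<^bsub>K\<^esub> \<one>\<^bsub>K\<^esub>" a] by (auto simp: J_def smult_l_minus I.a_Hcarr)
      show "a \<oplus>\<^bsub>A\<^esub> b \<in> J" if "a \<in> J" "b \<in> J" for a b
        using that by (auto simp: J_def gpart_add I.a_Hcarr)
    qed
    show "x \<otimes>\<^bsub>A\<^esub> a \<in> J" "a \<otimes>\<^bsub>A\<^esub> x \<in> J" if "a \<in> J" "x \<in> carrier A" for a x
      using that by (simp_all add: J_def gpart_mult I.a_Hcarr I.I_l_closed I.I_r_closed
          additive_subgroup.a_closed[OF I.is_additive_subgroup])
  qed
  have "super_comm_gens r \<subseteq> J"
  proof
    fix x assume x: "x \<in> super_comm_gens r"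
    then have xI: "x \<in> ?I"
      unfolding super_comm_ideal_eq using genideal_self[OF super_comm_gens_carrier] by blast
    from x have "gpart A p x \<in> ?I" for p
    proof (unfold super_comm_gens_def, elim UnE CollectE exE conjE)
      fix a assume "x = [r] \<cdot>\<^bsub>A\<^esub> a" "a \<in> carrier A"
      then show ?thesis by (simp add: gpart_pow pow_mem)
    next
      fix a b q s assume *: "x = a \<otimes>\<^bsub>A\<^esub> b \<ominus>\<^bsub>A\<^esub> [ksgn (q * s)] \<cdot>\<^bsub>A\<^esub> (b \<otimes>\<^bsub>A\<^esub> a)"
        "a \<in> grade A q" "b \<in> grade A s"
      have "x \<in> grade A (q + s)"
        using *(2,3) mult_even[OF *(2,3)] mult_even[OF *(3,2)] unfolding *(1)
        by (simp add: ksgn_pow grade_carrier a_minus_def add.commute)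
      then show ?thesis using xI by (simp add: gpart_homog)
    qed
    then show "x \<in> J" using xI by (simp add: J_def)
  qed
  then have "?I \<subseteq> J" by (rule super_comm_minimal[OF J])
  then show ?thesis
    by (intro graded_ideal.intro superalgebra_axioms ideal_super_comm graded_ideal_axioms.intro)
      (auto simp: J_def)
qed

end

section \<open>The module \<open>W\<close>\<close>

locale super_W = superalgebra K A for K :: "('k, 'y) ring_scheme" and A :: "('k, 'a, 'z) supermodule_scheme"
begin

abbreviation S where "S r \<equiv> Wsummand A r"
abbreviation W where "W \<equiv> Wmod A"
abbreviation cl where "cl r a \<equiv> Wclass A r a"
abbreviation Iw where "Iw r \<equiv> super_comm_ideal (if r \<le> 4 then 2 else 0) A"

lemma S_quot: "S r = super_quot A (Iw r)"
  by (simp add: Wsummand_def Aquot_def)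

lemma graded_ideal_Iw: "graded_ideal K A (Iw r)"
  by (rule graded_ideal_super_comm)

lemma superalgebra_S: "superalgebra K (S r)"
  unfolding S_quot by (rule graded_ideal.superalgebra_Q[OF graded_ideal_Iw])

sublocale S: superalgebra K "S r" for r by (rule superalgebra_S)

lemmas cl_defs = Wclass_def S_quot
lemma carrier_S: "carrier (S r) = cl r ` carrier A"
  unfolding cl_defs by (rule graded_ideal.carrier_Q[OF graded_ideal_Iw])
lemma grade_S: "grade (S r) p = cl r ` grade A p"
  unfolding cl_defs by (rule graded_ideal.grade_Q[OF graded_ideal_Iw])
lemma cl_closed [simp]: "a \<in> carrier A \<Longrightarrow> cl r a \<in> carrier (S r)"
  by (simp add: carrier_S)
lemma cl_grade: "a \<in> grade A p \<Longrightarrow> cl r a \<in> grade (S r) p"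
  by (simp add: grade_S)
lemma cl_add: "\<lbrakk>a \<in> carrier A; b \<in> carrier A\<rbrakk> \<Longrightarrow> cl r (a \<oplus>\<^bsub>A\<^esub> b) = cl r a \<oplus>\<^bsub>S r\<^esub> cl r b"
  unfolding cl_defs by (rule graded_ideal.c_add[OF graded_ideal_Iw, symmetric])
lemma cl_mult: "\<lbrakk>a \<in> carrier A; b \<in> carrier A\<rbrakk> \<Longrightarrow> cl r (a \<otimes>\<^bsub>A\<^esub> b) = cl r a \<otimes>\<^bsub>S r\<^esub> cl r b"
  unfolding cl_defs by (rule graded_ideal.c_mult[OF graded_ideal_Iw, symmetric])
lemma cl_smult: "\<lbrakk>k \<in> carrier K; a \<in> carrier A\<rbrakk> \<Longrightarrow> cl r (k \<odot>\<^bsub>A\<^esub> a) = k \<odot>\<^bsub>S r\<^esub> cl r a"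
  unfolding cl_defs by (rule graded_ideal.c_smult[OF graded_ideal_Iw, symmetric])
lemma cl_sg: "a \<in> carrier A \<Longrightarrow> cl r (sg A p a) = sg (S r) p (cl r a)"
  unfolding cl_defs by (rule graded_ideal.sg_c[OF graded_ideal_Iw, symmetric])
lemma cl_zero_iff: "a \<in> carrier A \<Longrightarrow> cl r a = \<zero>\<^bsub>S r\<^esub> \<longleftrightarrow> a \<in> Iw r"
  unfolding cl_defs by (rule graded_ideal.c_zero_iff[OF graded_ideal_Iw])
lemma cl_zero [simp]: "cl r \<zero>\<^bsub>A\<^esub> = \<zero>\<^bsub>S r\<^esub>"
  unfolding cl_defs by (rule graded_ideal.zero_Q[OF graded_ideal_Iw, symmetric])

lemma cl_supercomm:
  assumes a: "a \<in> grade A p" and b: "b \<in> grade A q"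
  shows "cl r a \<otimes>\<^bsub>S r\<^esub> cl r b = sg (S r) (p * q) (cl r b \<otimes>\<^bsub>S r\<^esub> cl r a)"
proof -
  note c = grade_carrier[OF a] grade_carrier[OF b]
  have "cl r (a \<otimes>\<^bsub>A\<^esub> b \<oplus>\<^bsub>A\<^esub> sg A (p * q + 1) (b \<otimes>\<^bsub>A\<^esub> a)) = \<zero>\<^bsub>S r\<^esub>"
    using super_comm_mem[OF a b] c by (subst cl_zero_iff) (simp_all add: a_minus_def minus_sg)
  then have "cl r a \<otimes>\<^bsub>S r\<^esub> cl r b \<oplus>\<^bsub>S r\<^esub> \<ominus>\<^bsub>S r\<^esub> sg (S r) (p * q) (cl r b \<otimes>\<^bsub>S r\<^esub> cl r a) = \<zero>\<^bsub>S r\<^esub>"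
    using c by (simp add: cl_add cl_sg cl_mult S.minus_sg)
  then show ?thesis using c S.eq_minus_iff[of "cl r a \<otimes>\<^bsub>S r\<^esub> cl r b" r "sg (S r) (p * q) (cl r b \<otimes>\<^bsub>S r\<^esub> cl r a)"]
    by (simp add: a_minus_def)
qed

text \<open>Signs are invisible in the first four summands. This makes it possible to use one
  formula, with signs, for all six.\<close>

lemma S_char2:
  assumes r: "r \<le> 4" and x: "x \<in> carrier (S r)"
  shows "sg (S r) p x = x"
proof -
  obtain a where a: "a \<in> carrier A" "x = cl r a" using x by (auto simp: carrier_S)
  have "[(2::nat)] \<cdot>\<^bsub>A\<^esub> a = a \<oplus>\<^bsub>A\<^esub> a" using a by (simp add: numeral_2_eq_2)
  then have "cl r (a \<oplus>\<^bsub>A\<^esub> a) = \<zero>\<^bsub>S r\<^esub>"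
    using pow_mem[OF a(1), of 2] r a by (subst cl_zero_iff) simp_all
  then have "x \<oplus>\<^bsub>S r\<^esub> x = \<zero>\<^bsub>S r\<^esub>" using a by (simp add: cl_add)
  then have "\<ominus>\<^bsub>S r\<^esub> x = x" using x by (intro S.minus_equality)
  then show ?thesis by (simp add: sg_def)
qed

lemma W_add_app: "r \<in> {1..6} \<Longrightarrow> (v \<oplus>\<^bsub>W\<^esub> w) r = v r \<oplus>\<^bsub>S r\<^esub> w r"
  by (simp add: Wmod_def)

lemma W_smult_app: "r \<in> {1..6} \<Longrightarrow> (k \<odot>\<^bsub>W\<^esub> w) r = k \<odot>\<^bsub>S r\<^esub> w r"
  by (simp add: Wmod_def)

lemma W_zero_app: "r \<in> {1..6} \<Longrightarrow> \<zero>\<^bsub>W\<^esub> r = \<zero>\<^bsub>S r\<^esub>"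
  by (simp add: Wmod_def)

lemmas W_app = W_add_app W_smult_app W_zero_app

lemma carrier_W: "carrier W = (\<Pi>\<^sub>E r\<in>{1..6}. carrier (S r))"
  by (simp add: Wmod_def)

lemma W_mem: "\<lbrakk>w \<in> carrier W; r \<in> {1..6}\<rbrakk> \<Longrightarrow> w r \<in> carrier (S r)"
  by (auto simp: carrier_W)

lemma grade_W: "grade W p = (\<Pi>\<^sub>E r\<in>{1..6}. grade (S r) p)"
  by (simp add: Wmod_def)

lemma W_eqI: "\<lbrakk>v \<in> carrier W; w \<in> carrier W; \<And>r. r \<in> {1..6} \<Longrightarrow> v r = w r\<rbrakk> \<Longrightarrow> v = w"
  unfolding carrier_W by (rule PiE_ext)

lemma W_closed: "v \<in> carrier W \<Longrightarrow> w \<in> carrier W \<Longrightarrow> v \<oplus>\<^bsub>W\<^esub> w \<in> carrier W"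
  "\<zero>\<^bsub>W\<^esub> \<in> carrier W" "k \<in> carrier K \<Longrightarrow> w \<in> carrier W \<Longrightarrow> k \<odot>\<^bsub>W\<^esub> w \<in> carrier W"
  by (auto simp: Wmod_def PiE_iff extensional_def)

lemma graded_module_W: "graded_module K W"
proof -
  have ag: "abelian_group W"
  proof (rule abelian_groupI)
    show "\<exists>y\<in>carrier W. y \<oplus>\<^bsub>W\<^esub> x = \<zero>\<^bsub>W\<^esub>" if x: "x \<in> carrier W" for x
    proof
      show c: "(\<lambda>r\<in>{1..6}. \<ominus>\<^bsub>S r\<^esub> x r) \<in> carrier W" using x by (auto simp: carrier_W)
      show "(\<lambda>r\<in>{1..6}. \<ominus>\<^bsub>S r\<^esub> x r) \<oplus>\<^bsub>W\<^esub> x = \<zero>\<^bsub>W\<^esub>"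
        using x c by (intro W_eqI W_closed) (simp_all add: W_app W_mem S.l_neg)
    qed
  qed (auto intro!: W_eqI W_closed simp: W_app W_mem S.a_ac)
  have mod: "module K W"
    by (rule moduleI[OF R.is_cring ag]; (intro W_eqI W_closed)?)
      (auto simp: W_app W_mem S.smult_l_distr S.smult_r_distr S.smult_assoc1 intro!: W_closed)
  interpret W: module K W by (rule mod)
  have minus: "(\<ominus>\<^bsub>W\<^esub> w) r = \<ominus>\<^bsub>S r\<^esub> w r" if "w \<in> carrier W" "r \<in> {1..6}" for w r
    using that W_add_app[of r "\<ominus>\<^bsub>W\<^esub> w" w]
    by (intro S.minus_equality[symmetric]) (simp_all add: W.M.l_neg W_app W_mem)
  have gc: "x \<in> grade W p \<Longrightarrow> x \<in> carrier W" for x p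
    by (auto simp: grade_W carrier_W PiE_iff S.grade_carrier)
  show ?thesis
  proof (rule graded_moduleI[OF mod])
    show "submodule (grade W p) K W" for p
    proof (rule W.submoduleI)
      show "\<ominus>\<^bsub>W\<^esub> a \<in> grade W p" if a: "a \<in> grade W p" for a
        using gc[OF a] W.M.a_inv_closed[OF gc[OF a]] a by (auto simp: grade_W carrier_W PiE_iff minus[OF gc[OF a]])
    next
      show "grade W p \<subseteq> carrier W" using gc by blast
    qed (auto simp: grade_W PiE_iff Wmod_def)
    show "\<exists>y\<in>grade W 0. \<exists>z\<in>grade W 1. x = y \<oplus>\<^bsub>W\<^esub> z" if x: "x \<in> carrier W" for x
    proof (intro bexI)
      show g: "(\<lambda>r\<in>{1..6}. gpart (S r) 0 (x r)) \<in> grade W 0" "(\<lambda>r\<in>{1..6}. gpart (S r) 1 (x r)) \<in> grade W 1"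
        using x by (auto simp: grade_W W_mem)
      show "x = (\<lambda>r\<in>{1..6}. gpart (S r) 0 (x r)) \<oplus>\<^bsub>W\<^esub> (\<lambda>r\<in>{1..6}. gpart (S r) 1 (x r))"
        using x g[THEN gc] by (intro W_eqI W_closed) (simp_all add: W_app W_mem S.gpart_decomp)
    qed
    show "y = \<zero>\<^bsub>W\<^esub>" if y: "y \<in> grade W 0" "y \<in> grade W 1" for y
    proof (rule W_eqI)
      fix r :: nat assume r: "r \<in> {1..6}"
      then have "y r \<in> grade (S r) 0" "y r \<in> grade (S r) 1" using y by (auto simp: grade_W)
      then show "y r = \<zero>\<^bsub>W\<^esub> r" using r S.gpart_homog[of "y r" r 0 0] S.gpart_homog[of "y r" r 1 0]
        by (simp add: W_app)
    qed (use gc[OF y(1)] W_closed in auto)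
  qed
qed

sublocale W: graded_module K W by (rule graded_module_W)

lemma W_minus_app:
  assumes "w \<in> carrier W" "r \<in> {1..6}" shows "(\<ominus>\<^bsub>W\<^esub> w) r = \<ominus>\<^bsub>S r\<^esub> w r"
  using assms W_add_app[of r "\<ominus>\<^bsub>W\<^esub> w" w]
  by (intro S.minus_equality[symmetric]) (simp_all add: W.M.l_neg W_app W_mem)

lemma W_sg_app: "\<lbrakk>w \<in> carrier W; r \<in> {1..6}\<rbrakk> \<Longrightarrow> (sg W p w) r = sg (S r) p (w r)"
  by (simp add: sg_def W_minus_app)

end

section \<open>Extensions by a cocycle\<close>

text \<open>For arbitrary data the axioms of a Lie superalgebra split into those of
  \<open>L\<close> and the conditions on \<open>\<psi>\<close> that the locale below
  collects.\<close>

definition cocycle_ext where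
  "cocycle_ext L W \<psi> = \<lparr>carrier = carrier L \<times> carrier W,
     mult = (\<lambda>(x, v) (y, w). (bracket L x y, \<psi> x y)),
     one = undefined,
     zero = (\<zero>\<^bsub>L\<^esub>, \<zero>\<^bsub>W\<^esub>),
     add = (\<lambda>(x, v) (y, w). (x \<oplus>\<^bsub>L\<^esub> y, v \<oplus>\<^bsub>W\<^esub> w)),
     smult = (\<lambda>k (x, v). (k \<odot>\<^bsub>L\<^esub> x, k \<odot>\<^bsub>W\<^esub> v)),
     grade = (\<lambda>p. grade L p \<times> grade W p)\<rparr>"

locale super_cocycle = L: lie_superalgebra K L + W: graded_module K W
  for K :: "('k, 'y) ring_scheme" and L :: "('k, 'l, 'z) supermodule_scheme"
    and W :: "('k, 'w, 'z2) supermodule_scheme" +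
  fixes \<psi> :: "'l \<Rightarrow> 'l \<Rightarrow> 'w"
  assumes psi_closed: "\<lbrakk>x \<in> carrier L; y \<in> carrier L\<rbrakk> \<Longrightarrow> \<psi> x y \<in> carrier W"
    and psi_add_left: "\<lbrakk>x \<in> carrier L; y \<in> carrier L; z \<in> carrier L\<rbrakk> \<Longrightarrow>
      \<psi> (x \<oplus>\<^bsub>L\<^esub> y) z = \<psi> x z \<oplus>\<^bsub>W\<^esub> \<psi> y z"
    and psi_add_right: "\<lbrakk>x \<in> carrier L; y \<in> carrier L; z \<in> carrier L\<rbrakk> \<Longrightarrow>
      \<psi> x (y \<oplus>\<^bsub>L\<^esub> z) = \<psi> x y \<oplus>\<^bsub>W\<^esub> \<psi> x z"
    and psi_smult_left: "\<lbrakk>k \<in> carrier K; x \<in> carrier L; y \<in> carrier L\<rbrakk> \<Longrightarrow>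
      \<psi> (k \<odot>\<^bsub>L\<^esub> x) y = k \<odot>\<^bsub>W\<^esub> \<psi> x y"
    and psi_smult_right: "\<lbrakk>k \<in> carrier K; x \<in> carrier L; y \<in> carrier L\<rbrakk> \<Longrightarrow>
      \<psi> x (k \<odot>\<^bsub>L\<^esub> y) = k \<odot>\<^bsub>W\<^esub> \<psi> x y"
    and psi_even: "\<lbrakk>x \<in> grade L p; y \<in> grade L q\<rbrakk> \<Longrightarrow> \<psi> x y \<in> grade W (p + q)"
    and psi_skew: "\<lbrakk>x \<in> grade L p; y \<in> grade L q\<rbrakk> \<Longrightarrow> \<psi> x y = sg W (p * q + 1) (\<psi> y x)"
    and psi_alternating: "x \<in> grade L 0 \<Longrightarrow> \<psi> x x = \<zero>\<^bsub>W\<^esub>"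
    and psi_cocycle: "\<lbrakk>x \<in> grade L p; y \<in> grade L q; z \<in> grade L r\<rbrakk> \<Longrightarrow>
      sg W (p * r) (\<psi> (bracket L x y) z) \<oplus>\<^bsub>W\<^esub> sg W (p * q) (\<psi> (bracket L y z) x) \<oplus>\<^bsub>W\<^esub>
      sg W (q * r) (\<psi> (bracket L z x) y) = \<zero>\<^bsub>W\<^esub>"
begin

abbreviation E where "E \<equiv> cocycle_ext L W \<psi>"

lemma E_simps [simp]:
  "carrier E = carrier L \<times> carrier W"
  "bracket E (x, v) (y, w) = (bracket L x y, \<psi> x y)"
  "\<zero>\<^bsub>E\<^esub> = (\<zero>\<^bsub>L\<^esub>, \<zero>\<^bsub>W\<^esub>)"
  "(x, v) \<oplus>\<^bsub>E\<^esub> (y, w) = (x \<oplus>\<^bsub>L\<^esub> y, v \<oplus>\<^bsub>W\<^esub> w)"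
  "k \<odot>\<^bsub>E\<^esub> (x, v) = (k \<odot>\<^bsub>L\<^esub> x, k \<odot>\<^bsub>W\<^esub> v)"
  "grade E p = grade L p \<times> grade W p"
  by (simp_all add: cocycle_ext_def)

lemma module_E: "module K E"
proof (rule moduleI)
  show "abelian_group E"
  proof (rule abelian_groupI)
    show "\<exists>y\<in>carrier E. y \<oplus>\<^bsub>E\<^esub> x = \<zero>\<^bsub>E\<^esub>" if "x \<in> carrier E" for x
      using that by (cases x) (auto intro!: bexI[of _ "\<ominus>\<^bsub>L\<^esub> fst x"] bexI[of _ "\<ominus>\<^bsub>W\<^esub> snd x"]
          simp: L.M.l_neg W.M.l_neg)
  qed (auto simp: L.M.a_ac W.M.a_ac)
qed (auto simp: L.R.is_cring L.smult_l_distr L.smult_r_distr L.smult_assoc1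
    W.smult_l_distr W.smult_r_distr W.smult_assoc1)

sublocale E: module K E by (rule module_E)

lemma minus_E [simp]: "\<lbrakk>x \<in> carrier L; v \<in> carrier W\<rbrakk> \<Longrightarrow> \<ominus>\<^bsub>E\<^esub> (x, v) = (\<ominus>\<^bsub>L\<^esub> x, \<ominus>\<^bsub>W\<^esub> v)"
  by (intro E.M.minus_equality) (auto simp: L.M.l_neg W.M.l_neg)

lemma sg_E: "\<lbrakk>x \<in> carrier L; v \<in> carrier W\<rbrakk> \<Longrightarrow> sg E p (x, v) = (sg L p x, sg W p v)"
  by (simp add: sg_def)

lemma graded_module_E: "graded_module K E"
proof (rule graded_moduleI[OF module_E])
  show "submodule (grade E p) K E" for p
    by (rule E.submoduleI) (auto simp: L.grade_carrier W.grade_carrier)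
  show "\<exists>y\<in>grade E 0. \<exists>z\<in>grade E 1. x = y \<oplus>\<^bsub>E\<^esub> z" if "x \<in> carrier E" for x
  proof (cases x)
    case (Pair a w)
    then show ?thesis using that
      by (intro bexI[of _ "(gpart L 0 a, gpart W 0 w)"] bexI[of _ "(gpart L 1 a, gpart W 1 w)"])
        (auto simp: L.gpart_decomp W.gpart_decomp)
  qed
  show "y = \<zero>\<^bsub>E\<^esub>" if "y \<in> grade E 0" "y \<in> grade E 1" for y
    using that L.gpart_homog[of "fst y" 0 0] L.gpart_homog[of "fst y" 1 0]
      W.gpart_homog[of "snd y" 0 0] W.gpart_homog[of "snd y" 1 0] by auto
qed

theorem lie_superalgebra_E: "lie_superalgebra K E"
proof (intro lie_superalgebra.intro graded_module_E lie_superalgebra_axioms.intro)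
  fix x y p q assume xy: "x \<in> grade E p" "y \<in> grade E q"
  then show "bracket E x y \<in> grade E (p + q)"
    by (auto simp: L.bracket_even psi_even)
  obtain a v b w where e: "x = (a, v)" "y = (b, w)" "a \<in> grade L p" "b \<in> grade L q"
    using xy by auto
  note c = e(3,4)[THEN L.grade_carrier]
  have "bracket E x y = sg E (p * q + 1) (bracket E y x)"
    using L.skew[OF e(3,4)] psi_skew[OF e(3,4)] c unfolding e(1,2) by (simp add: sg_E psi_closed)
  then show "bracket E x y = \<ominus>\<^bsub>E\<^esub> ([ksgn (p * q)] \<cdot>\<^bsub>E\<^esub> bracket E y x)"
    using c unfolding e(1,2) by (simp add: E.M.ksgn_pow psi_closed E.M.minus_sg)
next
  fix x y z p q r assume xyz: "x \<in> grade E p" "y \<in> grade E q" "z \<in> grade E r"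
  obtain a v b w d u where e: "x = (a, v)" "y = (b, w)" "z = (d, u)" and
    g: "a \<in> grade L p" "b \<in> grade L q" "d \<in> grade L r"
    using xyz by auto
  note c = g[THEN L.grade_carrier]
  show "[ksgn (p * r)] \<cdot>\<^bsub>E\<^esub> bracket E (bracket E x y) z \<oplus>\<^bsub>E\<^esub>
      [ksgn (p * q)] \<cdot>\<^bsub>E\<^esub> bracket E (bracket E y z) x \<oplus>\<^bsub>E\<^esub>
      [ksgn (q * r)] \<cdot>\<^bsub>E\<^esub> bracket E (bracket E z x) y = \<zero>\<^bsub>E\<^esub>"
    using L.jacobi[OF g] psi_cocycle[OF g] c unfolding e
    by (simp add: E.M.ksgn_pow psi_closed sg_E)
qed (auto simp: L.bracket_add_left L.bracket_add_right L.bracket_smult_left L.bracket_smult_right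
    psi_closed psi_add_left psi_add_right psi_smult_left psi_smult_right L.bracket_alternating psi_alternating)

lemma psi_zero_left: "x \<in> carrier L \<Longrightarrow> \<psi> \<zero>\<^bsub>L\<^esub> x = \<zero>\<^bsub>W\<^esub>"
  using psi_smult_left[of "\<zero>\<^bsub>K\<^esub>" "\<zero>\<^bsub>L\<^esub>" x] psi_closed by simp

lemma center_E: "w \<in> carrier W \<Longrightarrow> (\<zero>\<^bsub>L\<^esub>, w) \<in> lie_center E"
  by (auto simp: lie_center_def psi_zero_left)

theorem central_extension_E: "central_extension K E L fst"
  unfolding central_extension_def
proof (intro conjI lie_superalgebra_E L.lie_superalgebra_axioms)
  show "fst \<in> lie_super_hom K E L" by (auto simp: lie_super_hom_def)
  show "fst ` carrier E = carrier L" by (auto intro: image_eqI[of _ _ "(_, \<zero>\<^bsub>W\<^esub>)"])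
  show "a_kernel E L fst \<subseteq> lie_center E"
    by (auto simp: a_kernel_def' center_E)
qed

end

section \<open>The Lie superalgebra of an associative superalgebra\<close>

text \<open>The sign of a supercommutator depends on the degrees. For general elements the formula
  therefore subtracts \<open>y x\<^sub>0\<close> and the product of the parity involution of
  \<open>y\<close> with \<open>x\<^sub>1\<close>.\<close>

definition supercomm :: "('k, 'a, 'z) supermodule_scheme \<Rightarrow> 'a \<Rightarrow> 'a \<Rightarrow> 'a"
  where "supercomm B x y = x \<otimes>\<^bsub>B\<^esub> y \<ominus>\<^bsub>B\<^esub>
    (y \<otimes>\<^bsub>B\<^esub> gpart B 0 x \<oplus>\<^bsub>B\<^esub> (gpart B 0 y \<ominus>\<^bsub>B\<^esub> gpart B 1 y) \<otimes>\<^bsub>B\<^esub> gpart B 1 x)"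

definition lie_of :: "('k, 'a, 'z) supermodule_scheme \<Rightarrow> ('k, 'a, 'z) supermodule_scheme"
  where "lie_of B = B\<lparr>mult := supercomm B\<rparr>"

lemma lie_of_simps [simp]:
  "carrier (lie_of B) = carrier B" "bracket (lie_of B) = supercomm B" "zero (lie_of B) = zero B"
  "add (lie_of B) = add B" "smult (lie_of B) = smult B" "grade (lie_of B) = grade B"
  "a_inv (lie_of B) = a_inv B" "sg (lie_of B) = sg B"
  by (simp_all add: lie_of_def a_inv_def fun_eq_iff sg_def)

context superalgebra
begin

lemma supercomm_closed [simp]: "\<lbrakk>x \<in> carrier A; y \<in> carrier A\<rbrakk> \<Longrightarrow> supercomm A x y \<in> carrier A"
  by (simp add: supercomm_def)

lemma supercomm_homog:
  assumes x: "x \<in> grade A p" and y: "y \<in> grade A q"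
  shows "supercomm A x y = x \<otimes>\<^bsub>A\<^esub> y \<oplus>\<^bsub>A\<^esub> sg A (p * q + 1) (y \<otimes>\<^bsub>A\<^esub> x)"
  using grade_carrier[OF x] grade_carrier[OF y]
  by (cases p; cases q) (simp_all add: supercomm_def gpart_homog[OF x] gpart_homog[OF y] sg_1 a_minus_def
      l_minus)

lemma supercomm_add_left: "\<lbrakk>x \<in> carrier A; y \<in> carrier A; z \<in> carrier A\<rbrakk> \<Longrightarrow>
    supercomm A (x \<oplus>\<^bsub>A\<^esub> y) z = supercomm A x z \<oplus>\<^bsub>A\<^esub> supercomm A y z"
  by (simp add: supercomm_def gpart_add l_distr r_distr a_minus_def minus_add a_ac)

lemma supercomm_add_right: "\<lbrakk>x \<in> carrier A; y \<in> carrier A; z \<in> carrier A\<rbrakk> \<Longrightarrow>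
    supercomm A x (y \<oplus>\<^bsub>A\<^esub> z) = supercomm A x y \<oplus>\<^bsub>A\<^esub> supercomm A x z"
  by (simp add: supercomm_def gpart_add l_distr r_distr a_minus_def minus_add a_ac)

lemma supercomm_smult_left: "\<lbrakk>k \<in> carrier K; x \<in> carrier A; y \<in> carrier A\<rbrakk> \<Longrightarrow>
    supercomm A (k \<odot>\<^bsub>A\<^esub> x) y = k \<odot>\<^bsub>A\<^esub> supercomm A x y"
  by (simp add: supercomm_def gpart_smult smult_mult_left smult_mult_right a_minus_def
      smult_r_distr smult_r_minus)

lemma supercomm_smult_right: "\<lbrakk>k \<in> carrier K; x \<in> carrier A; y \<in> carrier A\<rbrakk> \<Longrightarrow>
    supercomm A x (k \<odot>\<^bsub>A\<^esub> y) = k \<odot>\<^bsub>A\<^esub> supercomm A x y"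
  by (simp add: supercomm_def gpart_smult smult_mult_left smult_mult_right a_minus_def
      smult_r_distr smult_r_minus l_distr l_minus)

lemma supercomm_even: "\<lbrakk>x \<in> grade A p; y \<in> grade A q\<rbrakk> \<Longrightarrow> supercomm A x y \<in> grade A (p + q)"
  using mult_even[of x p y q] mult_even[of y q x p] by (simp add: supercomm_homog add.commute)

text \<open>Each of the six products of \<open>x\<close>, \<open>y\<close>, \<open>z\<close>
  occurs twice, with opposite signs.\<close>

lemma supercomm_jacobi:
  assumes x: "x \<in> grade A p" and y: "y \<in> grade A q" and z: "z \<in> grade A r"
  shows "sg A (p * r) (supercomm A (supercomm A x y) z) \<oplus>\<^bsub>A\<^esub>
      (sg A (p * q) (supercomm A (supercomm A y z) x) \<oplus>\<^bsub>A\<^esub>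
      sg A (q * r) (supercomm A (supercomm A z x) y)) = \<zero>\<^bsub>A\<^esub>" (is "?J = _")
proof -
  note [simp] = assms[THEN grade_carrier]
  have br: "supercomm A (supercomm A a b) d = (a \<otimes>\<^bsub>A\<^esub> (b \<otimes>\<^bsub>A\<^esub> d) \<oplus>\<^bsub>A\<^esub> sg A (i * j + 1) (b \<otimes>\<^bsub>A\<^esub> (a \<otimes>\<^bsub>A\<^esub> d))) \<oplus>\<^bsub>A\<^esub>
      (sg A ((i + j) * k + 1) (d \<otimes>\<^bsub>A\<^esub> (a \<otimes>\<^bsub>A\<^esub> b)) \<oplus>\<^bsub>A\<^esub> sg A ((i + j) * k + 1 + (i * j + 1)) (d \<otimes>\<^bsub>A\<^esub> (b \<otimes>\<^bsub>A\<^esub> a)))"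
    if g: "a \<in> grade A i" "b \<in> grade A j" "d \<in> grade A k" for a b d i j k
  proof -
    note [simp] = g[THEN grade_carrier]
    show ?thesis
      unfolding supercomm_homog[OF supercomm_even[OF g(1,2)] g(3)]
      by (simp add: supercomm_homog[OF g(1,2)] l_distr r_distr sg_add mult_sg_left mult_sg_right m_assoc)
  qed
  let ?u = "\<lambda>a b d. a \<otimes>\<^bsub>A\<^esub> (b \<otimes>\<^bsub>A\<^esub> d)"
  have "?J = (?u x y z \<oplus>\<^bsub>A\<^esub> sg A 1 (?u x y z)) \<oplus>\<^bsub>A\<^esub> ((?u y z x \<oplus>\<^bsub>A\<^esub> sg A 1 (?u y z x)) \<oplus>\<^bsub>A\<^esub>
     ((?u z x y \<oplus>\<^bsub>A\<^esub> sg A 1 (?u z x y)) \<oplus>\<^bsub>A\<^esub> ((?u y x z \<oplus>\<^bsub>A\<^esub> sg A 1 (?u y x z)) \<oplus>\<^bsub>A\<^esub>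
     ((?u x z y \<oplus>\<^bsub>A\<^esub> sg A 1 (?u x z y)) \<oplus>\<^bsub>A\<^esub> (?u z y x \<oplus>\<^bsub>A\<^esub> sg A 1 (?u z y x))))))"
    unfolding br[OF x y z] br[OF y z x] br[OF z x y]
    by (cases p; cases q; cases r; simp add: sg_add; simp only: a_ac sg_closed m_closed a_closed \<open>x \<in> carrier A\<close>
      \<open>y \<in> carrier A\<close> \<open>z \<in> carrier A\<close>)
  also have "\<dots> = \<zero>\<^bsub>A\<^esub>"
    by (simp add: sg_1 r_neg)
  finally show ?thesis .
qed

theorem lie_superalgebra_lie_of: "lie_superalgebra K (lie_of A)"
proof -
  have ag: "abelian_group (lie_of A)"
    by (rule abelian_groupI) (auto simp: a_ac intro!: bexI[of _ "\<ominus>\<^bsub>A\<^esub> _"] l_neg)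
  have mod: "module K (lie_of A)"
    by (rule moduleI[OF R.is_cring ag]) (auto simp: smult_l_distr smult_r_distr smult_assoc1)
  interpret L: module K "lie_of A" by (rule mod)
  have gm: "graded_module K (lie_of A)"
  proof (rule graded_moduleI[OF mod])
    show "submodule (grade (lie_of A) p) K (lie_of A)" for p
      by (rule L.submoduleI) (auto simp: grade_carrier)
    show "\<exists>y\<in>grade (lie_of A) 0. \<exists>z\<in>grade (lie_of A) 1. x = y \<oplus>\<^bsub>lie_of A\<^esub> z"
      if "x \<in> carrier (lie_of A)" for x
      using that by (intro bexI[of _ "gpart A 0 x"] bexI[of _ "gpart A 1 x"]) (simp_all add: gpart_decomp)
    show "y = \<zero>\<^bsub>lie_of A\<^esub>" if "y \<in> grade (lie_of A) 0" "y \<in> grade (lie_of A) 1" for y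
      using that gpart_homog[of y 0 0] gpart_homog[of y 1 0] by simp
  qed
  show ?thesis
  proof (intro lie_superalgebra.intro gm lie_superalgebra_axioms.intro)
    fix x y p q assume *: "x \<in> grade (lie_of A) p" "y \<in> grade (lie_of A) q"
    then have g: "x \<in> grade A p" "y \<in> grade A q" by auto
    note [simp] = g[THEN grade_carrier]
    show "bracket (lie_of A) x y \<in> grade (lie_of A) (p + q)"
      using g by (simp add: supercomm_even)
    have "supercomm A x y = sg A (p * q + 1) (supercomm A y x)"
      by (simp add: supercomm_homog[OF g] supercomm_homog[OF g(2,1)] sg_add a_comm mult.commute)
    then show "bracket (lie_of A) x y = \<ominus>\<^bsub>lie_of A\<^esub> ([ksgn (p * q)] \<cdot>\<^bsub>lie_of A\<^esub> bracket (lie_of A) y x)"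
      by (simp add: L.M.ksgn_pow minus_sg)
  next
    fix x assume "x \<in> grade (lie_of A) 0"
    then show "bracket (lie_of A) x x = \<zero>\<^bsub>lie_of A\<^esub>"
      using supercomm_homog[of x 0 x 0] grade_carrier[of x 0] by (simp add: sg_1 r_neg)
  next
    fix x y z p q r
    assume "x \<in> grade (lie_of A) p" "y \<in> grade (lie_of A) q" "z \<in> grade (lie_of A) r"
    then have g: "x \<in> grade A p" "y \<in> grade A q" "z \<in> grade A r" by auto
    note [simp] = g[THEN grade_carrier]
    show "[ksgn (p * r)] \<cdot>\<^bsub>lie_of A\<^esub> bracket (lie_of A) (bracket (lie_of A) x y) z \<oplus>\<^bsub>lie_of A\<^esub>
      [ksgn (p * q)] \<cdot>\<^bsub>lie_of A\<^esub> bracket (lie_of A) (bracket (lie_of A) y z) x \<oplus>\<^bsub>lie_of A\<^esub>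
      [ksgn (q * r)] \<cdot>\<^bsub>lie_of A\<^esub> bracket (lie_of A) (bracket (lie_of A) z x) y = \<zero>\<^bsub>lie_of A\<^esub>"
      using supercomm_jacobi[OF g] by (simp add: L.M.ksgn_pow a_assoc)
  qed (simp_all add: supercomm_add_left supercomm_add_right supercomm_smult_left supercomm_smult_right)
qed

end

section \<open>Matrices\<close>

abbreviation idx2 :: "(nat \<times> nat) set" where "idx2 \<equiv> idx \<times> idx"

text \<open>With the four terms written out, identities between matrix entries become identities
  between short sums, which normalisation by associativity and commutativity decides.\<close>

definition sum4 :: "('a, 'z) ring_scheme \<Rightarrow> (nat \<Rightarrow> 'a) \<Rightarrow> 'a"
  where "sum4 G f = f 1 \<oplus>\<^bsub>G\<^esub> (f 2 \<oplus>\<^bsub>G\<^esub> (f 3 \<oplus>\<^bsub>G\<^esub> f 4))"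

text \<open>The entry at \<open>(i, j)\<close> contributes its own degree plus \<open>|i| +
  |j|\<close>. For this grading the ordinary matrix product, without signs, is even.\<close>

definition mat_alg :: "('k, 'a, 'z) supermodule_scheme \<Rightarrow> ('k, nat \<times> nat \<Rightarrow> 'a) supermodule"
  where "mat_alg A = \<lparr>carrier = (\<Pi>\<^sub>E t\<in>idx2. carrier A),
    mult = (\<lambda>x y. \<lambda>t\<in>idx2. sum4 A (\<lambda>m. x (fst t, m) \<otimes>\<^bsub>A\<^esub> y (m, snd t))),
    one = (\<lambda>t\<in>idx2. if fst t = snd t then \<one>\<^bsub>A\<^esub> else \<zero>\<^bsub>A\<^esub>),
    zero = (\<lambda>t\<in>idx2. \<zero>\<^bsub>A\<^esub>),
    add = (\<lambda>x y. \<lambda>t\<in>idx2. x t \<oplus>\<^bsub>A\<^esub> y t),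
    smult = (\<lambda>k x. \<lambda>t\<in>idx2. k \<odot>\<^bsub>A\<^esub> x t),
    grade = (\<lambda>p. \<Pi>\<^sub>E t\<in>idx2. grade A (p + ipar (fst t) + ipar (snd t)))\<rparr>"

definition elem_mat :: "('k, 'a, 'z) supermodule_scheme \<Rightarrow> nat \<Rightarrow> nat \<Rightarrow> 'a \<Rightarrow> nat \<times> nat \<Rightarrow> 'a"
  where "elem_mat A i j a = (\<lambda>t\<in>idx2. if t = (i, j) then a else \<zero>\<^bsub>A\<^esub>)"

text \<open>Membership in the index sets is left to dedicated rules, and the index 1 is not to be
  turned into a successor.\<close>

declare One_nat_def [simp del] atLeastAtMost_iff [simp del]

lemma idx_cases: 
  assumes "i \<in> idx" obtains "i = 1" | "i = 2" | "i = 3" | "i = 4"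
  using assms by (force simp: atLeastAtMost_iff)

lemma idx_mem [simp]: "1 \<in> idx" "2 \<in> idx" "3 \<in> idx" "4 \<in> idx"
  by (auto simp: atLeastAtMost_iff)

context superalgebra
begin

abbreviation Mat where "Mat \<equiv> mat_alg A"

lemma sum4_closed [simp]: "(\<And>m. m \<in> idx \<Longrightarrow> f m \<in> carrier A) \<Longrightarrow> sum4 A f \<in> carrier A"
  by (simp add: sum4_def)

lemma mat_closed [simp]: "\<lbrakk>x \<in> carrier Mat; i \<in> idx; j \<in> idx\<rbrakk> \<Longrightarrow> x (i, j) \<in> carrier A"
  by (auto simp: mat_alg_def)

lemma mat_eqI: "\<lbrakk>x \<in> carrier Mat; y \<in> carrier Mat; \<And>i j. \<lbrakk>i \<in> idx; j \<in> idx\<rbrakk> \<Longrightarrow> x (i, j) = y (i, j)\<rbrakk> \<Longrightarrow> x = y"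
  by (rule PiE_ext[where k = idx2]) (auto simp: mat_alg_def)

lemma mat_memI: "\<lbrakk>x \<in> extensional idx2; \<And>i j. \<lbrakk>i \<in> idx; j \<in> idx\<rbrakk> \<Longrightarrow> x (i, j) \<in> carrier A\<rbrakk> \<Longrightarrow> x \<in> carrier Mat"
  by (auto simp: mat_alg_def PiE_iff)

lemma mat_app:
  assumes "i \<in> idx" "j \<in> idx"
  shows "(x \<oplus>\<^bsub>Mat\<^esub> y) (i, j) = x (i, j) \<oplus>\<^bsub>A\<^esub> y (i, j)"
    "(k \<odot>\<^bsub>Mat\<^esub> x) (i, j) = k \<odot>\<^bsub>A\<^esub> x (i, j)"
    "\<zero>\<^bsub>Mat\<^esub> (i, j) = \<zero>\<^bsub>A\<^esub>"
    "\<one>\<^bsub>Mat\<^esub> (i, j) = (if i = j then \<one>\<^bsub>A\<^esub> else \<zero>\<^bsub>A\<^esub>)"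
    "(x \<otimes>\<^bsub>Mat\<^esub> y) (i, j) = sum4 A (\<lambda>m. x (i, m) \<otimes>\<^bsub>A\<^esub> y (m, j))"
  using assms by (simp_all add: mat_alg_def)

lemma mat_ext: "x \<oplus>\<^bsub>Mat\<^esub> y \<in> extensional idx2" "k \<odot>\<^bsub>Mat\<^esub> x \<in> extensional idx2"
    "\<zero>\<^bsub>Mat\<^esub> \<in> extensional idx2" "\<one>\<^bsub>Mat\<^esub> \<in> extensional idx2" "x \<otimes>\<^bsub>Mat\<^esub> y \<in> extensional idx2"
  by (simp_all add: mat_alg_def)

lemma mat_ops_closed:
  "\<lbrakk>x \<in> carrier Mat; y \<in> carrier Mat\<rbrakk> \<Longrightarrow> x \<oplus>\<^bsub>Mat\<^esub> y \<in> carrier Mat"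
  "\<lbrakk>k \<in> carrier K; x \<in> carrier Mat\<rbrakk> \<Longrightarrow> k \<odot>\<^bsub>Mat\<^esub> x \<in> carrier Mat"
  "\<zero>\<^bsub>Mat\<^esub> \<in> carrier Mat" "\<one>\<^bsub>Mat\<^esub> \<in> carrier Mat"
  "\<lbrakk>x \<in> carrier Mat; y \<in> carrier Mat\<rbrakk> \<Longrightarrow> x \<otimes>\<^bsub>Mat\<^esub> y \<in> carrier Mat"
  by (rule mat_memI[OF mat_ext(1)] mat_memI[OF mat_ext(2)] mat_memI[OF mat_ext(3)] mat_memI[OF mat_ext(4)] mat_memI[OF mat_ext(5)];
      simp add: mat_app)+

lemma mat_grade: "x \<in> grade Mat p \<longleftrightarrow> x \<in> extensional idx2 \<and>
    (\<forall>i\<in>idx. \<forall>j\<in>idx. x (i, j) \<in> grade A (p + ipar i + ipar j))"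
  by (auto simp: mat_alg_def PiE_iff)

lemma grade_MatD: "\<lbrakk>x \<in> grade Mat p; i \<in> idx; j \<in> idx\<rbrakk> \<Longrightarrow> x (i, j) \<in> grade A (p + ipar i + ipar j)"
  by (simp add: mat_grade)

lemma elem_mat_app: "\<lbrakk>s \<in> idx; t \<in> idx\<rbrakk> \<Longrightarrow> elem_mat A i j a (s, t) = (if s = i \<and> t = j then a else \<zero>\<^bsub>A\<^esub>)"
  by (simp add: elem_mat_def)

lemma elem_mat_closed [simp]: "a \<in> carrier A \<Longrightarrow> elem_mat A i j a \<in> carrier Mat"
  by (rule mat_memI) (simp_all add: elem_mat_app, simp add: elem_mat_def)

lemma elem_mat_grade: "a \<in> grade A p \<Longrightarrow> elem_mat A i j a \<in> grade Mat (ipar i + ipar j + p)"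
  by (auto simp: mat_grade elem_mat_app ac_simps) (simp add: elem_mat_def)

lemma elem_mat_mult:
  assumes "i \<in> idx" "j \<in> idx" "k \<in> idx" "l \<in> idx" "a \<in> carrier A" "b \<in> carrier A"
  shows "elem_mat A i j a \<otimes>\<^bsub>Mat\<^esub> elem_mat A k l b = (if j = k then elem_mat A i l (a \<otimes>\<^bsub>A\<^esub> b) else \<zero>\<^bsub>Mat\<^esub>)"
proof (rule mat_eqI)
  fix s t assume st: "s \<in> idx" "t \<in> idx"
  show "(elem_mat A i j a \<otimes>\<^bsub>Mat\<^esub> elem_mat A k l b) (s, t) = (if j = k then elem_mat A i l (a \<otimes>\<^bsub>A\<^esub> b) else \<zero>\<^bsub>Mat\<^esub>) (s, t)"
    using assms(2) by (cases rule: idx_cases) (use assms st in \<open>auto simp: mat_app elem_mat_app sum4_def\<close>)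
qed (use assms in \<open>simp_all add: mat_ops_closed\<close>)

lemma elem_mat_linear:
  "\<lbrakk>a \<in> carrier A; b \<in> carrier A\<rbrakk> \<Longrightarrow> elem_mat A i j (a \<oplus>\<^bsub>A\<^esub> b) = elem_mat A i j a \<oplus>\<^bsub>Mat\<^esub> elem_mat A i j b"
  "\<lbrakk>k \<in> carrier K; a \<in> carrier A\<rbrakk> \<Longrightarrow> elem_mat A i j (k \<odot>\<^bsub>A\<^esub> a) = k \<odot>\<^bsub>Mat\<^esub> elem_mat A i j a"
  by (rule mat_eqI; simp add: mat_app elem_mat_app mat_ops_closed)+

theorem superalgebra_Mat: "superalgebra K Mat"
proof -
  note [simp] = mat_ops_closed mat_app
  have ag: "abelian_group Mat"
  proof (rule abelian_groupI)
    show "\<exists>y\<in>carrier Mat. y \<oplus>\<^bsub>Mat\<^esub> x = \<zero>\<^bsub>Mat\<^esub>" if x: "x \<in> carrier Mat" for x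
    proof
      have e: "(\<ominus>\<^bsub>K\<^esub> \<one>\<^bsub>K\<^esub>) \<odot>\<^bsub>Mat\<^esub> x \<in> carrier Mat" using x by simp
      then show "(\<ominus>\<^bsub>K\<^esub> \<one>\<^bsub>K\<^esub>) \<odot>\<^bsub>Mat\<^esub> x \<in> carrier Mat" .
      show "(\<ominus>\<^bsub>K\<^esub> \<one>\<^bsub>K\<^esub>) \<odot>\<^bsub>Mat\<^esub> x \<oplus>\<^bsub>Mat\<^esub> x = \<zero>\<^bsub>Mat\<^esub>"
        using x e by (intro mat_eqI) (simp_all add: smult_l_minus l_neg)
    qed
  qed (auto intro!: mat_eqI simp: a_ac)
  have mod: "module K Mat"
    by (rule moduleI[OF R.is_cring ag]; (intro mat_eqI)?)
      (auto simp: smult_l_distr smult_r_distr smult_assoc1)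
  have rng: "ring Mat"
  proof (rule ringI[OF ag])
    show "monoid Mat"
    proof (rule monoidI)
      show "x \<otimes>\<^bsub>Mat\<^esub> y \<otimes>\<^bsub>Mat\<^esub> z = x \<otimes>\<^bsub>Mat\<^esub> (y \<otimes>\<^bsub>Mat\<^esub> z)"
        if "x \<in> carrier Mat" "y \<in> carrier Mat" "z \<in> carrier Mat" for x y z
        using that by (intro mat_eqI) (simp_all add: sum4_def l_distr r_distr m_assoc a_ac)
      show "\<one>\<^bsub>Mat\<^esub> \<otimes>\<^bsub>Mat\<^esub> x = x" if "x \<in> carrier Mat" for x
        using that by (intro mat_eqI) (auto simp: sum4_def elim!: idx_cases)
      show "x \<otimes>\<^bsub>Mat\<^esub> \<one>\<^bsub>Mat\<^esub> = x" if "x \<in> carrier Mat" for x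
        using that by (intro mat_eqI) (auto simp: sum4_def elim!: idx_cases)
    qed simp_all
  qed (auto intro!: mat_eqI simp: sum4_def l_distr r_distr a_ac)
  interpret M: module K Mat by (rule mod)
  have gc: "x \<in> carrier Mat" if "x \<in> grade Mat p" for x p
    using that by (intro mat_memI) (auto simp: mat_grade dest: grade_carrier)
  have gm: "graded_module K Mat"
  proof (rule graded_moduleI[OF mod])
    show "submodule (grade Mat p) K Mat" for p
    proof (rule M.submoduleI)
      show sm: "k \<odot>\<^bsub>Mat\<^esub> x \<in> grade Mat p" if "k \<in> carrier K" "x \<in> grade Mat p" for k x
        using that by (simp add: mat_grade mat_ext)
      show "\<ominus>\<^bsub>Mat\<^esub> x \<in> grade Mat p" if "x \<in> grade Mat p" for x
        using sm[of "\<ominus>\<^bsub>K\<^esub> \<one>\<^bsub>K\<^esub>" x] gc[OF that] that by (simp add: M.smult_l_minus)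
    next
      show "grade Mat p \<subseteq> carrier Mat" using gc by blast
    qed (simp_all add: mat_grade mat_ext)
    show "\<exists>y\<in>grade Mat 0. \<exists>z\<in>grade Mat 1. x = y \<oplus>\<^bsub>Mat\<^esub> z" if x: "x \<in> carrier Mat" for x
    proof (intro bexI)
      let ?y = "\<lambda>p. \<lambda>t\<in>idx2. gpart A (p + ipar (fst t) + ipar (snd t)) (x t)"
      show g: "?y 0 \<in> grade Mat 0" "?y 1 \<in> grade Mat 1" using x by (simp_all add: mat_grade)
      show "x = ?y 0 \<oplus>\<^bsub>Mat\<^esub> ?y 1"
      proof (rule mat_eqI)
        fix i j assume ij: "i \<in> idx" "j \<in> idx"
        have "x (i, j) = gpart A (ipar i + ipar j) (x (i, j)) \<oplus>\<^bsub>A\<^esub> gpart A (ipar i + ipar j + 1) (x (i, j))"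
          using x ij by (simp add: gpart_decomp')
        then show "x (i, j) = (?y 0 \<oplus>\<^bsub>Mat\<^esub> ?y 1) (i, j)" using ij by (simp add: ac_simps)
      qed (use x gc[OF g(1)] gc[OF g(2)] in simp_all)
    qed
    show "y = \<zero>\<^bsub>Mat\<^esub>" if y: "y \<in> grade Mat 0" "y \<in> grade Mat 1" for y
    proof (rule mat_eqI)
      fix i j assume ij: "i \<in> idx" "j \<in> idx"
      show "y (i, j) = \<zero>\<^bsub>Mat\<^esub> (i, j)"
        using gpart_homog[OF grade_MatD[OF y(1) ij], of "ipar i + ipar j"]
          gpart_homog[OF grade_MatD[OF y(2) ij], of "ipar i + ipar j"] ij by (simp add: add.assoc)
    qed (use gc[OF y(1)] in simp_all)
  qed
  show ?thesis
  proof (intro superalgebra.intro gm rng superalgebra_axioms.intro)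
    show "\<one>\<^bsub>Mat\<^esub> \<in> grade Mat 0" by (simp add: mat_grade mat_ext one_even)
    fix x y p q assume xy: "x \<in> grade Mat p" "y \<in> grade Mat q"
    have m: "x (i, m) \<otimes>\<^bsub>A\<^esub> y (m, j) \<in> grade A (p + q + ipar i + ipar j)" if "i \<in> idx" "j \<in> idx" "m \<in> idx" for i j m
    proof -
      have "x (i, m) \<otimes>\<^bsub>A\<^esub> y (m, j) \<in> grade A ((p + ipar i + ipar m) + (q + ipar m + ipar j))"
        using that xy by (intro mult_even) (simp_all add: grade_MatD)
      also have "(p + ipar i + ipar m) + (q + ipar m + ipar j) = p + q + ipar i + ipar j"
        by (cases "ipar m") (simp_all add: ac_simps)
      finally show ?thesis .
    qed
    show "x \<otimes>\<^bsub>Mat\<^esub> y \<in> grade Mat (p + q)" by (simp add: mat_grade mat_ext sum4_def m)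
  next
    fix k a b assume *: "k \<in> carrier K" "a \<in> carrier Mat" "b \<in> carrier Mat"
    show "k \<odot>\<^bsub>Mat\<^esub> a \<otimes>\<^bsub>Mat\<^esub> b = k \<odot>\<^bsub>Mat\<^esub> (a \<otimes>\<^bsub>Mat\<^esub> b)"
      using * by (intro mat_eqI) (simp_all add: sum4_def smult_mult_left smult_r_distr)
    show "a \<otimes>\<^bsub>Mat\<^esub> (k \<odot>\<^bsub>Mat\<^esub> b) = k \<odot>\<^bsub>Mat\<^esub> (a \<otimes>\<^bsub>Mat\<^esub> b)"
      using * by (intro mat_eqI) (simp_all add: sum4_def smult_mult_right smult_r_distr)
  qed
qed

end

section \<open>Homomorphisms out of a presentation\<close>

lemma (in lie_presentation) presentation_hom:
  assumes L: "lie_superalgebra K L" and g: "\<And>x. x \<in> G \<Longrightarrow> g x \<in> grade L (d x)"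
    and rel: "\<And>s t. \<lbrakk>(s, t) \<in> R; s \<in> T; t \<in> T\<rbrakk> \<Longrightarrow> eval_term L g s = eval_term L g t"
  obtains f where "f \<in> lie_super_hom K P L" "\<And>t. t \<in> T \<Longrightarrow> f (cls t) = eval_term L g t"
proof -
  interpret L: lie_superalgebra K L by fact
  let ?ev = "eval_term L g"
  have closed[simp]: "?ev t \<in> carrier L" if "t \<in> T" for t
    by (rule L.eval_term_closed[OF _ that]) (auto dest: g L.grade_carrier)
  have wd: "?ev s = ?ev t" if "(s, t) \<in> r" for s t
  proof -
    have "(?ev s \<ominus>\<^bsub>L\<^esub> ?ev t, ?ev s \<ominus>\<^bsub>L\<^esub> ?ev t) \<in> {(\<zero>\<^bsub>L\<^esub>, \<zero>\<^bsub>L\<^esub>)}"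
      by (rule eval_term_cong_mod_center[OF L L g g _ _ _ _ _ lie_presentation_axioms that])
        (auto simp: lie_center_def L.M.eq_minus_iff intro: rel)
    then show ?thesis using cong_terms[OF that] by (simp add: L.M.eq_minus_iff)
  qed
  define f where "f x = ?ev (SOME t. t \<in> T \<and> x = cls t)" for x
  have f: "f (cls t) = ?ev t" if "t \<in> T" for t
  proof -
    have "\<exists>s. s \<in> T \<and> cls t = cls s" using that by blast
    from someI_ex[OF this] show ?thesis unfolding f_def using that wd cls_eq_iff by metis
  qed
  have "f \<in> lie_super_hom K P L"
    unfolding lie_super_hom_def
  proof (intro CollectI conjI ballI allI)
    show "f \<in> carrier P \<rightarrow> carrier L" by (auto elim!: cls_cases simp: f)
    show "f ` grade P p \<subseteq> grade L p" for p
      using L.eval_term_homog[OF g] by (auto elim!: grade_P_E simp: f homog_terms)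
  qed ((elim cls_cases; simp add: cls_ops f)+)
  then show ?thesis using f that by blast
qed

lemma lie_super_homD:
  assumes "f \<in> lie_super_hom K L M"
  shows "x \<in> carrier L \<Longrightarrow> f x \<in> carrier M"
    "\<lbrakk>x \<in> carrier L; y \<in> carrier L\<rbrakk> \<Longrightarrow> f (x \<oplus>\<^bsub>L\<^esub> y) = f x \<oplus>\<^bsub>M\<^esub> f y"
    "\<lbrakk>k \<in> carrier K; x \<in> carrier L\<rbrakk> \<Longrightarrow> f (k \<odot>\<^bsub>L\<^esub> x) = k \<odot>\<^bsub>M\<^esub> f x"
    "\<lbrakk>x \<in> carrier L; y \<in> carrier L\<rbrakk> \<Longrightarrow> f (bracket L x y) = bracket M (f x) (f y)"
    "x \<in> grade L p \<Longrightarrow> f x \<in> grade M p"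
  using assms unfolding lie_super_hom_def by blast+

section \<open>The Steinberg Lie superalgebra and its matrix representation\<close>

context super_W
begin

abbreviation L where "L \<equiv> st22 K A"
abbreviation F where "F \<equiv> stF K A"

lemma st_presentation: "lie_presentation K (st_gens A) st_deg (st_rels K A)"
proof
  show "\<exists>p. homog_term K (st_gens A) st_deg p s \<and> homog_term K (st_gens A) st_deg p t"
    if "(s, t) \<in> st_rels K A" for s t
    using that
  proof cases
    case (gen_add i j a p b)
    then have "homog_term K (st_gens A) st_deg (ipar i + ipar j + p) (Gen (i, j, p, c))" if "c \<in> grade A p" for c
      using homog_term.gen[of "(i, j, p, c)" "st_gens A" K st_deg] that by (simp add: st_gens_def)
    then show ?thesis using gen_add
      by (auto intro!: exI[of _ "ipar i + ipar j + p"] homog_term.add)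
  next
    case (gen_smult i j k a p)
    then have "homog_term K (st_gens A) st_deg (ipar i + ipar j + p) (Gen (i, j, p, c))" if "c \<in> grade A p" for c
      using homog_term.gen[of "(i, j, p, c)" "st_gens A" K st_deg] that by (simp add: st_gens_def)
    then show ?thesis using gen_smult
      by (auto intro!: exI[of _ "ipar i + ipar j + p"] homog_term.smult)
  next
    case (br_chain i j k a p b q)
    have g: "homog_term K (st_gens A) st_deg (ipar s + ipar t + p) (Gen (s, t, p, c))"
      if "s \<in> idx" "t \<in> idx" "s \<noteq> t" "c \<in> grade A p" for s t c p
      using homog_term.gen[of "(s, t, p, c)" "st_gens A" K st_deg] that by (simp add: st_gens_def)
    have "homog_term K (st_gens A) st_deg ((ipar i + ipar j + p) + (ipar j + ipar k + q))
        (Br (Gen (i, j, p, a)) (Gen (j, k, q, b)))"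
      using br_chain by (intro homog_term.br g) auto
    moreover have "homog_term K (st_gens A) st_deg (ipar i + ipar k + (p + q)) (Gen (i, k, p + q, a \<otimes>\<^bsub>A\<^esub> b))"
      using br_chain by (intro g) (auto intro: mult_even)
    moreover have "(ipar i + ipar j + p) + (ipar j + ipar k + q) = ipar i + ipar k + (p + q)"
      by (cases "ipar j") (simp_all add: ac_simps)
    ultimately show ?thesis using br_chain by metis
  next
    case (br_zero i j k l a p b q)
    have g: "homog_term K (st_gens A) st_deg (ipar s + ipar t + p) (Gen (s, t, p, c))"
      if "s \<in> idx" "t \<in> idx" "s \<noteq> t" "c \<in> grade A p" for s t c p
      using homog_term.gen[of "(s, t, p, c)" "st_gens A" K st_deg] that by (simp add: st_gens_def)
    have "homog_term K (st_gens A) st_deg ((ipar i + ipar j + p) + (ipar k + ipar l + q))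
        (Br (Gen (i, j, p, a)) (Gen (k, l, q, b)))"
      using br_zero by (intro homog_term.br g) auto
    then show ?thesis using br_zero homog_term.zero by blast
  qed
qed

sublocale st: lie_presentation K "st_gens A" st_deg "st_rels K A"
  by (rule st_presentation)

lemma L_eq: "L = st.P"
  by (simp add: st22_def)

lemma lie_superalgebra_L: "lie_superalgebra K L"
  unfolding L_eq by (rule st.lie_superalgebra_P)

sublocale L: lie_superalgebra K L by (rule lie_superalgebra_L)

lemma F_eq: "F i j p a = st.cls (Gen (i, j, p, a))"
  by (simp add: stF_def st.cls_def)

lemma gens_mem [simp]: "\<lbrakk>i \<in> idx; j \<in> idx; i \<noteq> j; a \<in> grade A p\<rbrakk> \<Longrightarrow> (i, j, p, a) \<in> st_gens A"
  by (simp add: st_gens_def)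

lemma gens_E:
  assumes "x \<in> st_gens A"
  obtains i j p a where "x = (i, j, p, a)" "i \<in> idx" "j \<in> idx" "i \<noteq> j" "a \<in> grade A p"
  using assms by (auto simp: st_gens_def)

lemma F_grade:
  assumes "i \<in> idx" "j \<in> idx" "i \<noteq> j" "a \<in> grade A p"
  shows "F i j p a \<in> grade L (ipar i + ipar j + p)"
  unfolding F_eq L_eq
  using st.grade_P_I[OF homog_term.gen[OF gens_mem[OF assms], where d = st_deg]] by simp

lemma F_closed [simp]: "\<lbrakk>i \<in> idx; j \<in> idx; i \<noteq> j; a \<in> grade A p\<rbrakk> \<Longrightarrow> F i j p a \<in> carrier L"
  using F_grade L.grade_carrier by blast

lemma F_add:
  assumes "i \<in> idx" "j \<in> idx" "i \<noteq> j" "a \<in> grade A p" "b \<in> grade A p"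
  shows "F i j p (a \<oplus>\<^bsub>A\<^esub> b) = F i j p a \<oplus>\<^bsub>L\<^esub> F i j p b"
  unfolding F_eq L_eq using assms
  by (simp add: st.cls_ops lie_terms.gen, intro st.cls_eqI lie_cong.rel[OF st_rels.gen_add]) auto

lemma F_smult:
  assumes "i \<in> idx" "j \<in> idx" "i \<noteq> j" "k \<in> carrier K" "a \<in> grade A p"
  shows "F i j p (k \<odot>\<^bsub>A\<^esub> a) = k \<odot>\<^bsub>L\<^esub> F i j p a"
  unfolding F_eq L_eq using assms
  by (simp add: st.cls_ops lie_terms.gen, intro st.cls_eqI lie_cong.rel[OF st_rels.gen_smult]) auto

lemma F_chain:
  assumes "i \<in> idx" "j \<in> idx" "k \<in> idx" "i \<noteq> j" "j \<noteq> k" "i \<noteq> k" "a \<in> grade A p" "b \<in> grade A q"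
  shows "bracket L (F i j p a) (F j k q b) = F i k (p + q) (a \<otimes>\<^bsub>A\<^esub> b)"
  unfolding F_eq L_eq using assms
  by (simp add: st.cls_ops lie_terms.gen, intro st.cls_eqI lie_cong.rel[OF st_rels.br_chain] lie_terms.intros)
    (simp_all add: mult_even)

lemma F_bracket_zero:
  assumes "i \<in> idx" "j \<in> idx" "i \<noteq> j" "k \<in> idx" "l \<in> idx" "k \<noteq> l" "j \<noteq> k" "i \<noteq> l"
    "a \<in> grade A p" "b \<in> grade A q"
  shows "bracket L (F i j p a) (F k l q b) = \<zero>\<^bsub>L\<^esub>"
  unfolding F_eq L_eq using assms
  by (simp add: st.cls_ops lie_terms.gen, intro st.cls_eqI lie_cong.rel[OF st_rels.br_zero]) auto

abbreviation gl where "gl \<equiv> lie_of Mat"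

sublocale Mat: superalgebra K Mat by (rule superalgebra_Mat)

sublocale gl: lie_superalgebra K gl by (rule Mat.lie_superalgebra_lie_of)

fun st_gen_mat :: "'a st_gen \<Rightarrow> nat \<times> nat \<Rightarrow> 'a"
  where "st_gen_mat (i, j, p, a) = elem_mat A i j a"

lemma elem_mat_zero [simp]: "elem_mat A i j \<zero>\<^bsub>A\<^esub> = \<zero>\<^bsub>Mat\<^esub>"
  by (auto simp: elem_mat_def mat_alg_def)

lemma supercomm_elem_mat:
  assumes "i \<in> idx" "j \<in> idx" "k \<in> idx" "l \<in> idx" "a \<in> grade A p" "b \<in> grade A q"
  shows "supercomm Mat (elem_mat A i j a) (elem_mat A k l b) =
    (if j = k then elem_mat A i l (a \<otimes>\<^bsub>A\<^esub> b) else \<zero>\<^bsub>Mat\<^esub>) \<oplus>\<^bsub>Mat\<^esub>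
    sg Mat ((ipar i + ipar j + p) * (ipar k + ipar l + q) + 1) (if l = i then elem_mat A k j (b \<otimes>\<^bsub>A\<^esub> a) else \<zero>\<^bsub>Mat\<^esub>)"
  using assms by (simp add: Mat.supercomm_homog[OF elem_mat_grade elem_mat_grade] elem_mat_mult grade_carrier)

text \<open>The matrix units \<open>E\<^sub>i\<^sub>j(a)\<close> satisfy the defining relations.
  No sign enters, because in each relation the product in the wrong order is zero.\<close>

lemma mat_rep_exists: "\<exists>f. f \<in> lie_super_hom K L gl \<and>
    (\<forall>t\<in>st.T. f (st.cls t) = eval_term gl st_gen_mat t)"
proof -
  have "\<exists>f. f \<in> lie_super_hom K st.P gl \<and> (\<forall>t\<in>st.T. f (st.cls t) = eval_term gl st_gen_mat t)"
  proof (rule st.presentation_hom[OF gl.lie_superalgebra_axioms, of st_gen_mat])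
    show "st_gen_mat x \<in> grade gl (st_deg x)" if "x \<in> st_gens A" for x
      using that by (auto simp: st_gens_def elem_mat_grade)
    show "eval_term gl st_gen_mat s = eval_term gl st_gen_mat t" if "(s, t) \<in> st_rels K A" for s t
      using that by cases (simp_all add: elem_mat_linear grade_carrier supercomm_elem_mat)
  qed blast
  then show ?thesis by (simp add: L_eq)
qed

definition mat_rep where "mat_rep = (SOME f. f \<in> lie_super_hom K L gl \<and>
    (\<forall>t\<in>st.T. f (st.cls t) = eval_term gl st_gen_mat t))"

lemma mat_rep: "mat_rep \<in> lie_super_hom K L gl" "t \<in> st.T \<Longrightarrow> mat_rep (st.cls t) = eval_term gl st_gen_mat t"
  using someI_ex[OF mat_rep_exists] unfolding mat_rep_def by blast+

lemmas mat_rep_hom = lie_super_homD[OF mat_rep(1), simplified lie_of_simps]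

lemma mat_rep_F: "\<lbrakk>i \<in> idx; j \<in> idx; i \<noteq> j; a \<in> grade A p\<rbrakk> \<Longrightarrow> mat_rep (F i j p a) = elem_mat A i j a"
  by (simp add: F_eq mat_rep(2) lie_terms.gen)

lemma Mat_sg_app: "\<lbrakk>x \<in> carrier Mat; i \<in> idx; j \<in> idx\<rbrakk> \<Longrightarrow> (sg Mat p x) (i, j) = sg A p (x (i, j))"
proof -
  assume x: "x \<in> carrier Mat" and ij: "i \<in> idx" "j \<in> idx"
  have "(\<ominus>\<^bsub>Mat\<^esub> x) (i, j) = \<ominus>\<^bsub>A\<^esub> x (i, j)"
    using x ij mat_app(1)[OF ij, of "\<ominus>\<^bsub>Mat\<^esub> x" x]
    by (intro minus_equality[symmetric]) (simp_all add: Mat.l_neg mat_app)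
  then show ?thesis by (simp add: sg_def)
qed

lemma supercomm_Mat_app:
  assumes "X \<in> grade Mat p" "Y \<in> grade Mat q" "i \<in> idx" "j \<in> idx"
  shows "supercomm Mat X Y (i, j) = sum4 A (\<lambda>m. X (i, m) \<otimes>\<^bsub>A\<^esub> Y (m, j)) \<oplus>\<^bsub>A\<^esub>
    sg A (p * q + 1) (sum4 A (\<lambda>m. Y (i, m) \<otimes>\<^bsub>A\<^esub> X (m, j)))"
  using assms(1,2)[THEN Mat.grade_carrier] assms
  by (simp add: Mat.supercomm_homog mat_app Mat_sg_app)

lemma cl_sum4: "(\<And>m. m \<in> idx \<Longrightarrow> f m \<in> carrier A) \<Longrightarrow> cl r (sum4 A f) = sum4 (S r) (\<lambda>m. cl r (f m))"
  by (simp add: sum4_def cl_add)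

lemma cl_supercomm_Mat:
  assumes X: "X \<in> grade Mat p" and Y: "Y \<in> grade Mat q" and ij: "i \<in> idx" "j \<in> idx"
  shows "cl r (supercomm Mat X Y (i, j)) = sum4 (S r) (\<lambda>m. cl r (X (i, m)) \<otimes>\<^bsub>S r\<^esub> cl r (Y (m, j))) \<oplus>\<^bsub>S r\<^esub>
    sg (S r) (p * q + 1) (sum4 (S r) (\<lambda>m. cl r (Y (i, m)) \<otimes>\<^bsub>S r\<^esub> cl r (X (m, j))))"
proof -
  note [simp] = X[THEN Mat.grade_carrier] Y[THEN Mat.grade_carrier] ij
  show ?thesis
    unfolding supercomm_Mat_app[OF X Y ij]
    by (simp add: cl_add cl_sg cl_sum4 cl_mult sum4_def)
qed

text \<open>The supertrace \<open>x\<^sub>1\<^sub>1 + x\<^sub>2\<^sub>2 - (-1)\<^sup>p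
  (x\<^sub>3\<^sub>3 + x\<^sub>4\<^sub>4)\<close> of a matrix of degree \<open>p\<close> vanishes
  in the \<open>r\<close>-th summand. Over \<open>A\<close> itself it would not kill
  supercommutators, since \<open>A\<close> need not be supercommutative.\<close>

definition supertraceless where
  "supertraceless r p X \<longleftrightarrow> cl r (X (1, 1)) \<oplus>\<^bsub>S r\<^esub> cl r (X (2, 2)) =
     sg (S r) p (cl r (X (3, 3)) \<oplus>\<^bsub>S r\<^esub> cl r (X (4, 4)))"

lemma ipar_simps [simp]: "ipar 1 = 0" "ipar 2 = 0" "ipar 3 = 1" "ipar 4 = 1"
  by (simp_all add: ipar_def)

text \<open>Let \<open>u\<^sub>i\<^sub>m\<close> be the class of \<open>x\<^sub>i\<^sub>m
  y\<^sub>m\<^sub>i\<close>; by supercommutativity the class of \<open>y\<^sub>i\<^sub>m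
  x\<^sub>m\<^sub>i\<close> is a signed \<open>u\<^sub>m\<^sub>i\<close>. In the sum of two
  diagonal entries of one parity the terms with \<open>|i| = |m|\<close> cancel, and the remaining
  ones are, up to the sign \<open>(-1)\<^sup>p\<^sup>+\<^sup>q\<close>, those of the other
  parity.\<close>

lemma supertraceless_supercomm:
  assumes X: "X \<in> grade Mat p" and Y: "Y \<in> grade Mat q"
  shows "supertraceless r (p + q) (supercomm Mat X Y)"
proof -
  note [simp] = X[THEN Mat.grade_carrier] Y[THEN Mat.grade_carrier]
  define u where "u i m = cl r (X (i, m)) \<otimes>\<^bsub>S r\<^esub> cl r (Y (m, i))" for i m
  have u[simp]: "u i m \<in> carrier (S r)" if "i \<in> idx" "m \<in> idx" for i m
    using that by (simp add: u_def)
  have e: "cl r (Y (i, m)) \<otimes>\<^bsub>S r\<^esub> cl r (X (m, i)) = sg (S r) ((q + ipar i + ipar m) * (p + ipar i + ipar m)) (u m i)"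
    if "i \<in> idx" "m \<in> idx" for i m
    using cl_supercomm[OF grade_MatD[OF Y that] grade_MatD[OF X that(2,1)], of r]
    by (simp add: u_def ac_simps)
  have d: "cl r (supercomm Mat X Y (i, i)) = sum4 (S r) (\<lambda>m. u i m) \<oplus>\<^bsub>S r\<^esub>
      sum4 (S r) (\<lambda>m. sg (S r) (p * q + 1 + (q + ipar i + ipar m) * (p + ipar i + ipar m)) (u m i))"
    if i: "i \<in> idx" for i
    unfolding cl_supercomm_Mat[OF X Y i i]
    using i by (simp add: e sum4_def S.sg_add flip: u_def)
  define M where "M = u 1 3 \<oplus>\<^bsub>S r\<^esub> (u 1 4 \<oplus>\<^bsub>S r\<^esub> (u 2 3 \<oplus>\<^bsub>S r\<^esub> u 2 4))"
  define N where "N = u 3 1 \<oplus>\<^bsub>S r\<^esub> (u 4 1 \<oplus>\<^bsub>S r\<^esub> (u 3 2 \<oplus>\<^bsub>S r\<^esub> u 4 2))"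
  have [simp]: "M \<in> carrier (S r)" "N \<in> carrier (S r)" by (simp_all add: M_def N_def)
  have "cl r (supercomm Mat X Y (1, 1)) \<oplus>\<^bsub>S r\<^esub> cl r (supercomm Mat X Y (2, 2)) =
    (M \<oplus>\<^bsub>S r\<^esub> sg (S r) (p + q) N) \<oplus>\<^bsub>S r\<^esub> ((u 1 1 \<oplus>\<^bsub>S r\<^esub> \<ominus>\<^bsub>S r\<^esub> u 1 1) \<oplus>\<^bsub>S r\<^esub>
    ((u 1 2 \<oplus>\<^bsub>S r\<^esub> \<ominus>\<^bsub>S r\<^esub> u 1 2) \<oplus>\<^bsub>S r\<^esub> ((u 2 1 \<oplus>\<^bsub>S r\<^esub> \<ominus>\<^bsub>S r\<^esub> u 2 1) \<oplus>\<^bsub>S r\<^esub> (u 2 2 \<oplus>\<^bsub>S r\<^esub> \<ominus>\<^bsub>S r\<^esub> u 2 2))))"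
    unfolding M_def N_def
    by (cases p; cases q; simp add: d sum4_def sg_1 S.minus_add S.a_ac)
  then have 1: "cl r (supercomm Mat X Y (1, 1)) \<oplus>\<^bsub>S r\<^esub> cl r (supercomm Mat X Y (2, 2)) = M \<oplus>\<^bsub>S r\<^esub> sg (S r) (p + q) N"
    by (simp add: S.r_neg)
  have "cl r (supercomm Mat X Y (3, 3)) \<oplus>\<^bsub>S r\<^esub> cl r (supercomm Mat X Y (4, 4)) =
    (N \<oplus>\<^bsub>S r\<^esub> sg (S r) (p + q) M) \<oplus>\<^bsub>S r\<^esub> ((u 3 3 \<oplus>\<^bsub>S r\<^esub> \<ominus>\<^bsub>S r\<^esub> u 3 3) \<oplus>\<^bsub>S r\<^esub>
    ((u 3 4 \<oplus>\<^bsub>S r\<^esub> \<ominus>\<^bsub>S r\<^esub> u 3 4) \<oplus>\<^bsub>S r\<^esub> ((u 4 3 \<oplus>\<^bsub>S r\<^esub> \<ominus>\<^bsub>S r\<^esub> u 4 3) \<oplus>\<^bsub>S r\<^esub> (u 4 4 \<oplus>\<^bsub>S r\<^esub> \<ominus>\<^bsub>S r\<^esub> u 4 4))))"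
    unfolding M_def N_def
    by (cases p; cases q; simp add: d sum4_def sg_1 S.minus_add S.a_ac)
  then have 2: "cl r (supercomm Mat X Y (3, 3)) \<oplus>\<^bsub>S r\<^esub> cl r (supercomm Mat X Y (4, 4)) = N \<oplus>\<^bsub>S r\<^esub> sg (S r) (p + q) M"
    by (simp add: S.r_neg)
  show ?thesis unfolding supertraceless_def 1 2 by (simp add: S.sg_add S.a_comm)
qed

lemma supertraceless_add:
  "\<lbrakk>X \<in> carrier Mat; Y \<in> carrier Mat; supertraceless r p X; supertraceless r p Y\<rbrakk> \<Longrightarrow>
    supertraceless r p (X \<oplus>\<^bsub>Mat\<^esub> Y)"
proof -
  assume [simp]: "X \<in> carrier Mat" "Y \<in> carrier Mat" and XY: "supertraceless r p X" "supertraceless r p Y"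
  let ?x = "\<lambda>i. cl r (X (i, i))" and ?y = "\<lambda>i. cl r (Y (i, i))"
  have "?x 1 \<oplus>\<^bsub>S r\<^esub> ?y 1 \<oplus>\<^bsub>S r\<^esub> (?x 2 \<oplus>\<^bsub>S r\<^esub> ?y 2) = (?x 1 \<oplus>\<^bsub>S r\<^esub> ?x 2) \<oplus>\<^bsub>S r\<^esub> (?y 1 \<oplus>\<^bsub>S r\<^esub> ?y 2)"
    by (simp add: S.a_ac)
  also have "\<dots> = sg (S r) p (?x 3 \<oplus>\<^bsub>S r\<^esub> ?x 4) \<oplus>\<^bsub>S r\<^esub> sg (S r) p (?y 3 \<oplus>\<^bsub>S r\<^esub> ?y 4)"
    using XY by (simp add: supertraceless_def)
  also have "\<dots> = sg (S r) p (?x 3 \<oplus>\<^bsub>S r\<^esub> ?y 3 \<oplus>\<^bsub>S r\<^esub> (?x 4 \<oplus>\<^bsub>S r\<^esub> ?y 4))"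
    by (simp add: S.sg_add S.a_ac)
  finally show ?thesis by (simp add: supertraceless_def mat_app cl_add)
qed

lemma supertraceless_smult:
  "\<lbrakk>k \<in> carrier K; X \<in> carrier Mat; supertraceless r p X\<rbrakk> \<Longrightarrow> supertraceless r p (k \<odot>\<^bsub>Mat\<^esub> X)"
proof -
  assume [simp]: "k \<in> carrier K" "X \<in> carrier Mat" and X: "supertraceless r p X"
  let ?x = "\<lambda>i. cl r (X (i, i))"
  have "k \<odot>\<^bsub>S r\<^esub> (?x 1 \<oplus>\<^bsub>S r\<^esub> ?x 2) = k \<odot>\<^bsub>S r\<^esub> sg (S r) p (?x 3 \<oplus>\<^bsub>S r\<^esub> ?x 4)"
    using X by (simp add: supertraceless_def)
  then show ?thesis by (simp add: supertraceless_def mat_app cl_smult S.smult_r_distr S.smult_sg)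
qed

lemma mat_rep_cls_grade: "st.homog p t \<Longrightarrow> mat_rep (st.cls t) \<in> grade Mat p"
  using mat_rep_hom(5)[of "st.cls t" p] st.grade_P_I by (simp add: L_eq)

lemma mat_rep_supertraceless_term: "st.homog p t \<Longrightarrow> supertraceless r p (mat_rep (st.cls t))"
proof (induction rule: homog_term.induct)
  case (gen x)
  then obtain i j p a where x: "x = (i, j, p, a)" and ij: "i \<in> idx" "j \<in> idx" "i \<noteq> j" "a \<in> grade A p"
    by (rule gens_E)
  have "(mat_rep (st.cls (Gen x))) (m, m) = \<zero>\<^bsub>A\<^esub>" if "m \<in> idx" for m
    unfolding x F_eq[symmetric] mat_rep_F[OF ij] using ij that by (auto simp: elem_mat_app)
  then show ?case by (simp add: supertraceless_def)
next
  case (zero p)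
  show ?case by (simp add: mat_rep(2) lie_terms.zero supertraceless_def mat_app)
next
  case (add p s t)
  note c = add.hyps[THEN st.homog_terms]
  have "mat_rep (st.cls (Add s t)) = mat_rep (st.cls s) \<oplus>\<^bsub>Mat\<^esub> mat_rep (st.cls t)"
    using c by (simp add: mat_rep(2) lie_terms.add)
  then show ?case using add supertraceless_add mat_rep_cls_grade Mat.grade_carrier by metis
next
  case (smult k p t)
  have "mat_rep (st.cls (Smult k t)) = k \<odot>\<^bsub>Mat\<^esub> mat_rep (st.cls t)"
    using smult st.homog_terms by (simp add: mat_rep(2) lie_terms.smult)
  then show ?case using smult supertraceless_smult mat_rep_cls_grade Mat.grade_carrier by metis
next
  case (br p s q t)
  note c = br.hyps[THEN st.homog_terms]
  have "mat_rep (st.cls (Br s t)) = supercomm Mat (mat_rep (st.cls s)) (mat_rep (st.cls t))"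
    using c by (simp add: mat_rep(2) lie_terms.br)
  then show ?case using br supertraceless_supercomm mat_rep_cls_grade by metis
qed

lemma mat_rep_supertraceless: "x \<in> grade L p \<Longrightarrow> supertraceless r p (mat_rep x)"
  unfolding L_eq by (elim st.grade_P_E) (simp add: mat_rep_supertraceless_term)

end

section \<open>The polarised determinant of two-by-two blocks\<close>

context superalgebra
begin

text \<open>The symmetric bilinear form behind the determinant of two-by-two blocks: over a
  commutative ring its value at \<open>(u, u)\<close> is twice the determinant of
  \<open>u\<close>. The Boolean arguments are row and column.\<close>

definition polar_det :: "(bool \<Rightarrow> bool \<Rightarrow> 'a) \<Rightarrow> (bool \<Rightarrow> bool \<Rightarrow> 'a) \<Rightarrow> 'a"
  where "polar_det u v = (u False False \<otimes>\<^bsub>A\<^esub> v True True \<oplus>\<^bsub>A\<^esub> sg A 1 (u True False \<otimes>\<^bsub>A\<^esub> v False True)) \<oplus>\<^bsub>A\<^esub>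
    (sg A 1 (u False True \<otimes>\<^bsub>A\<^esub> v True False) \<oplus>\<^bsub>A\<^esub> u True True \<otimes>\<^bsub>A\<^esub> v False False)"

definition block_mul :: "(bool \<Rightarrow> bool \<Rightarrow> 'a) \<Rightarrow> (bool \<Rightarrow> bool \<Rightarrow> 'a) \<Rightarrow> bool \<Rightarrow> bool \<Rightarrow> 'a"
  where "block_mul u v = (\<lambda>s t. u s False \<otimes>\<^bsub>A\<^esub> v False t \<oplus>\<^bsub>A\<^esub> u s True \<otimes>\<^bsub>A\<^esub> v True t)"

definition block_tr :: "(bool \<Rightarrow> bool \<Rightarrow> 'a) \<Rightarrow> 'a"
  where "block_tr u = u False False \<oplus>\<^bsub>A\<^esub> u True True"

definition block :: "(bool \<Rightarrow> bool \<Rightarrow> 'a) \<Rightarrow> bool"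
  where "block u \<longleftrightarrow> (\<forall>s t. u s t \<in> carrier A)"

definition block_comm :: "bit \<Rightarrow> (bool \<Rightarrow> bool \<Rightarrow> 'a) \<Rightarrow> (bool \<Rightarrow> bool \<Rightarrow> 'a) \<Rightarrow> bool"
  where "block_comm e u v \<longleftrightarrow> (\<forall>s t s' t'. u s t \<otimes>\<^bsub>A\<^esub> v s' t' = sg A e (v s' t' \<otimes>\<^bsub>A\<^esub> u s t))"

lemma block_closed [simp]: "block u \<Longrightarrow> u s t \<in> carrier A"
  by (simp add: block_def)

lemma block_block_mul [simp]: "\<lbrakk>block u; block v\<rbrakk> \<Longrightarrow> block (block_mul u v)"
  by (simp add: block_def block_mul_def)

lemma polar_det_closed [simp]: "\<lbrakk>block u; block v\<rbrakk> \<Longrightarrow> polar_det u v \<in> carrier A"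
  by (simp add: polar_det_def)

lemma block_tr_closed [simp]: "block u \<Longrightarrow> block_tr u \<in> carrier A"
  by (simp add: block_tr_def)

lemma block_commD: "block_comm e u v \<Longrightarrow> u s t \<otimes>\<^bsub>A\<^esub> v s' t' = sg A e (v s' t' \<otimes>\<^bsub>A\<^esub> u s t)"
  by (simp add: block_comm_def)

lemma block_comm_sym: "\<lbrakk>block_comm e u v; block u; block v\<rbrakk> \<Longrightarrow> block_comm e v u"
  by (simp add: block_comm_def sg_eq_iff)

lemma block_comm_left:
  assumes "block_comm e u v" "block u" "block v" "w \<in> carrier A"
  shows "u s t \<otimes>\<^bsub>A\<^esub> (v s' t' \<otimes>\<^bsub>A\<^esub> w) = sg A e (v s' t' \<otimes>\<^bsub>A\<^esub> (u s t \<otimes>\<^bsub>A\<^esub> w))"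
proof -
  have "u s t \<otimes>\<^bsub>A\<^esub> v s' t' \<otimes>\<^bsub>A\<^esub> w = sg A e (v s' t' \<otimes>\<^bsub>A\<^esub> u s t) \<otimes>\<^bsub>A\<^esub> w"
    using block_commD[OF assms(1), of s t s' t'] by simp
  then show ?thesis using assms by (simp add: m_assoc mult_sg_left)
qed

lemma block_comm_block_mul:
  assumes "block_comm e u v" "block_comm f u w" and b: "block u" "block v" "block w"
  shows "block_comm (e + f) u (block_mul v w)"
  using b unfolding block_comm_def block_mul_def
  by (simp add: r_distr l_distr sg_add block_comm_left[OF assms(1)] m_assoc block_commD[OF assms(2)] mult_sg_right)

lemma polar_det_swap:
  assumes "block_comm e u v" "block u" "block v"
  shows "polar_det v u = sg A e (polar_det u v)"
  using assms block_commD[OF block_comm_sym[OF assms]] by (simp add: polar_det_def sg_add a_ac add.commute)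

text \<open>The polarised form of the rule that the derivative of a determinant along \<open>m
  y\<close> is the trace of \<open>m\<close> times the determinant of \<open>y\<close>. The
  off-diagonal entries of \<open>m\<close> contribute four pairs of terms that cancel.\<close>

lemma polar_det_left:
  assumes c: "block_comm e m y" and b: "block m" "block y" "block z"
  shows "polar_det (block_mul m y) z \<oplus>\<^bsub>A\<^esub> sg A e (polar_det y (block_mul m z)) = block_tr m \<otimes>\<^bsub>A\<^esub> polar_det y z"
proof -
  note cm = block_comm_left[OF block_comm_sym[OF c b(1,2)] b(2,1)]
  let ?t = "\<lambda>i j k l s t. m i j \<otimes>\<^bsub>A\<^esub> (y k l \<otimes>\<^bsub>A\<^esub> z s t)"
  let ?F = False and ?T = True
  have "polar_det (block_mul m y) z \<oplus>\<^bsub>A\<^esub> sg A e (polar_det y (block_mul m z)) =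
    block_tr m \<otimes>\<^bsub>A\<^esub> polar_det y z \<oplus>\<^bsub>A\<^esub> ((?t ?F ?T ?T ?F ?T ?T \<oplus>\<^bsub>A\<^esub> \<ominus>\<^bsub>A\<^esub> ?t ?F ?T ?T ?F ?T ?T) \<oplus>\<^bsub>A\<^esub>
      ((?t ?F ?T ?T ?T ?T ?F \<oplus>\<^bsub>A\<^esub> \<ominus>\<^bsub>A\<^esub> ?t ?F ?T ?T ?T ?T ?F) \<oplus>\<^bsub>A\<^esub>
      ((?t ?T ?F ?F ?F ?F ?T \<oplus>\<^bsub>A\<^esub> \<ominus>\<^bsub>A\<^esub> ?t ?T ?F ?F ?F ?F ?T) \<oplus>\<^bsub>A\<^esub>
      (?t ?T ?F ?F ?T ?F ?F \<oplus>\<^bsub>A\<^esub> \<ominus>\<^bsub>A\<^esub> ?t ?T ?F ?F ?T ?F ?F))))"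
    using b by (simp add: polar_det_def block_mul_def block_tr_def l_distr r_distr m_assoc cm sg_add mult_sg_left mult_sg_right)
      (simp add: sg_1 l_minus r_minus minus_add a_ac)
  then show ?thesis using b by (simp add: r_neg)
qed

lemma polar_det_right:
  assumes c: "block_comm e n z" and b: "block n" "block y" "block z"
  shows "polar_det (block_mul y n) z \<oplus>\<^bsub>A\<^esub> sg A e (polar_det y (block_mul z n)) = sg A e (polar_det y z \<otimes>\<^bsub>A\<^esub> block_tr n)"
proof -
  note cm = block_commD[OF block_comm_sym[OF c b(1,3)]]
  let ?t = "\<lambda>i j k l s t. y i j \<otimes>\<^bsub>A\<^esub> (n k l \<otimes>\<^bsub>A\<^esub> z s t)"
  let ?F = False and ?T = True
  have "polar_det (block_mul y n) z \<oplus>\<^bsub>A\<^esub> sg A e (polar_det y (block_mul z n)) =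
    sg A e (polar_det y z \<otimes>\<^bsub>A\<^esub> block_tr n) \<oplus>\<^bsub>A\<^esub> ((?t ?F ?T ?T ?F ?T ?T \<oplus>\<^bsub>A\<^esub> \<ominus>\<^bsub>A\<^esub> ?t ?F ?T ?T ?F ?T ?T) \<oplus>\<^bsub>A\<^esub>
      ((?t ?F ?F ?F ?T ?T ?F \<oplus>\<^bsub>A\<^esub> \<ominus>\<^bsub>A\<^esub> ?t ?F ?F ?F ?T ?T ?F) \<oplus>\<^bsub>A\<^esub>
      ((?t ?T ?T ?T ?F ?F ?T \<oplus>\<^bsub>A\<^esub> \<ominus>\<^bsub>A\<^esub> ?t ?T ?T ?T ?F ?F ?T) \<oplus>\<^bsub>A\<^esub>
      (?t ?T ?F ?F ?T ?F ?F \<oplus>\<^bsub>A\<^esub> \<ominus>\<^bsub>A\<^esub> ?t ?T ?F ?F ?T ?F ?F))))"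
    using b by (simp add: polar_det_def block_mul_def block_tr_def l_distr r_distr m_assoc cm sg_add mult_sg_left mult_sg_right)
      (simp add: sg_1 l_minus r_minus minus_add a_ac)
  then show ?thesis using b by (simp add: r_neg)
qed

lemma polar_det_add_left: "\<lbrakk>block u; block u'; block v\<rbrakk> \<Longrightarrow>
    polar_det (\<lambda>s t. u s t \<oplus>\<^bsub>A\<^esub> u' s t) v = polar_det u v \<oplus>\<^bsub>A\<^esub> polar_det u' v"
  by (simp add: polar_det_def l_distr sg_add a_ac)

lemma polar_det_add_right: "\<lbrakk>block u; block v; block v'\<rbrakk> \<Longrightarrow>
    polar_det u (\<lambda>s t. v s t \<oplus>\<^bsub>A\<^esub> v' s t) = polar_det u v \<oplus>\<^bsub>A\<^esub> polar_det u v'"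
  by (simp add: polar_det_def r_distr sg_add a_ac)

lemma polar_det_smult_left: "\<lbrakk>block u; block v; k \<in> carrier K\<rbrakk> \<Longrightarrow>
    polar_det (\<lambda>s t. k \<odot>\<^bsub>A\<^esub> u s t) v = k \<odot>\<^bsub>A\<^esub> polar_det u v"
  by (simp add: polar_det_def smult_mult_left smult_r_distr smult_sg)

lemma polar_det_smult_right: "\<lbrakk>block u; block v; k \<in> carrier K\<rbrakk> \<Longrightarrow>
    polar_det u (\<lambda>s t. k \<odot>\<^bsub>A\<^esub> v s t) = k \<odot>\<^bsub>A\<^esub> polar_det u v"
  by (simp add: polar_det_def smult_mult_right smult_r_distr smult_sg)

lemma polar_det_sg_left: "\<lbrakk>block u; block v\<rbrakk> \<Longrightarrow> polar_det (\<lambda>s t. sg A e (u s t)) v = sg A e (polar_det u v)"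
  by (simp add: polar_det_def mult_sg_left sg_add add.commute)

lemma polar_det_sg_right: "\<lbrakk>block u; block v\<rbrakk> \<Longrightarrow> polar_det u (\<lambda>s t. sg A e (v s t)) = sg A e (polar_det u v)"
  by (simp add: polar_det_def mult_sg_right sg_add add.commute)

lemma polar_det_alternating:
  assumes "block_comm 1 u u" "block u" shows "polar_det u u = \<zero>\<^bsub>A\<^esub>"
proof -
  have "polar_det u u = (u False False \<otimes>\<^bsub>A\<^esub> u True True \<oplus>\<^bsub>A\<^esub> \<ominus>\<^bsub>A\<^esub> (u False False \<otimes>\<^bsub>A\<^esub> u True True)) \<oplus>\<^bsub>A\<^esub>
    (u False True \<otimes>\<^bsub>A\<^esub> u True False \<oplus>\<^bsub>A\<^esub> \<ominus>\<^bsub>A\<^esub> (u False True \<otimes>\<^bsub>A\<^esub> u True False))"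
    using assms block_commD[OF assms(1), of True True False False] block_commD[OF assms(1), of True False False True]
    by (simp add: polar_det_def sg_1 a_ac)
  then show ?thesis using assms by (simp add: r_neg)
qed

lemma polar_det_comm:
  assumes "block_comm e n y" "block_comm f n z" "block n" "block y" "block z"
  shows "polar_det y z \<otimes>\<^bsub>A\<^esub> block_tr n = sg A (e + f) (block_tr n \<otimes>\<^bsub>A\<^esub> polar_det y z)"
proof -
  have "n s t \<otimes>\<^bsub>A\<^esub> (y i j \<otimes>\<^bsub>A\<^esub> z k l) = sg A (e + f) (y i j \<otimes>\<^bsub>A\<^esub> (z k l \<otimes>\<^bsub>A\<^esub> n s t))" for s t i j k l
    using assms by (simp add: block_comm_left[OF assms(1,3,4)] block_commD[OF assms(2)] mult_sg_right)
  then show ?thesis using assms(3-5)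
    by (simp add: polar_det_def block_tr_def l_distr r_distr sg_add mult_sg_left mult_sg_right m_assoc)
      (simp add: a_ac add_ac)
qed

text \<open>The contribution of one of three matrices to the cocycle identity, through its
  diagonal block \<open>m\<close> on the rows and \<open>n\<close> on the columns. By invariance
  it is a signed multiple of \<open>(tr m - (-1)\<^sup>p tr n) polar_det y z\<close>, and the
  supertrace vanishes.\<close>

lemma block_cocycle_part:
  assumes b: "block m" "block n" "block y" "block z"
    and c: "block_comm (p * (q + 1)) m y" "block_comm (p * (q + 1)) n y" "block_comm (p * (r + 1)) m z" "block_comm (p * (r + 1)) n z"
      "block_comm ((q + 1) * (r + 1)) y z"
    and tr: "block_tr m = sg A p (block_tr n)"
  shows "(sg A (p * r + r + 1) (polar_det (block_mul m y) z) \<oplus>\<^bsub>A\<^esub> sg A (q * r + q + r * p) (polar_det (block_mul m z) y)) \<oplus>\<^bsub>A\<^esub>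
    (sg A (p * r + r + p * q) (polar_det (block_mul y n) z) \<oplus>\<^bsub>A\<^esub> sg A (q * r + q + 1) (polar_det (block_mul z n) y)) = \<zero>\<^bsub>A\<^esub>"
proof -
  have zm: "polar_det (block_mul m z) y = sg A (p * (q + 1) + (q + 1) * (r + 1)) (polar_det y (block_mul m z))"
    by (rule polar_det_swap[OF block_comm_block_mul[OF block_comm_sym[OF c(1)] c(5)]]) (use b in simp_all)
  have zn: "polar_det (block_mul z n) y = sg A ((q + 1) * (r + 1) + p * (q + 1)) (polar_det y (block_mul z n))"
    by (rule polar_det_swap[OF block_comm_block_mul[OF c(5) block_comm_sym[OF c(2)]]]) (use b in simp_all)
  have M: "sg A (p * r + r + 1) (polar_det (block_mul m y) z) \<oplus>\<^bsub>A\<^esub> sg A (q * r + q + r * p) (polar_det (block_mul m z) y) =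
      sg A (p * r + r + 1) (polar_det (block_mul m y) z \<oplus>\<^bsub>A\<^esub> sg A (p * (q + 1)) (polar_det y (block_mul m z)))"
    using b by (cases p; cases q; cases r; simp add: zm sg_add)
  have N: "sg A (p * r + r + p * q) (polar_det (block_mul y n) z) \<oplus>\<^bsub>A\<^esub> sg A (q * r + q + 1) (polar_det (block_mul z n) y) =
      sg A (p * r + r + p * q) (polar_det (block_mul y n) z \<oplus>\<^bsub>A\<^esub> sg A (p * (r + 1)) (polar_det y (block_mul z n)))"
    using b by (cases p; cases q; cases r; simp add: zn sg_add)
  have D: "polar_det y z \<otimes>\<^bsub>A\<^esub> block_tr n = sg A (p * (q + 1) + p * (r + 1)) (block_tr n \<otimes>\<^bsub>A\<^esub> polar_det y z)"
    by (rule polar_det_comm[OF c(2,4)]) (use b in simp_all)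
  have "block_tr m \<otimes>\<^bsub>A\<^esub> polar_det y z = sg A p (block_tr n \<otimes>\<^bsub>A\<^esub> polar_det y z)"
    using b by (simp add: tr mult_sg_left)
  then show ?thesis
    unfolding M N polar_det_left[OF c(1) b(1,3,4)] polar_det_right[OF c(4) b(2,3,4)] D
    using b by (cases p; cases q; cases r; simp add: sg_1 r_neg l_neg)
qed

text \<open>Here \<open>br\<close> is the block of a supercommutator that \<open>\<psi>\<close>
  sees, expressed through the blocks of the two factors. Sorting the twelve terms by the matrix
  that enters with a diagonal block leaves three sums of the preceding kind.\<close>

lemma block_cocycle:
  assumes b: "block mx" "block nx" "block x" "block my" "block ny" "block y" "block mz" "block nz" "block z"
    and x: "block_comm (p * (q + 1)) mx y" "block_comm (p * (q + 1)) nx y" "block_comm (p * (r + 1)) mx z" "block_comm (p * (r + 1)) nx z"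
    and y: "block_comm (q * (r + 1)) my z" "block_comm (q * (r + 1)) ny z" "block_comm (q * (p + 1)) my x" "block_comm (q * (p + 1)) ny x"
    and z: "block_comm (r * (p + 1)) mz x" "block_comm (r * (p + 1)) nz x" "block_comm (r * (q + 1)) mz y" "block_comm (r * (q + 1)) nz y"
    and xyz: "block_comm ((q + 1) * (r + 1)) y z" "block_comm ((r + 1) * (p + 1)) z x" "block_comm ((p + 1) * (q + 1)) x y"
    and tr: "block_tr mx = sg A p (block_tr nx)" "block_tr my = sg A q (block_tr ny)" "block_tr mz = sg A r (block_tr nz)"
  defines "br e m n u m' n' v \<equiv> \<lambda>s t. (block_mul m v s t \<oplus>\<^bsub>A\<^esub> block_mul u n' s t) \<oplus>\<^bsub>A\<^esub> sg A (e + 1) (block_mul m' u s t \<oplus>\<^bsub>A\<^esub> block_mul v n s t)"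
  shows "(sg A (p * r + r + 1) (polar_det (br (p * q) mx nx x my ny y) z) \<oplus>\<^bsub>A\<^esub>
    sg A (p * q + p + 1) (polar_det (br (q * r) my ny y mz nz z) x)) \<oplus>\<^bsub>A\<^esub>
    sg A (q * r + q + 1) (polar_det (br (r * p) mz nz z mx nx x) y) = \<zero>\<^bsub>A\<^esub>"
proof -
  have br: "polar_det (br e m n u m' n' v) w = (polar_det (block_mul m v) w \<oplus>\<^bsub>A\<^esub> polar_det (block_mul u n') w) \<oplus>\<^bsub>A\<^esub>
      sg A (e + 1) (polar_det (block_mul m' u) w \<oplus>\<^bsub>A\<^esub> polar_det (block_mul v n) w)"
    if "block m" "block n" "block u" "block m'" "block n'" "block v" "block w" for e m n u m' n' v w
  proof -
    have [simp]: "block (\<lambda>s t. a s t \<oplus>\<^bsub>A\<^esub> c s t)" if "block a" "block c" for a c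
      using that by (simp add: block_def)
    have [simp]: "block (\<lambda>s t. sg A e (a s t))" if "block a" for e a
      using that by (simp add: block_def)
    show ?thesis unfolding br_def using that
      by (simp add: polar_det_add_left polar_det_sg_left)
  qed
  note gx = block_cocycle_part[OF b(1,2,6,9) x xyz(1) tr(1)]
  note gy = block_cocycle_part[OF b(4,5,9,3) y xyz(2) tr(2)]
  note gz = block_cocycle_part[OF b(7,8,3,6) z xyz(3) tr(3)]
  let ?g = "\<lambda>p q r m n y z. (sg A (p * r + r + 1) (polar_det (block_mul m y) z) \<oplus>\<^bsub>A\<^esub> sg A (q * r + q + r * p) (polar_det (block_mul m z) y)) \<oplus>\<^bsub>A\<^esub>
    (sg A (p * r + r + p * q) (polar_det (block_mul y n) z) \<oplus>\<^bsub>A\<^esub> sg A (q * r + q + 1) (polar_det (block_mul z n) y))"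
  have "(sg A (p * r + r + 1) (polar_det (br (p * q) mx nx x my ny y) z) \<oplus>\<^bsub>A\<^esub>
    sg A (p * q + p + 1) (polar_det (br (q * r) my ny y mz nz z) x)) \<oplus>\<^bsub>A\<^esub>
    sg A (q * r + q + 1) (polar_det (br (r * p) mz nz z mx nx x) y) =
    ?g p q r mx nx y z \<oplus>\<^bsub>A\<^esub> (?g q r p my ny z x \<oplus>\<^bsub>A\<^esub> ?g r p q mz nz x y)"
    using b by (cases p; cases q; cases r; simp add: br sg_add; simp add: a_ac)
  then show ?thesis unfolding gx gy gz by simp
qed

end

section \<open>The cocycle on matrices\<close>

text \<open>A representative \<open>(i, j, k, l)\<close> of each class. The class is determined by
  its rows \<open>{i, k}\<close> and its columns \<open>{j, l}\<close>, which together exhaust the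
  four indices.\<close>

definition class_rep :: "nat \<Rightarrow> quad"
  where "class_rep r = (if r = 1 then (1, 2, 3, 4) else if r = 2 then (1, 2, 4, 3) else if r = 3 then (2, 1, 3, 4)
    else if r = 4 then (2, 1, 4, 3) else if r = 5 then (1, 3, 2, 4) else (3, 1, 4, 2))"

definition brow :: "nat \<Rightarrow> bool \<Rightarrow> nat"
  where "brow r s = (case class_rep r of (i, j, k, l) \<Rightarrow> if s then k else i)"

definition bcol :: "nat \<Rightarrow> bool \<Rightarrow> nat"
  where "bcol r s = (case class_rep r of (i, j, k, l) \<Rightarrow> if s then l else j)"

lemma six_cases:
  assumes "r \<in> {1..6::nat}" obtains "r = 1" | "r = 2" | "r = 3" | "r = 4" | "r = 5" | "r = 6"
  using assms by (force simp: atLeastAtMost_iff)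

lemma brow_idx [simp]: "brow r s \<in> idx" "bcol r s \<in> idx"
  by (simp_all add: brow_def bcol_def class_rep_def)

lemma brow_bcol_values:
  assumes "r \<in> {1..6}"
  shows "(brow r False, brow r True, bcol r False, bcol r True) \<in>
    {(1, 3, 2, 4), (1, 4, 2, 3), (2, 3, 1, 4), (2, 4, 1, 3)} \<union> (if r \<le> 4 then {} else {(1, 2, 3, 4), (3, 4, 1, 2)})"
  using assms by (cases rule: six_cases) (simp_all add: brow_def bcol_def class_rep_def)

context super_W
begin

text \<open>The parity involution. Applied to the second argument it produces the factor
  \<open>(-1)\<close> to the power \<open>|b|\<close> of \<open>\<psi>\<close>.\<close>

definition parity_inv :: "'a \<Rightarrow> 'a"
  where "parity_inv a = gpart A 0 a \<oplus>\<^bsub>A\<^esub> sg A 1 (gpart A 1 a)"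

lemma parity_inv_closed [simp]: "a \<in> carrier A \<Longrightarrow> parity_inv a \<in> carrier A"
  by (simp add: parity_inv_def)

lemma parity_inv_homog: "a \<in> grade A p \<Longrightarrow> parity_inv a = sg A p a"
  using grade_carrier[of a p] by (cases p) (simp_all add: parity_inv_def gpart_homog[of a p])

lemma parity_inv_add: "\<lbrakk>a \<in> carrier A; b \<in> carrier A\<rbrakk> \<Longrightarrow> parity_inv (a \<oplus>\<^bsub>A\<^esub> b) = parity_inv a \<oplus>\<^bsub>A\<^esub> parity_inv b"
  by (simp add: parity_inv_def gpart_add sg_add a_ac)

lemma parity_inv_smult: "\<lbrakk>k \<in> carrier K; a \<in> carrier A\<rbrakk> \<Longrightarrow> parity_inv (k \<odot>\<^bsub>A\<^esub> a) = k \<odot>\<^bsub>A\<^esub> parity_inv a"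
  by (simp add: parity_inv_def gpart_smult smult_r_distr smult_sg)

definition rc_block where "rc_block r X = (\<lambda>s t. cl r (X (brow r s, bcol r t)))"
definition rr_block where "rr_block r X = (\<lambda>s t. cl r (X (brow r s, brow r t)))"
definition cc_block where "cc_block r X = (\<lambda>s t. cl r (X (bcol r s, bcol r t)))"
definition rc_block_inv where "rc_block_inv r X = (\<lambda>s t. cl r (parity_inv (X (brow r s, bcol r t))))"

text \<open>On the classes 1 to 4 this has signs that \<open>\<psi>\<close> does not have; they
  disappear because \<open>2 = 0\<close> there.\<close>

definition block_psi where "block_psi r X Y = S.polar_det r (rc_block r X) (rc_block_inv r Y)"

lemma block_rc_block [simp]:
  assumes "X \<in> carrier Mat"
  shows "S.block r (rc_block r X)" "S.block r (rr_block r X)" "S.block r (cc_block r X)" "S.block r (rc_block_inv r X)"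
  using assms by (simp_all add: S.block_def rc_block_def rr_block_def cc_block_def rc_block_inv_def)

text \<open>In the last two classes the rows have one parity and the columns the other, so every
  block of a homogeneous matrix has entries of one degree.\<close>

lemma parity_rc:
  assumes "r \<in> {1..6}" "\<not> r \<le> 4"
  obtains \<alpha> where "\<And>s. ipar (brow r s) = \<alpha>" "\<And>s. ipar (bcol r s) = \<alpha> + 1"
  using assms(1)
proof (cases rule: six_cases)
  case 5
  then show thesis by (intro that[of 0]) (simp_all add: brow_def bcol_def class_rep_def)
next
  case 6
  then show thesis by (intro that[of 1]) (simp_all add: brow_def bcol_def class_rep_def)
qed (use assms(2) in simp_all)

lemma rc_block_inv_homog:
  assumes Y: "Y \<in> grade Mat q" and r: "r \<in> {1..6}"
  shows "rc_block_inv r Y = (\<lambda>s t. sg (S r) (q + 1) (rc_block r Y s t))"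
proof (intro ext)
  fix s t
  have g: "Y (brow r s, bcol r t) \<in> grade A (q + ipar (brow r s) + ipar (bcol r t))"
    using grade_MatD[OF Y] by simp
  note c = grade_carrier[OF g]
  show "rc_block_inv r Y s t = sg (S r) (q + 1) (rc_block r Y s t)"
  proof (cases "r \<le> 4")
    case True
    then show ?thesis using c by (simp add: rc_block_inv_def rc_block_def parity_inv_homog[OF g] cl_sg S_char2)
  next
    case False
    with parity_rc[OF r] obtain \<alpha> where "\<And>s. ipar (brow r s) = \<alpha>" "\<And>s. ipar (bcol r s) = \<alpha> + 1" by metis
    then have e: "q + ipar (brow r s) + ipar (bcol r t) = q + 1" by (simp add: add.assoc)
    have "Y (brow r s, bcol r t) \<in> grade A (q + 1)" using g unfolding e .
    then show ?thesis using c by (simp add: rc_block_inv_def rc_block_def parity_inv_homog cl_sg)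
  qed
qed

lemma block_psi_homog:
  assumes "X \<in> carrier Mat" "Y \<in> grade Mat q" "r \<in> {1..6}"
  shows "block_psi r X Y = sg (S r) (q + 1) (S.polar_det r (rc_block r X) (rc_block r Y))"
  using assms Mat.grade_carrier[of Y q] by (simp add: block_psi_def rc_block_inv_homog S.polar_det_sg_right)

lemma block_psi_closed [simp]: "\<lbrakk>X \<in> carrier Mat; Y \<in> carrier Mat\<rbrakk> \<Longrightarrow> block_psi r X Y \<in> carrier (S r)"
  by (simp add: block_psi_def)

lemma block_psi_linear:
  "\<lbrakk>X \<in> carrier Mat; X' \<in> carrier Mat; Y \<in> carrier Mat\<rbrakk> \<Longrightarrow>
    block_psi r (X \<oplus>\<^bsub>Mat\<^esub> X') Y = block_psi r X Y \<oplus>\<^bsub>S r\<^esub> block_psi r X' Y"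
  "\<lbrakk>X \<in> carrier Mat; Y \<in> carrier Mat; Y' \<in> carrier Mat\<rbrakk> \<Longrightarrow>
    block_psi r X (Y \<oplus>\<^bsub>Mat\<^esub> Y') = block_psi r X Y \<oplus>\<^bsub>S r\<^esub> block_psi r X Y'"
  "\<lbrakk>k \<in> carrier K; X \<in> carrier Mat; Y \<in> carrier Mat\<rbrakk> \<Longrightarrow> block_psi r (k \<odot>\<^bsub>Mat\<^esub> X) Y = k \<odot>\<^bsub>S r\<^esub> block_psi r X Y"
  "\<lbrakk>k \<in> carrier K; X \<in> carrier Mat; Y \<in> carrier Mat\<rbrakk> \<Longrightarrow> block_psi r X (k \<odot>\<^bsub>Mat\<^esub> Y) = k \<odot>\<^bsub>S r\<^esub> block_psi r X Y"
proof -
  have rc_block: "rc_block r (X \<oplus>\<^bsub>Mat\<^esub> X') = (\<lambda>s t. rc_block r X s t \<oplus>\<^bsub>S r\<^esub> rc_block r X' s t)"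
    "rc_block_inv r (X \<oplus>\<^bsub>Mat\<^esub> X') = (\<lambda>s t. rc_block_inv r X s t \<oplus>\<^bsub>S r\<^esub> rc_block_inv r X' s t)"
    if "X \<in> carrier Mat" "X' \<in> carrier Mat" for X X'
    using that by (simp_all add: rc_block_def rc_block_inv_def mat_app cl_add parity_inv_add)
  have RC': "rc_block r (k \<odot>\<^bsub>Mat\<^esub> X) = (\<lambda>s t. k \<odot>\<^bsub>S r\<^esub> rc_block r X s t)"
    "rc_block_inv r (k \<odot>\<^bsub>Mat\<^esub> X) = (\<lambda>s t. k \<odot>\<^bsub>S r\<^esub> rc_block_inv r X s t)"
    if "k \<in> carrier K" "X \<in> carrier Mat" for k X
    using that by (simp_all add: rc_block_def rc_block_inv_def mat_app cl_smult parity_inv_smult)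
  show "\<lbrakk>X \<in> carrier Mat; X' \<in> carrier Mat; Y \<in> carrier Mat\<rbrakk> \<Longrightarrow>
      block_psi r (X \<oplus>\<^bsub>Mat\<^esub> X') Y = block_psi r X Y \<oplus>\<^bsub>S r\<^esub> block_psi r X' Y"
    "\<lbrakk>X \<in> carrier Mat; Y \<in> carrier Mat; Y' \<in> carrier Mat\<rbrakk> \<Longrightarrow>
      block_psi r X (Y \<oplus>\<^bsub>Mat\<^esub> Y') = block_psi r X Y \<oplus>\<^bsub>S r\<^esub> block_psi r X Y'"
    "\<lbrakk>k \<in> carrier K; X \<in> carrier Mat; Y \<in> carrier Mat\<rbrakk> \<Longrightarrow> block_psi r (k \<odot>\<^bsub>Mat\<^esub> X) Y = k \<odot>\<^bsub>S r\<^esub> block_psi r X Y"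
    "\<lbrakk>k \<in> carrier K; X \<in> carrier Mat; Y \<in> carrier Mat\<rbrakk> \<Longrightarrow> block_psi r X (k \<odot>\<^bsub>Mat\<^esub> Y) = k \<odot>\<^bsub>S r\<^esub> block_psi r X Y"
    by (simp_all add: block_psi_def rc_block RC' S.polar_det_add_left S.polar_det_add_right S.polar_det_smult_left S.polar_det_smult_right)
qed

lemma block_comm_char2:
  assumes "r \<le> 4" "X \<in> carrier Mat" "Y \<in> carrier Mat" 
    and "\<And>s t. u s t \<in> {X (i, j) |i j. i \<in> idx \<and> j \<in> idx}" "\<And>s t. v s t \<in> {Y (i, j) |i j. i \<in> idx \<and> j \<in> idx}"
  shows "S.block_comm r e (\<lambda>s t. cl r (u s t)) (\<lambda>s t. cl r (v s t))"
proof -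
  have comm: "cl r a \<otimes>\<^bsub>S r\<^esub> cl r b = cl r b \<otimes>\<^bsub>S r\<^esub> cl r a" if [simp]: "a \<in> carrier A" "b \<in> carrier A" for a b
  proof -
    have h: "cl r (gpart A p a) \<otimes>\<^bsub>S r\<^esub> cl r (gpart A q b) = cl r (gpart A q b) \<otimes>\<^bsub>S r\<^esub> cl r (gpart A p a)" for p q
      using cl_supercomm[OF gpart_grade[OF that(1)] gpart_grade[OF that(2)], of r p q] assms(1) by (simp add: S_char2)
    have ab: "cl r a = cl r (gpart A 0 a) \<oplus>\<^bsub>S r\<^esub> cl r (gpart A 1 a)" "cl r b = cl r (gpart A 0 b) \<oplus>\<^bsub>S r\<^esub> cl r (gpart A 1 b)"
      by (simp_all add: gpart_decomp flip: cl_add)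
    show ?thesis unfolding ab by (simp add: S.l_distr S.r_distr h S.a_ac)
  qed
  have "u s t \<in> carrier A" "v s t \<in> carrier A" for s t
    using assms(4)[of s t] assms(5)[of s t] assms(2,3) by auto
  then show ?thesis unfolding S.block_comm_def using comm assms(1) by (simp add: S_char2)
qed

lemma block_comm_Mat:
  assumes X: "X \<in> grade Mat p" and Y: "Y \<in> grade Mat q" and r: "r \<in> {1..6}"
  shows "S.block_comm r ((p + 1) * (q + 1)) (rc_block r X) (rc_block r Y)" "S.block_comm r (p * (q + 1)) (rr_block r X) (rc_block r Y)"
    "S.block_comm r (p * (q + 1)) (cc_block r X) (rc_block r Y)"
proof -
  note c = X[THEN Mat.grade_carrier] Y[THEN Mat.grade_carrier]
  have "S.block_comm r ((p + 1) * (q + 1)) (rc_block r X) (rc_block r Y) \<and> S.block_comm r (p * (q + 1)) (rr_block r X) (rc_block r Y) \<and>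
    S.block_comm r (p * (q + 1)) (cc_block r X) (rc_block r Y)"
  proof (cases "r \<le> 4")
    case True
    then show ?thesis unfolding rc_block_def rr_block_def cc_block_def
      by (intro conjI block_comm_char2[OF True c]) (use brow_idx in blast)+
  next
    case False
    with parity_rc[OF r] obtain \<alpha> where par: "\<And>s. ipar (brow r s) = \<alpha>" "\<And>s. ipar (bcol r s) = \<alpha> + 1" by metis
    have g: "X (brow r s, bcol r t) \<in> grade A (p + 1)" "Y (brow r s, bcol r t) \<in> grade A (q + 1)"
      "X (brow r s, brow r t) \<in> grade A p" "X (bcol r s, bcol r t) \<in> grade A p" for s t
      using grade_MatD[OF X, of "brow r s" "bcol r t"] grade_MatD[OF Y, of "brow r s" "bcol r t"]
        grade_MatD[OF X, of "brow r s" "brow r t"] grade_MatD[OF X, of "bcol r s" "bcol r t"]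
      by (cases \<alpha>; simp add: par add.assoc)+
    show ?thesis unfolding S.block_comm_def rc_block_def rr_block_def cc_block_def by (intro conjI allI cl_supercomm g)
  qed
  then show "S.block_comm r ((p + 1) * (q + 1)) (rc_block r X) (rc_block r Y)" "S.block_comm r (p * (q + 1)) (rr_block r X) (rc_block r Y)"
    "S.block_comm r (p * (q + 1)) (cc_block r X) (rc_block r Y)" by blast+
qed

text \<open>In the classes 1 to 4 rows and columns mix the two parities. But without signs the
  supertrace is the sum of all four diagonal entries, however they are grouped.\<close>

lemma block_tr_Mat:
  assumes X: "X \<in> grade Mat p" and r: "r \<in> {1..6}" and tr: "supertraceless r p X"
  shows "S.block_tr r (rr_block r X) = sg (S r) p (S.block_tr r (cc_block r X))"
proof -
  have [simp]: "X \<in> carrier Mat" using X by (rule Mat.grade_carrier)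
  let ?x = "\<lambda>i. cl r (X (i, i))"
  show ?thesis
  proof (cases "r \<le> 4")
    case True
    then have e: "?x 1 \<oplus>\<^bsub>S r\<^esub> ?x 2 = ?x 3 \<oplus>\<^bsub>S r\<^esub> ?x 4"
      using tr by (simp add: supertraceless_def S_char2)
    have two2: "a \<oplus>\<^bsub>S r\<^esub> a = \<zero>\<^bsub>S r\<^esub>" if "a \<in> carrier (S r)" for a
      using S_char2[OF True, of a 1] S.r_neg[OF that] that by (simp add: sg_1)
    have two: "a \<oplus>\<^bsub>S r\<^esub> (a \<oplus>\<^bsub>S r\<^esub> b) = b" if "a \<in> carrier (S r)" "b \<in> carrier (S r)" for a b
      using that by (simp add: two2 flip: S.a_assoc)
    have x1: "?x 1 = ?x 2 \<oplus>\<^bsub>S r\<^esub> (?x 3 \<oplus>\<^bsub>S r\<^esub> ?x 4)"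
      using two(1)[of "?x 2" "?x 1"] e by (simp add: S.a_comm)
    have "S.block_tr r (rr_block r X) = S.block_tr r (cc_block r X)"
      using brow_bcol_values[OF r] True unfolding S.block_tr_def rr_block_def cc_block_def
      by (auto simp: x1 S.a_ac two two2)
    then show ?thesis using True by (simp add: S_char2)
  next
    case False
    with r consider "r = 5" | "r = 6" by (cases rule: six_cases) simp_all
    then show ?thesis
    proof cases
      case 1
      then show ?thesis using tr
        by (simp add: supertraceless_def S.block_tr_def rr_block_def cc_block_def brow_def bcol_def class_rep_def)
    next
      case 2
      then show ?thesis using tr
        by (simp add: supertraceless_def S.block_tr_def rr_block_def cc_block_def brow_def bcol_def class_rep_def)
    qed
  qed
qed

lemma rc_block_supercomm:
  assumes X: "X \<in> grade Mat p" and Y: "Y \<in> grade Mat q" and r: "r \<in> {1..6}"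
  shows "rc_block r (supercomm Mat X Y) = (\<lambda>s t.
    (S.block_mul r (rr_block r X) (rc_block r Y) s t \<oplus>\<^bsub>S r\<^esub> S.block_mul r (rc_block r X) (cc_block r Y) s t) \<oplus>\<^bsub>S r\<^esub>
    sg (S r) (p * q + 1) (S.block_mul r (rr_block r Y) (rc_block r X) s t \<oplus>\<^bsub>S r\<^esub> S.block_mul r (rc_block r Y) (cc_block r X) s t))"
proof (intro ext)
  fix s t
  have [simp]: "X \<in> carrier Mat" "Y \<in> carrier Mat" using X Y by (auto dest: Mat.grade_carrier)
  have s4: "sum4 (S r) f = f (brow r False) \<oplus>\<^bsub>S r\<^esub> f (brow r True) \<oplus>\<^bsub>S r\<^esub> (f (bcol r False) \<oplus>\<^bsub>S r\<^esub> f (bcol r True))"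
    if "\<And>m. m \<in> idx \<Longrightarrow> f m \<in> carrier (S r)" for f
    using brow_bcol_values[OF r] that[of 1] that[of 2] that[of 3] that[of 4]
    by (auto simp: sum4_def S.a_ac split: if_splits)
  show "rc_block r (supercomm Mat X Y) s t = (S.block_mul r (rr_block r X) (rc_block r Y) s t \<oplus>\<^bsub>S r\<^esub> S.block_mul r (rc_block r X) (cc_block r Y) s t) \<oplus>\<^bsub>S r\<^esub>
    sg (S r) (p * q + 1) (S.block_mul r (rr_block r Y) (rc_block r X) s t \<oplus>\<^bsub>S r\<^esub> S.block_mul r (rc_block r Y) (cc_block r X) s t)"
    unfolding rc_block_def[of r "supercomm Mat X Y"] cl_supercomm_Mat[OF X Y brow_idx]
    by (simp add: s4 S.block_mul_def rc_block_def rr_block_def cc_block_def)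
qed

lemma block_psi_skew:
  assumes X: "X \<in> grade Mat p" and Y: "Y \<in> grade Mat q" and r: "r \<in> {1..6}"
  shows "block_psi r X Y = sg (S r) (p * q + 1) (block_psi r Y X)"
proof -
  have [simp]: "X \<in> carrier Mat" "Y \<in> carrier Mat" using X Y by (auto dest: Mat.grade_carrier)
  have "S.polar_det r (rc_block r Y) (rc_block r X) = sg (S r) ((p + 1) * (q + 1)) (S.polar_det r (rc_block r X) (rc_block r Y))"
    by (rule S.polar_det_swap[OF block_comm_Mat(1)[OF X Y r]]) simp_all
  then show ?thesis
    by (cases p; cases q; simp add: block_psi_homog[OF _ X r] block_psi_homog[OF _ Y r])
qed

lemma block_psi_alternating:
  assumes X: "X \<in> grade Mat 0" and r: "r \<in> {1..6}"
  shows "block_psi r X X = \<zero>\<^bsub>S r\<^esub>"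
  using block_comm_Mat(1)[OF X X r] Mat.grade_carrier[OF X]
  by (simp add: block_psi_homog[OF _ X r] S.polar_det_alternating)

lemma block_psi_even:
  assumes X: "X \<in> grade Mat p" and Y: "Y \<in> grade Mat q" and r: "r \<in> {1..6}"
  shows "block_psi r X Y \<in> grade (S r) (p + q)"
proof -
  have g: "rc_block r X s t \<otimes>\<^bsub>S r\<^esub> rc_block r Y s' t' \<in> grade (S r) (p + q)"
    if "ipar (brow r s) + ipar (bcol r t) = ipar (brow r s') + ipar (bcol r t')" for s t s' t'
  proof -
    have "rc_block r X s t \<otimes>\<^bsub>S r\<^esub> rc_block r Y s' t' \<in> grade (S r) ((p + ipar (brow r s) + ipar (bcol r t)) + (q + ipar (brow r s') + ipar (bcol r t')))"
      unfolding rc_block_def by (intro S.mult_even cl_grade grade_MatD X Y brow_idx)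
    also have "(p + ipar (brow r s) + ipar (bcol r t)) + (q + ipar (brow r s') + ipar (bcol r t')) = p + q"
      using that by (cases p; cases q; cases "ipar (brow r s)"; cases "ipar (bcol r t)"; simp add: add.assoc)
    finally show ?thesis .
  qed
  have e: "ipar (brow r s) + ipar (bcol r t) = ipar (brow r (\<not> s)) + ipar (bcol r (\<not> t))" for s t
    using r by (cases rule: six_cases) (auto simp: brow_def bcol_def class_rep_def)
  show ?thesis
    unfolding block_psi_homog[OF Mat.grade_carrier[OF X] Y r] S.polar_det_def
    using e[of True True] e[of True False] e[of False True] e[of False False] by (simp add: g)
qed

lemma block_psi_cocycle:
  assumes X: "X \<in> grade Mat p" and Y: "Y \<in> grade Mat q" and Z: "Z \<in> grade Mat v" and r: "r \<in> {1..6}"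
    and tr: "supertraceless r p X" "supertraceless r q Y" "supertraceless r v Z"
  shows "(sg (S r) (p * v) (block_psi r (supercomm Mat X Y) Z) \<oplus>\<^bsub>S r\<^esub> sg (S r) (p * q) (block_psi r (supercomm Mat Y Z) X)) \<oplus>\<^bsub>S r\<^esub>
      sg (S r) (q * v) (block_psi r (supercomm Mat Z X) Y) = \<zero>\<^bsub>S r\<^esub>"
proof -
  have [simp]: "X \<in> carrier Mat" "Y \<in> carrier Mat" "Z \<in> carrier Mat" using X Y Z by (auto dest: Mat.grade_carrier)
  have P: "sg (S r) (p * v) (block_psi r (supercomm Mat X Y) Z) = sg (S r) (p * v + v + 1) (S.polar_det r (rc_block r (supercomm Mat X Y)) (rc_block r Z))"
    "sg (S r) (p * q) (block_psi r (supercomm Mat Y Z) X) = sg (S r) (p * q + p + 1) (S.polar_det r (rc_block r (supercomm Mat Y Z)) (rc_block r X))"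
    "sg (S r) (q * v) (block_psi r (supercomm Mat Z X) Y) = sg (S r) (q * v + q + 1) (S.polar_det r (rc_block r (supercomm Mat Z X)) (rc_block r Y))"
    by (simp_all add: block_psi_homog[OF _ X r] block_psi_homog[OF _ Y r] block_psi_homog[OF _ Z r] add.assoc)
  show ?thesis
    unfolding P rc_block_supercomm[OF X Y r] rc_block_supercomm[OF Y Z r] rc_block_supercomm[OF Z X r]
    by (rule S.block_cocycle) (simp_all add: block_comm_Mat[OF X Y r] block_comm_Mat[OF Y Z r] block_comm_Mat[OF Z X r]
        block_comm_Mat[OF X Z r] block_comm_Mat[OF Y X r] block_comm_Mat[OF Z Y r] block_tr_Mat[OF X r tr(1)] block_tr_Mat[OF Y r tr(2)]
        block_tr_Mat[OF Z r tr(3)])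
qed

definition mat_psi where "mat_psi x y = (\<lambda>r\<in>{1..6}. block_psi r (mat_rep x) (mat_rep y))"

lemma mat_psi_app: "r \<in> {1..6} \<Longrightarrow> mat_psi x y r = block_psi r (mat_rep x) (mat_rep y)"
  by (simp add: mat_psi_def)

lemma mat_psi_closed [simp]: "\<lbrakk>x \<in> carrier L; y \<in> carrier L\<rbrakk> \<Longrightarrow> mat_psi x y \<in> carrier W"
  by (simp add: mat_psi_def carrier_W mat_rep_hom(1))

theorem super_cocycle_mat_psi: "super_cocycle K L W mat_psi"
proof (intro super_cocycle.intro L.lie_superalgebra_axioms graded_module_W super_cocycle_axioms.intro)
  fix x y p q assume g: "x \<in> grade L p" "y \<in> grade L q"
  note c = g[THEN L.grade_carrier]
  show "mat_psi x y \<in> grade W (p + q)"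
    using g by (auto simp: mat_psi_def grade_W intro: block_psi_even mat_rep_hom(5))
  show "mat_psi x y = sg W (p * q + 1) (mat_psi y x)"
    using c block_psi_skew[OF g[THEN mat_rep_hom(5)]] by (intro W_eqI) (simp_all add: W_sg_app mat_psi_app)
next
  fix x assume g: "x \<in> grade L 0"
  then show "mat_psi x x = \<zero>\<^bsub>W\<^esub>"
    using L.grade_carrier[OF g] block_psi_alternating[OF mat_rep_hom(5)[OF g]] by (intro W_eqI) (simp_all add: W_app mat_psi_app)
next
  fix x y z p q r assume g: "x \<in> grade L p" "y \<in> grade L q" "z \<in> grade L r"
  note c = g[THEN L.grade_carrier]
  show "sg W (p * r) (mat_psi (bracket L x y) z) \<oplus>\<^bsub>W\<^esub> sg W (p * q) (mat_psi (bracket L y z) x) \<oplus>\<^bsub>W\<^esub>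
      sg W (q * r) (mat_psi (bracket L z x) y) = \<zero>\<^bsub>W\<^esub>"
    using c block_psi_cocycle[OF g[THEN mat_rep_hom(5)] _ g[THEN mat_rep_supertraceless]]
    by (intro W_eqI) (simp_all add: W_app W_sg_app mat_psi_app mat_rep_hom(4))
qed (auto intro!: W_eqI W_closed simp: W_app mat_psi_app mat_rep_hom(1-3) block_psi_linear)

end

section \<open>The decomposition of the Steinberg Lie superalgebra\<close>

context lie_superalgebra
begin

lemma gpart_bracket:
  assumes [simp]: "x \<in> carrier L" "y \<in> carrier L"
  shows "gpart L p (bracket L x y) =
    bracket L (gpart L 0 x) (gpart L p y) \<oplus>\<^bsub>L\<^esub> bracket L (gpart L 1 x) (gpart L (p + 1) y)"
proof -
  have e: "gpart L p (bracket L (gpart L q x) (gpart L r y)) =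
      (if p = q + r then bracket L (gpart L q x) (gpart L r y) else \<zero>\<^bsub>L\<^esub>)" for q r
    by (rule gpart_homog) (simp add: bracket_even)
  have "gpart L p (bracket L x y) =
    gpart L p (bracket L (gpart L 0 x \<oplus>\<^bsub>L\<^esub> gpart L 1 x) (gpart L p y \<oplus>\<^bsub>L\<^esub> gpart L (p + 1) y))"
    by (simp add: gpart_decomp gpart_decomp')
  also have "\<dots> = bracket L (gpart L 0 x) (gpart L p y) \<oplus>\<^bsub>L\<^esub> bracket L (gpart L 1 x) (gpart L (p + 1) y)"
    by (simp add: bracket_add_left bracket_add_right gpart_add e)
  finally show ?thesis .
qed

lemma jacobi_deriv':
  assumes x: "x \<in> grade L p" and y: "y \<in> grade L q" and [simp]: "z \<in> carrier L"
  shows "bracket L (bracket L x y) z =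
    bracket L x (bracket L y z) \<oplus>\<^bsub>L\<^esub> sg L (p * q + 1) (bracket L y (bracket L x z))"
proof -
  note [simp] = x[THEN grade_carrier] y[THEN grade_carrier]
  have z: "z = gpart L 0 z \<oplus>\<^bsub>L\<^esub> gpart L 1 z" by (simp add: gpart_decomp)
  have "bracket L (bracket L x y) (gpart L 0 z \<oplus>\<^bsub>L\<^esub> gpart L 1 z) =
    bracket L x (bracket L y (gpart L 0 z \<oplus>\<^bsub>L\<^esub> gpart L 1 z)) \<oplus>\<^bsub>L\<^esub>
    sg L (p * q + 1) (bracket L y (bracket L x (gpart L 0 z \<oplus>\<^bsub>L\<^esub> gpart L 1 z)))"
    by (simp add: bracket_add_right jacobi_deriv[OF x y gpart_grade] M.sg_add M.a_ac)
  then show ?thesis unfolding z[symmetric] .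
qed

text \<open>Skew-symmetry and the Jacobi identity apply to homogeneous elements only. The elements
  both of whose components satisfy \<open>Q\<close> form a subalgebra.\<close>

lemma lie_generated_homog_induct:
  assumes x: "x \<in> lie_generated K L S"
    and gens: "\<And>s. s \<in> S \<Longrightarrow> Q s" "\<And>s. s \<in> S \<Longrightarrow> \<exists>p. s \<in> grade L p"
    and zero: "Q \<zero>\<^bsub>L\<^esub>"
    and add: "\<And>x y p. \<lbrakk>x \<in> grade L p; y \<in> grade L p; Q x; Q y\<rbrakk> \<Longrightarrow> Q (x \<oplus>\<^bsub>L\<^esub> y)"
    and smult: "\<And>k x p. \<lbrakk>k \<in> carrier K; x \<in> grade L p; Q x\<rbrakk> \<Longrightarrow> Q (k \<odot>\<^bsub>L\<^esub> x)"
    and br: "\<And>x y p q. \<lbrakk>x \<in> grade L p; y \<in> grade L q; Q x; Q y\<rbrakk> \<Longrightarrow> Q (bracket L x y)"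
  shows "x \<in> carrier L \<and> Q (gpart L q x)"
proof -
  define N where "N = {x \<in> carrier L. \<forall>q. Q (gpart L q x)}"
  have g0: "gpart L q \<zero>\<^bsub>L\<^esub> = \<zero>\<^bsub>L\<^esub>" for q using gpart_homog[OF grade_zero, of q q] by simp
  have "submodule N K L"
  proof (rule submoduleI)
    show sm: "k \<odot>\<^bsub>L\<^esub> x \<in> N" if "k \<in> carrier K" "x \<in> N" for k x
      using that by (auto simp: N_def gpart_smult intro: smult gpart_grade)
    show "\<ominus>\<^bsub>L\<^esub> x \<in> N" if "x \<in> N" for x
      using sm[of "\<ominus>\<^bsub>K\<^esub> \<one>\<^bsub>K\<^esub>" x] that by (simp add: smult_l_minus N_def)
  qed (auto simp: N_def g0 zero gpart_add intro: add gpart_grade)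
  moreover have "bracket L x y \<in> N" if "x \<in> N" "y \<in> N" for x y
  proof -
    have "Q (gpart L p (bracket L x y))" for p
    proof -
      have g: "bracket L (gpart L 0 x) (gpart L p y) \<in> grade L p"
         "bracket L (gpart L 1 x) (gpart L (p + 1) y) \<in> grade L p"
        using that bracket_even[OF gpart_grade gpart_grade, of x y 0 p]
          bracket_even[OF gpart_grade gpart_grade, of x y 1 "p + 1"] by (simp_all add: N_def add.commute)
      show ?thesis using that by (auto simp: N_def gpart_bracket intro!: add[OF g] br gpart_grade)
    qed
    then show ?thesis using that by (simp add: N_def)
  qed
  moreover have "S \<subseteq> N"
    using gens zero grade_carrier by (fastforce simp: N_def gpart_homog)
  ultimately have "lie_generated K L S \<subseteq> N"
    unfolding lie_generated_def lie_subalgebra_def by blast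
  then show ?thesis using x by (auto simp: N_def)
qed

end

context super_W
begin

text \<open>The set \<open>F\<^sub>i\<^sub>j(A)\<close>. The generators carry a degree, so a
  general element is a sum of an even and an odd one.\<close>

definition root_space :: "nat \<Rightarrow> nat \<Rightarrow> ('k, 'a) st_elem set"
  where "root_space i j = {F i j 0 a \<oplus>\<^bsub>L\<^esub> F i j 1 b | a b. a \<in> grade A 0 \<and> b \<in> grade A 1}"

lemma F_zero: "\<lbrakk>i \<in> idx; j \<in> idx; i \<noteq> j\<rbrakk> \<Longrightarrow> F i j p \<zero>\<^bsub>A\<^esub> = \<zero>\<^bsub>L\<^esub>"
  using F_smult[of i j "\<zero>\<^bsub>K\<^esub>" "\<zero>\<^bsub>A\<^esub>" p] by simp

lemma root_space_I: "\<lbrakk>a \<in> grade A 0; b \<in> grade A 1\<rbrakk> \<Longrightarrow> F i j 0 a \<oplus>\<^bsub>L\<^esub> F i j 1 b \<in> root_space i j"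
  unfolding root_space_def by blast

lemma root_space_E:
  assumes "x \<in> root_space i j"
  obtains a b where "x = F i j 0 a \<oplus>\<^bsub>L\<^esub> F i j 1 b" "a \<in> grade A 0" "b \<in> grade A 1"
  using assms by (auto simp: root_space_def)

lemma F_root_space:
  assumes "i \<in> idx" "j \<in> idx" "i \<noteq> j" "a \<in> grade A p"
  shows "F i j p a \<in> root_space i j"
proof (cases p)
  case zero
  then have "F i j p a = F i j 0 a \<oplus>\<^bsub>L\<^esub> F i j 1 \<zero>\<^bsub>A\<^esub>" using assms by (simp add: F_zero)
  then show ?thesis using assms zero root_space_I[of a "\<zero>\<^bsub>A\<^esub>" i j] by simp
next
  case one
  then have "F i j p a = F i j 0 \<zero>\<^bsub>A\<^esub> \<oplus>\<^bsub>L\<^esub> F i j 1 a" using assms by (simp add: F_zero)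
  then show ?thesis using assms one root_space_I[of "\<zero>\<^bsub>A\<^esub>" a i j] by simp
qed

lemma root_space_submodule:
  assumes ij: "i \<in> idx" "j \<in> idx" "i \<noteq> j" shows "submodule (root_space i j) K L"
proof (rule L.submoduleI)
  show "root_space i j \<subseteq> carrier L" using ij by (auto simp: root_space_def)
  show "\<zero>\<^bsub>L\<^esub> \<in> root_space i j" using F_root_space[OF ij grade_zero, of 0] by (simp add: F_zero ij)
  show sm: "k \<odot>\<^bsub>L\<^esub> x \<in> root_space i j" if "k \<in> carrier K" "x \<in> root_space i j" for k x
  proof -
    obtain a b where x: "x = F i j 0 a \<oplus>\<^bsub>L\<^esub> F i j 1 b" "a \<in> grade A 0" "b \<in> grade A 1" using \<open>x \<in> root_space i j\<close> by (rule root_space_E)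
    then have e: "k \<odot>\<^bsub>L\<^esub> x = F i j 0 (k \<odot>\<^bsub>A\<^esub> a) \<oplus>\<^bsub>L\<^esub> F i j 1 (k \<odot>\<^bsub>A\<^esub> b)"
      using ij that by (simp add: F_smult L.smult_r_distr)
    show ?thesis unfolding e by (rule root_space_I) (use x that in simp_all)
  qed
  show "\<ominus>\<^bsub>L\<^esub> x \<in> root_space i j" if "x \<in> root_space i j" for x
    using sm[OF _ that, of "\<ominus>\<^bsub>K\<^esub> \<one>\<^bsub>K\<^esub>"] that \<open>root_space i j \<subseteq> carrier L\<close> by (auto simp: L.smult_l_minus)
  show "x \<oplus>\<^bsub>L\<^esub> y \<in> root_space i j" if "x \<in> root_space i j" "y \<in> root_space i j" for x y
  proof -
    obtain a b where x: "x = F i j 0 a \<oplus>\<^bsub>L\<^esub> F i j 1 b" "a \<in> grade A 0" "b \<in> grade A 1" using \<open>x \<in> root_space i j\<close> by (rule root_space_E)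
    obtain c d where y: "y = F i j 0 c \<oplus>\<^bsub>L\<^esub> F i j 1 d" "c \<in> grade A 0" "d \<in> grade A 1" using \<open>y \<in> root_space i j\<close> by (rule root_space_E)
    have e: "x \<oplus>\<^bsub>L\<^esub> y = F i j 0 (a \<oplus>\<^bsub>A\<^esub> c) \<oplus>\<^bsub>L\<^esub> F i j 1 (b \<oplus>\<^bsub>A\<^esub> d)"
      using ij x y by (simp add: F_add L.M.a_ac)
    show ?thesis unfolding e by (rule root_space_I) (use x y in simp_all)
  qed
qed

lemmas root_space_submoduleE = L.submoduleE[OF root_space_submodule]

lemma root_space_zero: "\<lbrakk>i \<in> idx; j \<in> idx; i \<noteq> j\<rbrakk> \<Longrightarrow> \<zero>\<^bsub>L\<^esub> \<in> root_space i j"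
  using F_root_space[OF _ _ _ grade_zero, of i j 0] by (simp add: F_zero)

lemma root_space_sg: "\<lbrakk>i \<in> idx; j \<in> idx; i \<noteq> j; x \<in> root_space i j\<rbrakk> \<Longrightarrow> sg L p x \<in> root_space i j"
  by (simp add: sg_def root_space_submoduleE(3))

lemma root_space_bracketI:
  assumes ij: "i \<in> idx" "j \<in> idx" "i \<noteq> j" and x: "x \<in> carrier L" and N: "submodule N K L"
    and *: "\<And>p a. a \<in> grade A p \<Longrightarrow> bracket L x (F i j p a) \<in> N" and y: "y \<in> root_space i j"
  shows "bracket L x y \<in> N"
  using y
proof (rule root_space_E)
  fix a b assume "y = F i j 0 a \<oplus>\<^bsub>L\<^esub> F i j 1 b" "a \<in> grade A 0" "b \<in> grade A 1"
  then show ?thesis using ij x * L.submoduleE(5)[OF N] by (simp add: L.bracket_add_right)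
qed

lemma root_space_chain:
  assumes ijk: "i \<in> idx" "j \<in> idx" "k \<in> idx" "i \<noteq> j" "j \<noteq> k" "i \<noteq> k" and a: "a \<in> grade A p"
  shows "x \<in> root_space j k \<Longrightarrow> bracket L (F i j p a) x \<in> root_space i k"
    and "x \<in> root_space k i \<Longrightarrow> bracket L (F i j p a) x \<in> root_space k j"
proof -
  show "bracket L (F i j p a) x \<in> root_space i k" if "x \<in> root_space j k"
    by (rule root_space_bracketI[OF _ _ _ _ root_space_submodule _ that]) (use ijk a in \<open>simp_all add: F_chain F_root_space mult_even\<close>)
  show "bracket L (F i j p a) x \<in> root_space k j" if "x \<in> root_space k i"
  proof (rule root_space_bracketI[OF _ _ _ _ root_space_submodule _ that])
    fix q b assume b: "b \<in> grade A q"
    have "bracket L (F i j p a) (F k i q b) = sg L ((ipar i + ipar j + p) * (ipar k + ipar i + q) + 1) (bracket L (F k i q b) (F i j p a))"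
      using ijk a b by (intro L.skew F_grade) auto
    then show "bracket L (F i j p a) (F k i q b) \<in> root_space k j"
      using ijk a b by (simp add: F_chain F_root_space mult_even root_space_sg)
  qed (use ijk a in simp_all)
qed

lemma root_space_bracket_zero:
  assumes "i \<in> idx" "j \<in> idx" "i \<noteq> j" "k \<in> idx" "l \<in> idx" "k \<noteq> l" "j \<noteq> k" "i \<noteq> l" "a \<in> grade A p" "x \<in> root_space k l"
  shows "bracket L (F i j p a) x = \<zero>\<^bsub>L\<^esub>"
  using assms(10) by (rule root_space_E) (use assms in \<open>simp add: L.bracket_add_right F_bracket_zero\<close>)

lemma third_index:
  assumes "i \<in> idx" "j \<in> idx" obtains m where "m \<in> idx" "m \<noteq> i" "m \<noteq> j"
proof -
  have "card {i, j} < card idx" by (rule le_less_trans[of _ 2]) (auto simp: card_insert_if)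
  then have "\<not> idx \<subseteq> {i, j}" using card_mono[of "{i, j}" idx] by auto
  then show thesis using that by blast
qed

text \<open>By the Jacobi identity \<open>H\<^sub>i\<^sub>j(a, b)\<close> acts through two
  successive brackets with \<open>F\<^sub>i\<^sub>j(a)\<close> and
  \<open>F\<^sub>j\<^sub>i(b)\<close>. If \<open>k\<close> or \<open>l\<close> lies outside
  \<open>{i, j}\<close>, at most one order of the two survives, and it leads back to
  \<open>F\<^sub>k\<^sub>l(A)\<close>. Otherwise an element of \<open>F\<^sub>k\<^sub>l(A)\<close>
  is first written as a bracket through a third index, to whose factors the first case
  applies.\<close>

lemma H_root_space:
  assumes ij: "i \<in> idx" "j \<in> idx" "i \<noteq> j" "a \<in> grade A p" "b \<in> grade A q"
    and kl: "k \<in> idx" "l \<in> idx" "k \<noteq> l" and x: "x \<in> root_space k l"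
  shows "bracket L (bracket L (F i j p a) (F j i q b)) x \<in> root_space k l"
proof -
  let ?H = "bracket L (F i j p a) (F j i q b)"
  have Fc: "F i j p a \<in> carrier L" "F j i q b \<in> carrier L" using ij by simp_all
  have main: "bracket L ?H x \<in> root_space k l"
    if kl: "k \<in> idx" "l \<in> idx" "k \<noteq> l" and ne: "\<not> (k \<in> {i, j} \<and> l \<in> {i, j})" and x: "x \<in> root_space k l" for k l x
  proof -
    have xc: "x \<in> carrier L" using root_space_submoduleE(1)[OF kl] x by blast
    have "bracket L (F i j p a) (bracket L (F j i q b) x) \<in> root_space k l \<and> bracket L (F j i q b) (bracket L (F i j p a) x) \<in> root_space k l"
    proof -
      consider "k \<notin> {i, j}" "l \<notin> {i, j}" | "k = i" "l \<notin> {i, j}" | "k = j" "l \<notin> {i, j}" | "k \<notin> {i, j}" "l = i" | "k \<notin> {i, j}" "l = j"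
        using ne by blast
      then show ?thesis
      proof cases
        case 1
        have "bracket L (F j i q b) x = \<zero>\<^bsub>L\<^esub>" by (rule root_space_bracket_zero[of _ _ k l]) (use 1 ij kl x in auto)
        moreover have "bracket L (F i j p a) x = \<zero>\<^bsub>L\<^esub>" by (rule root_space_bracket_zero[of _ _ k l]) (use 1 ij kl x in auto)
        ultimately show ?thesis using Fc root_space_zero[OF kl] by simp
      next
        case 2
        have "bracket L (F i j p a) x = \<zero>\<^bsub>L\<^esub>" by (rule root_space_bracket_zero[of _ _ k l]) (use 2 ij kl x in auto)
        moreover have "bracket L (F j i q b) x \<in> root_space j l" by (rule root_space_chain(1)) (use 2 ij kl x in auto)
        then have "bracket L (F i j p a) (bracket L (F j i q b) x) \<in> root_space i l" by - (rule root_space_chain(1); use 2 ij kl in auto)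
        ultimately show ?thesis using 2 Fc root_space_zero[OF kl] by simp
      next
        case 3
        have "bracket L (F j i q b) x = \<zero>\<^bsub>L\<^esub>" by (rule root_space_bracket_zero[of _ _ k l]) (use 3 ij kl x in auto)
        moreover have "bracket L (F i j p a) x \<in> root_space i l" by (rule root_space_chain(1)) (use 3 ij kl x in auto)
        then have "bracket L (F j i q b) (bracket L (F i j p a) x) \<in> root_space j l" by - (rule root_space_chain(1); use 3 ij kl in auto)
        ultimately show ?thesis using 3 Fc root_space_zero[OF kl] by simp
      next
        case 4
        have "bracket L (F j i q b) x = \<zero>\<^bsub>L\<^esub>" by (rule root_space_bracket_zero[of _ _ k l]) (use 4 ij kl x in auto)
        moreover have "bracket L (F i j p a) x \<in> root_space k j" by (rule root_space_chain(2)) (use 4 ij kl x in auto)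
        then have "bracket L (F j i q b) (bracket L (F i j p a) x) \<in> root_space k i" by - (rule root_space_chain(2); use 4 ij kl in auto)
        ultimately show ?thesis using 4 Fc root_space_zero[OF kl] by simp
      next
        case 5
        have "bracket L (F i j p a) x = \<zero>\<^bsub>L\<^esub>" by (rule root_space_bracket_zero[of _ _ k l]) (use 5 ij kl x in auto)
        moreover have "bracket L (F j i q b) x \<in> root_space k i" by (rule root_space_chain(2)) (use 5 ij kl x in auto)
        then have "bracket L (F i j p a) (bracket L (F j i q b) x) \<in> root_space k j" by - (rule root_space_chain(2); use 5 ij kl in auto)
        ultimately show ?thesis using 5 Fc root_space_zero[OF kl] by simp
      qed
    qed
    then show ?thesis
      using L.jacobi_deriv'[OF F_grade F_grade xc, of i j a p j i b q] ij kl by (simp add: root_space_submoduleE(5) root_space_sg)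
  qed
  show ?thesis
  proof (cases "k \<in> {i, j} \<and> l \<in> {i, j}")
    case False
    then show ?thesis by (rule main[OF kl _ x])
  next
    case True
    obtain m where m: "m \<in> idx" "m \<noteq> i" "m \<noteq> j" using third_index ij(1,2) by blast
    have Hc: "?H \<in> carrier L" using Fc by simp
    show ?thesis
    proof (rule root_space_bracketI[OF kl Hc root_space_submodule[OF kl] _ x])
      fix s c assume c: "c \<in> grade A s"
      let ?u = "F k m s c" and ?v = "F m l 0 \<one>\<^bsub>A\<^esub>"
      have kml: "k \<noteq> m" "m \<noteq> l" using m True by auto
      have u: "?u \<in> root_space k m" "?v \<in> root_space m l" using kml kl m c one_even by (auto intro!: F_root_space)
      have uv: "bracket L ?u ?v = F k l s c"
        using F_chain[of k m l c s "\<one>\<^bsub>A\<^esub>" 0] kml kl m c one_even grade_carrier[OF c] by simp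
      have Hg: "?H \<in> grade L ((ipar i + ipar j + p) + (ipar j + ipar i + q))"
        using ij by (intro L.bracket_even F_grade) auto
      have ug: "?u \<in> grade L (ipar k + ipar m + s)" using kml kl m c by (intro F_grade) auto
      have vc: "?v \<in> carrier L" using kml kl m one_even by simp
      let ?e = "((ipar i + ipar j + p) + (ipar j + ipar i + q)) * (ipar k + ipar m + s)"
      have Hu: "bracket L ?H ?u \<in> root_space k m" and Hv: "bracket L ?H ?v \<in> root_space m l"
        using m kl kml u by (auto intro!: main)
      have chain: "bracket L y z \<in> root_space k l" if "y \<in> root_space k m" "z \<in> root_space m l" for y z
        using that(1)
      proof (rule root_space_E)
        fix a b assume y: "y = F k m 0 a \<oplus>\<^bsub>L\<^esub> F k m 1 b" "a \<in> grade A 0" "b \<in> grade A 1"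
        have "z \<in> carrier L" using that(2) root_space_submoduleE(1)[OF m(1) kl(2) kml(2)] by blast
        then show ?thesis using y that(2) m kl kml
          by (simp add: L.bracket_add_left root_space_submoduleE(5) root_space_chain(1))
      qed
      have "bracket L (bracket L ?H ?u) ?v = bracket L ?H (bracket L ?u ?v) \<oplus>\<^bsub>L\<^esub> sg L (?e + 1) (bracket L ?u (bracket L ?H ?v))"
        by (rule L.jacobi_deriv'[OF Hg ug vc])
      then have "bracket L ?H (bracket L ?u ?v) = bracket L (bracket L ?H ?u) ?v \<oplus>\<^bsub>L\<^esub> sg L ?e (bracket L ?u (bracket L ?H ?v))"
        using Hc vc L.grade_carrier[OF ug] L.sg_cancel[of "bracket L ?u (bracket L ?H ?v)" ?e]
        by (simp add: L.M.a_assoc) (simp add: L.M.a_comm)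
      also have "\<dots> \<in> root_space k l" using Hu Hv u kl by (intro root_space_submoduleE(5) root_space_sg chain) auto
      finally show "bracket L ?H (F k l s c) \<in> root_space k l" by (simp only: uv)
    qed
  qed
qed

definition H_gens where
  "H_gens = {bracket L (F i j p a) (F j i q b) | i j p a q b.
      i \<in> idx \<and> j \<in> idx \<and> i \<noteq> j \<and> a \<in> grade A p \<and> b \<in> grade A q}"

lemma stH_eq: "stH K A = lie_generated K L H_gens"
  by (simp add: stH_def H_gens_def)

lemma H_gens_homog: "s \<in> H_gens \<Longrightarrow> \<exists>p. s \<in> grade L p"
  unfolding H_gens_def using L.bracket_even F_grade by blast

lemma H_root_space_homog:
  assumes "h \<in> stH K A"
  shows "h \<in> carrier L \<and> (\<forall>k l x. k \<in> idx \<longrightarrow> l \<in> idx \<longrightarrow> k \<noteq> l \<longrightarrow> x \<in> root_space k l \<longrightarrow> bracket L (gpart L q h) x \<in> root_space k l)"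
proof (rule L.lie_generated_homog_induct[OF assms[unfolded stH_eq], where Q = "\<lambda>h. \<forall>k l x. k \<in> idx \<longrightarrow> l \<in> idx \<longrightarrow> k \<noteq> l \<longrightarrow>
    x \<in> root_space k l \<longrightarrow> bracket L h x \<in> root_space k l"]; (intro allI impI)?)
  fix x y p q k l z assume *: "x \<in> grade L p" "y \<in> grade L q" "k \<in> idx" "l \<in> idx" "k \<noteq> l" "z \<in> root_space k l"
    "\<forall>k l z. k \<in> idx \<longrightarrow> l \<in> idx \<longrightarrow> k \<noteq> l \<longrightarrow> z \<in> root_space k l \<longrightarrow> bracket L x z \<in> root_space k l"
    "\<forall>k l z. k \<in> idx \<longrightarrow> l \<in> idx \<longrightarrow> k \<noteq> l \<longrightarrow> z \<in> root_space k l \<longrightarrow> bracket L y z \<in> root_space k l"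
  have "z \<in> carrier L" using root_space_submoduleE(1)[OF *(3-5)] *(6) by blast
  then show "bracket L (bracket L x y) z \<in> root_space k l"
    using * by (simp add: L.jacobi_deriv'[OF *(1,2)] root_space_submoduleE(5) root_space_sg)
next
  fix x y p k l z assume *: "x \<in> grade L p" "y \<in> grade L p" "k \<in> idx" "l \<in> idx" "k \<noteq> l" "z \<in> root_space k l"
    "\<forall>k l z. k \<in> idx \<longrightarrow> l \<in> idx \<longrightarrow> k \<noteq> l \<longrightarrow> z \<in> root_space k l \<longrightarrow> bracket L x z \<in> root_space k l"
    "\<forall>k l z. k \<in> idx \<longrightarrow> l \<in> idx \<longrightarrow> k \<noteq> l \<longrightarrow> z \<in> root_space k l \<longrightarrow> bracket L y z \<in> root_space k l"
  have "z \<in> carrier L" using root_space_submoduleE(1)[OF *(3-5)] *(6) by blast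
  then show "bracket L (x \<oplus>\<^bsub>L\<^esub> y) z \<in> root_space k l"
    using * *(1,2)[THEN L.grade_carrier] by (simp add: L.bracket_add_left root_space_submoduleE(5))
next
  fix c x p k l z assume *: "c \<in> carrier K" "x \<in> grade L p" "k \<in> idx" "l \<in> idx" "k \<noteq> l" "z \<in> root_space k l"
    "\<forall>k l z. k \<in> idx \<longrightarrow> l \<in> idx \<longrightarrow> k \<noteq> l \<longrightarrow> z \<in> root_space k l \<longrightarrow> bracket L x z \<in> root_space k l"
  have "z \<in> carrier L" using root_space_submoduleE(1)[OF *(3-5)] *(6) by blast
  then show "bracket L (c \<odot>\<^bsub>L\<^esub> x) z \<in> root_space k l"
    using * *(2)[THEN L.grade_carrier] by (simp add: L.bracket_smult_left root_space_submoduleE(4))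
next
  fix k l z assume *: "k \<in> idx" "l \<in> idx" "k \<noteq> l" "z \<in> root_space k l"
  have "z \<in> carrier L" using root_space_submoduleE(1)[OF *(1-3)] *(4) by blast
  then show "bracket L \<zero>\<^bsub>L\<^esub> z \<in> root_space k l" using root_space_zero[OF *(1-3)] by simp
next
  fix s k l z assume "s \<in> H_gens" "k \<in> idx" "l \<in> idx" "k \<noteq> l" "z \<in> root_space k l"
  then show "bracket L s z \<in> root_space k l" unfolding H_gens_def using H_root_space by blast
qed (rule H_gens_homog)

lemma stH_carrier: "h \<in> stH K A \<Longrightarrow> h \<in> carrier L"
  using H_root_space_homog by blast

lemma F_H:
  assumes h: "h \<in> stH K A" and ij: "i \<in> idx" "j \<in> idx" "i \<noteq> j" "a \<in> grade A p"
  shows "bracket L (F i j p a) h \<in> root_space i j"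
proof -
  note hc[simp] = stH_carrier[OF h]
  have Fc[simp]: "F i j p a \<in> carrier L" using ij by simp
  have *: "bracket L (F i j p a) (gpart L q h) \<in> root_space i j" for q
    using H_root_space_homog[OF h, of q] ij F_root_space[OF ij]
    by (subst L.skew[OF F_grade[OF ij] L.gpart_grade[OF hc]]) (auto intro: root_space_sg)
  have "bracket L (F i j p a) (gpart L 0 h \<oplus>\<^bsub>L\<^esub> gpart L 1 h) \<in> root_space i j"
    using * ij by (simp add: L.bracket_add_right root_space_submoduleE(5))
  then show ?thesis by (simp add: L.gpart_decomp)
qed

text \<open>Bracketing with a root element preserves the span of \<open>H\<close> and the root
  spaces. By the Jacobi identity the same holds for bracketing with any term, so the span contains
  all terms.\<close>

theorem st_span:
  assumes N: "submodule N K L" and H: "stH K A \<subseteq> N"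
    and FN: "\<And>i j p a. \<lbrakk>i \<in> idx; j \<in> idx; i \<noteq> j; a \<in> grade A p\<rbrakk> \<Longrightarrow> F i j p a \<in> N"
  shows "carrier L \<subseteq> N"
proof -
  define good where "good N \<longleftrightarrow> submodule N K L \<and> stH K A \<subseteq> N \<and>
    (\<forall>i j p a. i \<in> idx \<longrightarrow> j \<in> idx \<longrightarrow> i \<noteq> j \<longrightarrow> a \<in> grade A p \<longrightarrow> F i j p a \<in> N)" for N
  define B where "B = {x \<in> carrier L. \<forall>N. good N \<longrightarrow> x \<in> N}"
  have Bmin: "B \<subseteq> N" if "good N" for N using that by (auto simp: B_def)
  have HN: "stH K A \<subseteq> B" using stH_carrier by (auto simp: B_def good_def)
  have FB: "F i j p a \<in> B" if "i \<in> idx" "j \<in> idx" "i \<noteq> j" "a \<in> grade A p" for i j p a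
    using that by (simp add: B_def good_def)
  have B: "submodule B K L"
  proof (rule L.submoduleI)
    have "\<zero>\<^bsub>L\<^esub> \<in> N" if N: "submodule N K L" for N
    proof -
      obtain x where x: "x \<in> N" using L.submoduleE(2)[OF N] by blast
      then show ?thesis using L.submoduleE(4)[OF N, of "\<zero>\<^bsub>K\<^esub>" x] L.submoduleE(1)[OF N] by auto
    qed
    then show "\<zero>\<^bsub>L\<^esub> \<in> B" by (simp add: B_def good_def)
    show "x \<oplus>\<^bsub>L\<^esub> y \<in> B" if "x \<in> B" "y \<in> B" for x y
      using that by (simp add: B_def good_def L.submoduleE(5))
    show "k \<odot>\<^bsub>L\<^esub> x \<in> B" if "k \<in> carrier K" "x \<in> B" for k x
      using that by (simp add: B_def good_def L.submoduleE(4))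
    show "\<ominus>\<^bsub>L\<^esub> x \<in> B" if "x \<in> B" for x
      using that by (simp add: B_def good_def L.submoduleE(3))
  qed (simp add: B_def)
  note BE = L.submoduleE[OF B]
  have root_space_B: "root_space i j \<subseteq> B" if "i \<in> idx" "j \<in> idx" "i \<noteq> j" for i j
    using that FB BE(5) by (auto simp: root_space_def)
  have B_zero: "\<zero>\<^bsub>L\<^esub> \<in> B" using FB[of 1 2 "\<zero>\<^bsub>A\<^esub>" 0] by (simp add: F_zero)
  have F_br: "bracket L (F i j p a) x \<in> B" if ij: "i \<in> idx" "j \<in> idx" "i \<noteq> j" "a \<in> grade A p" and x: "x \<in> B" for i j p a x
  proof -
    let ?N = "{x \<in> B. bracket L (F i j p a) x \<in> B}"
    have Fc: "F i j p a \<in> carrier L" using ij by simp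
    have "good ?N"
      unfolding good_def
    proof (intro conjI allI impI)
      have c: "x \<in> B \<Longrightarrow> x \<in> carrier L" for x using BE(1) by blast
      show "submodule ?N K L"
        by (rule L.submoduleI) (use Fc c BE B_zero in \<open>auto simp: L.bracket_add_right L.bracket_smult_right L.bracket_minus_right\<close>)
      show "stH K A \<subseteq> ?N" using HN F_H[OF _ ij] root_space_B[OF ij(1-3)] by blast
      fix k l q b assume kl: "k \<in> idx" "l \<in> idx" "k \<noteq> l" "b \<in> grade A q"
      have "bracket L (F i j p a) (F k l q b) \<in> B"
      proof (cases "j = k")
        case jk: True
        show ?thesis
        proof (cases "i = l")
          case True
          have "bracket L (F i j p a) (F k l q b) \<in> H_gens"
            unfolding H_gens_def using ij kl jk True by blast
          then have "bracket L (F i j p a) (F k l q b) \<in> stH K A"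
            unfolding stH_eq lie_generated_def by blast
          then show ?thesis using HN by blast
        next
          case False
          then show ?thesis using ij kl jk by (simp add: F_chain FB mult_even)
        qed
      next
        case jk: False
        show ?thesis
        proof (cases "i = l")
          case True
          have "bracket L (F i j p a) (F k l q b) \<in> root_space k j"
            unfolding True by (rule root_space_chain(2)) (use ij kl jk True F_root_space in auto)
          then show ?thesis using root_space_B ij kl jk by blast
        next
          case False
          then show ?thesis using ij kl jk by (simp add: F_bracket_zero B_zero)
        qed
      qed
      then show "F k l q b \<in> ?N" using FB kl by simp
    qed
    from Bmin[OF this] show ?thesis using x by blast
  qed
  have trm: "(\<forall>x\<in>B. bracket L (st.cls t) x \<in> B) \<and> st.cls t \<in> B" if "st.homog p t" for p t
    using that
  proof (induction rule: homog_term.induct)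
    case (gen x)
    then obtain i j p a where x: "x = (i, j, p, a)" and ij: "i \<in> idx" "j \<in> idx" "i \<noteq> j" "a \<in> grade A p"
      by (rule gens_E)
    show ?case unfolding x F_eq[symmetric] using F_br FB ij by blast
  next
    case (zero p)
    show ?case using BE(1) B_zero by (auto simp flip: st.zero_P L_eq)
  next
    case (add p s t)
    note c = add.hyps[THEN st.homog_terms]
    have e: "st.cls (Add s t) = st.cls s \<oplus>\<^bsub>L\<^esub> st.cls t" using c by (simp add: L_eq st.add_P)
    have cc: "st.cls s \<in> carrier L" "st.cls t \<in> carrier L" using c by (simp_all add: L_eq)
    show ?case unfolding e using add.IH BE cc by (auto simp: L.bracket_add_left subset_eq)
  next
    case (smult k p t)
    have c: "t \<in> st.T" using smult.hyps st.homog_terms by blast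
    have e: "st.cls (Smult k t) = k \<odot>\<^bsub>L\<^esub> st.cls t" using c smult by (simp add: L_eq st.smult_P)
    have cc: "st.cls t \<in> carrier L" using c by (simp add: L_eq)
    show ?case unfolding e using smult BE cc by (auto simp: L.bracket_smult_left subset_eq)
  next
    case (br p s q t)
    note c = br.hyps[THEN st.homog_terms]
    have e: "st.cls (Br s t) = bracket L (st.cls s) (st.cls t)" using c by (simp add: L_eq st.br_P)
    have g: "st.cls s \<in> grade L p" "st.cls t \<in> grade L q" using br.hyps by (simp_all add: L_eq st.grade_P_I)
    have "bracket L (bracket L (st.cls s) (st.cls t)) x \<in> B" if x: "x \<in> B" for x
    proof -
      have sgB: "sg L (p * q + 1) y \<in> B" if "y \<in> B" for y using that BE(3) by (simp add: sg_def)
      have xc: "x \<in> carrier L" using x BE(1) by blast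
      have st: "\<And>y. y \<in> B \<Longrightarrow> bracket L (st.cls s) y \<in> B" "\<And>y. y \<in> B \<Longrightarrow> bracket L (st.cls t) y \<in> B"
        using br.IH by blast+
      show ?thesis unfolding L.jacobi_deriv'[OF g xc] by (intro BE(5) sgB st x)
    qed
    then show ?case unfolding e using br.IH by blast
  qed
  have "x \<in> B" if x: "x \<in> carrier L" for x
  proof -
    have "gpart L p x \<in> B" for p
      using L.gpart_grade[OF x, of p] trm unfolding L_eq by (auto elim!: st.grade_P_E)
    then have "gpart L 0 x \<oplus>\<^bsub>L\<^esub> gpart L 1 x \<in> B" by (intro BE(5))
    then show ?thesis by (simp add: L.gpart_decomp x)
  qed
  moreover have "good N" using assms by (simp add: good_def)
  ultimately show ?thesis using Bmin by blast
qed

end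

section \<open>The map \<open>\<psi>\<close> and the extension\<close>

text \<open>The product of the two row indices is constant on each class and separates the six
  classes.\<close>

lemma quad_class_label:
  assumes "(i, j, k, l) \<in> quad_class r"
  shows "r = (if i * k = 3 then 1 else if i * k = 4 then 2 else if i * k = 6 then 3
    else if i * k = 8 then 4 else if i * k = 2 then 5 else 6)"
  using assms unfolding quad_class_def by (simp split: if_split_asm; elim disjE; simp)

lemma quad_class_unique:
  assumes "t \<in> quad_class r" "t \<in> quad_class r'" shows "r = r'"
proof -
  obtain i j k l where t: "t = (i, j, k, l)" by (cases t)
  show ?thesis
    by (rule HOL.trans[OF quad_class_label[OF assms(1)[unfolded t]] quad_class_label[OF assms(2)[unfolded t], symmetric]])
qed

lemma quad_theta_eq: "t \<in> quad_class r \<Longrightarrow> quad_theta t = r"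
  unfolding quad_theta_def by (rule the_equality) (auto dest: quad_class_unique)

lemma quad_class_distinct: "(i, j, k, l) \<in> quad_class r \<Longrightarrow> distinct [i, j, k, l]"
  unfolding quad_class_def by (simp split: if_split_asm; elim disjE; simp)

lemma quad_class_range: "t \<in> quad_class r \<Longrightarrow> r \<in> {1..6}"
  unfolding quad_class_def by (simp add: atLeastAtMost_iff split: if_split_asm)

lemma quad_class_ex:
  assumes "i \<in> idx" "j \<in> idx" "k \<in> idx" "l \<in> idx" "distinct [i, j, k, l]"
  shows "\<exists>r. (i, j, k, l) \<in> quad_class r"
proof -
  have "(i, j, k, l) \<in> quad_class 1 \<union> quad_class 2 \<union> quad_class 3 \<union> quad_class 4 \<union> quad_class 5 \<union> quad_class 6"
    using assms by (elim idx_cases) (simp_all add: quad_class_def)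
  then show ?thesis by blast
qed

lemma quad_class_class_rep: "r \<in> {1..6} \<Longrightarrow> quad_class r = quad_coset (class_rep r)"
  by (erule six_cases) (simp_all add: quad_class_def class_rep_def)

definition sigma_bit :: "quad \<Rightarrow> bit"
  where "sigma_bit t = (if quad_sigma t = 1 then 0 else 1)"

lemma ksgn_sigma: "ksgn q * quad_sigma t = ksgn (q + sigma_bit t)"
  by (cases q) (simp_all add: ksgn_def sigma_bit_def quad_sigma_def)

context super_W
begin

text \<open>The four products in the polarised determinant belong to the four quadruples of the
  class, so for two matrix units at most one of them is non-zero.\<close>

lemma block_psi_elem_mat:
  assumes ab: "a \<in> grade A p" "b \<in> grade A q" and r: "r \<in> {1..6}"
  shows "block_psi r (elem_mat A i j a) (elem_mat A k l b) =
    (if (i, j, k, l) \<in> quad_class r then sg (S r) (q + sigma_bit (i, j, k, l)) (cl r (a \<otimes>\<^bsub>A\<^esub> b)) else \<zero>\<^bsub>S r\<^esub>)"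
proof -
  have [simp]: "a \<in> carrier A" "b \<in> carrier A" using ab by (auto dest: grade_carrier)
  have pz: "parity_inv \<zero>\<^bsub>A\<^esub> = \<zero>\<^bsub>A\<^esub>" using parity_inv_homog[OF grade_zero, of 0] by simp
  have rc_block: "rc_block r (elem_mat A i j a) s t = (if i = brow r s \<and> j = bcol r t then cl r a else \<zero>\<^bsub>S r\<^esub>)" for i j s t
    by (auto simp: rc_block_def elem_mat_app)
  have rc_block_inv: "rc_block_inv r (elem_mat A k l b) s t = (if k = brow r s \<and> l = bcol r t then sg (S r) q (cl r b) else \<zero>\<^bsub>S r\<^esub>)" for k l s t
    by (auto simp: rc_block_inv_def elem_mat_app parity_inv_homog[OF ab(2)] cl_sg pz)
  obtain i0 j0 k0 l0 where q: "class_rep r = (i0, j0, k0, l0)" by (cases "class_rep r")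
  have d: "distinct [i0, j0, k0, l0]"
    using quad_class_distinct[of i0 j0 k0 l0 r] quad_class_class_rep[OF r] q by simp
  have b: "brow r False = i0" "brow r True = k0" "bcol r False = j0" "bcol r True = l0"
    by (simp_all add: brow_def bcol_def q)
  have cls: "(i, j, k, l) \<in> quad_class r \<longleftrightarrow> (i = i0 \<and> j = j0 \<and> k = k0 \<and> l = l0) \<or> (i = k0 \<and> j = j0 \<and> k = i0 \<and> l = l0) \<or>
      (i = i0 \<and> j = l0 \<and> k = k0 \<and> l = j0) \<or> (i = k0 \<and> j = l0 \<and> k = i0 \<and> l = j0)"
    using quad_class_class_rep[OF r] q by auto
  have sgn: "r \<le> 4 \<or> (sigma_bit (i0, j0, k0, l0) = 0 \<and> sigma_bit (k0, j0, i0, l0) = 1 \<and> sigma_bit (i0, l0, k0, j0) = 1 \<and> sigma_bit (k0, l0, i0, j0) = 0)"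
    using r q by (cases rule: six_cases) (auto simp: class_rep_def sigma_bit_def quad_sigma_def)
  have c2: "r \<le> 4 \<Longrightarrow> x \<in> carrier (S r) \<Longrightarrow> sg (S r) e x = x" for e x by (rule S_char2)
  consider "i = i0" "j = j0" "k = k0" "l = l0" | "i = k0" "j = j0" "k = i0" "l = l0" |
    "i = i0" "j = l0" "k = k0" "l = j0" | "i = k0" "j = l0" "k = i0" "l = j0" | "(i, j, k, l) \<notin> quad_class r"
    using cls by blast
  then show ?thesis
  proof cases
    case 1
    then show ?thesis using d sgn cls
      by (auto simp: block_psi_def S.polar_det_def rc_block rc_block_inv b S.mult_sg_right cl_mult c2)
  next
    case 2
    then show ?thesis using d sgn cls
      by (auto simp: block_psi_def S.polar_det_def rc_block rc_block_inv b S.mult_sg_right cl_mult c2 add.commute)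
  next
    case 3
    then show ?thesis using d sgn cls
      by (auto simp: block_psi_def S.polar_det_def rc_block rc_block_inv b S.mult_sg_right cl_mult c2 add.commute)
  next
    case 4
    then show ?thesis using d sgn cls
      by (auto simp: block_psi_def S.polar_det_def rc_block rc_block_inv b S.mult_sg_right cl_mult c2)
  next
    case 5
    then have n: "\<not> (i = i0 \<and> j = j0 \<and> k = k0 \<and> l = l0)" "\<not> (i = k0 \<and> j = j0 \<and> k = i0 \<and> l = l0)"
      "\<not> (i = i0 \<and> j = l0 \<and> k = k0 \<and> l = j0)" "\<not> (i = k0 \<and> j = l0 \<and> k = i0 \<and> l = j0)"
      using cls by blast+
    have z: "(if P then x else \<zero>\<^bsub>S r\<^esub>) \<otimes>\<^bsub>S r\<^esub> (if R then y else \<zero>\<^bsub>S r\<^esub>) = \<zero>\<^bsub>S r\<^esub>"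
      if "\<not> (P \<and> R)" "x \<in> carrier (S r)" "y \<in> carrier (S r)" for P R x y
      using that by auto
    have "block_psi r (elem_mat A i j a) (elem_mat A k l b) = \<zero>\<^bsub>S r\<^esub>"
      unfolding block_psi_def S.polar_det_def rc_block rc_block_inv b using n by (subst (1 2 3 4) z) auto
    then show ?thesis using 5 by simp
  qed
qed

lemma Winj_closed:
  assumes "x \<in> carrier (S r)" "r \<in> {1..6}" shows "Winj A r x \<in> carrier W"
  using assms by (auto simp: Winj_def carrier_W)

lemma Winj_app: "s \<in> {1..6} \<Longrightarrow> Winj A r x s = (if s = r then x else \<zero>\<^bsub>S s\<^esub>)"
  by (simp add: Winj_def)

lemma mat_psi_F:
  assumes ij: "i \<in> idx" "j \<in> idx" "i \<noteq> j" and kl: "k \<in> idx" "l \<in> idx" "k \<noteq> l"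
    and ab: "a \<in> grade A p" "b \<in> grade A q"
  shows "mat_psi (F i j p a) (F k l q b) = (if distinct [i, j, k, l] then
      sg W (q + sigma_bit (i, j, k, l)) (Winj A (quad_theta (i, j, k, l)) (cl (quad_theta (i, j, k, l)) (a \<otimes>\<^bsub>A\<^esub> b)))
    else \<zero>\<^bsub>W\<^esub>)"
proof -
  have [simp]: "a \<in> carrier A" "b \<in> carrier A" using ab by (auto dest: grade_carrier)
  show ?thesis
  proof (cases "distinct [i, j, k, l]")
    case True
    obtain r where r: "(i, j, k, l) \<in> quad_class r" using quad_class_ex ij kl True by blast
    note r6 = quad_class_range[OF r] and th = quad_theta_eq[OF r]
    have Wc: "Winj A r (cl r (a \<otimes>\<^bsub>A\<^esub> b)) \<in> carrier W" using r6 by (simp add: Winj_closed)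
    have "mat_psi (F i j p a) (F k l q b) = sg W (q + sigma_bit (i, j, k, l)) (Winj A r (cl r (a \<otimes>\<^bsub>A\<^esub> b)))"
    proof (rule W_eqI)
      fix s :: nat assume s: "s \<in> {1..6}"
      show "mat_psi (F i j p a) (F k l q b) s = sg W (q + sigma_bit (i, j, k, l)) (Winj A r (cl r (a \<otimes>\<^bsub>A\<^esub> b))) s"
      proof (cases "s = r")
        case True
        then show ?thesis using r r6 Wc ij kl ab
          by (simp add: mat_psi_app mat_rep_F block_psi_elem_mat[OF ab r6] W_sg_app Winj_app)
      next
        case False
        then have "(i, j, k, l) \<notin> quad_class s" using quad_class_unique[OF r] by blast
        with False show ?thesis using s Wc ij kl ab
          by (simp add: mat_psi_app mat_rep_F block_psi_elem_mat[OF ab s] W_sg_app Winj_app)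
      qed
    qed (use Wc ij kl ab in simp_all)
    then show ?thesis using True th by simp
  next
    case False
    then have n: "(i, j, k, l) \<notin> quad_class s" for s using quad_class_distinct by blast
    have "mat_psi (F i j p a) (F k l q b) = \<zero>\<^bsub>W\<^esub>"
      using ij kl ab n by (intro W_eqI) (simp_all add: mat_psi_app mat_rep_F block_psi_elem_mat[OF ab] W_zero_app W_closed)
    then show ?thesis by (simp only: False if_False)
  qed
qed

text \<open>Diagonal matrices form a subalgebra, and the generators of \<open>H\<close> are
  represented by such matrices. Since \<open>\<psi>\<close> uses off-diagonal entries, it vanishes
  on \<open>H\<close>.\<close>

lemma mat_rep_H:
  assumes h: "h \<in> stH K A" and ij: "i \<in> idx" "j \<in> idx" "i \<noteq> j"
  shows "mat_rep h (i, j) = \<zero>\<^bsub>A\<^esub>"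
proof -
  have "h \<in> carrier L \<and> (\<forall>i\<in>idx. \<forall>j\<in>idx. i \<noteq> j \<longrightarrow> mat_rep (gpart L q h) (i, j) = \<zero>\<^bsub>A\<^esub>)" for q
  proof (rule L.lie_generated_homog_induct[OF h[unfolded stH_eq], where
        Q = "\<lambda>h. \<forall>i\<in>idx. \<forall>j\<in>idx. i \<noteq> j \<longrightarrow> mat_rep h (i, j) = \<zero>\<^bsub>A\<^esub>"]; (intro ballI impI)?)
    fix s i j assume s: "s \<in> H_gens" and ij: "i \<in> idx" "j \<in> idx" "i \<noteq> j"
    obtain k l p a q b where s: "s = bracket L (F k l p a) (F l k q b)" and kl: "k \<in> idx" "l \<in> idx" "k \<noteq> l"
      and ab: "a \<in> grade A p" "b \<in> grade A q"
      using s unfolding H_gens_def by blast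
    note c = ab[THEN grade_carrier]
    show "mat_rep s (i, j) = \<zero>\<^bsub>A\<^esub>"
      using kl ab c ij unfolding s
      by (auto simp: mat_rep_hom(4) mat_rep_F supercomm_elem_mat[OF kl(1,2) kl(2,1) ab] mat_app Mat_sg_app elem_mat_app)
  next
    fix i j :: nat assume ij: "i \<in> idx" "j \<in> idx" "i \<noteq> j"
    have "mat_rep \<zero>\<^bsub>L\<^esub> = \<zero>\<^bsub>Mat\<^esub>" using mat_rep_hom(3)[of "\<zero>\<^bsub>K\<^esub>" "\<zero>\<^bsub>L\<^esub>"] mat_rep_hom(1)[of "\<zero>\<^bsub>L\<^esub>"] by simp
    then show "mat_rep \<zero>\<^bsub>L\<^esub> (i, j) = \<zero>\<^bsub>A\<^esub>" using ij by (simp add: mat_app)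
  next
    fix x y p i j assume "x \<in> grade L p" "y \<in> grade L p" and ij: "i \<in> idx" "j \<in> idx" "i \<noteq> j"
      and xy: "\<forall>i\<in>idx. \<forall>j\<in>idx. i \<noteq> j \<longrightarrow> mat_rep x (i, j) = \<zero>\<^bsub>A\<^esub>" "\<forall>i\<in>idx. \<forall>j\<in>idx. i \<noteq> j \<longrightarrow> mat_rep y (i, j) = \<zero>\<^bsub>A\<^esub>"
    then show "mat_rep (x \<oplus>\<^bsub>L\<^esub> y) (i, j) = \<zero>\<^bsub>A\<^esub>" using L.grade_carrier by (simp add: mat_rep_hom(2) mat_app)
  next
    fix k x p i j assume "k \<in> carrier K" "x \<in> grade L p" and ij: "i \<in> idx" "j \<in> idx" "i \<noteq> j"
      and xy: "\<forall>i\<in>idx. \<forall>j\<in>idx. i \<noteq> j \<longrightarrow> mat_rep x (i, j) = \<zero>\<^bsub>A\<^esub>"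
    then show "mat_rep (k \<odot>\<^bsub>L\<^esub> x) (i, j) = \<zero>\<^bsub>A\<^esub>" using L.grade_carrier by (simp add: mat_rep_hom(3) mat_app)
  next
    fix x y p q i j assume g: "x \<in> grade L p" "y \<in> grade L q" and ij: "i \<in> idx" "j \<in> idx" "i \<noteq> j"
      and xy: "\<forall>i\<in>idx. \<forall>j\<in>idx. i \<noteq> j \<longrightarrow> mat_rep x (i, j) = \<zero>\<^bsub>A\<^esub>" "\<forall>i\<in>idx. \<forall>j\<in>idx. i \<noteq> j \<longrightarrow> mat_rep y (i, j) = \<zero>\<^bsub>A\<^esub>"
    note c = g[THEN L.grade_carrier] and mc = g[THEN L.grade_carrier, THEN mat_rep_hom(1)]
    have z: "mat_rep x (i, m) \<otimes>\<^bsub>A\<^esub> mat_rep y (m, j) = \<zero>\<^bsub>A\<^esub>" "mat_rep y (i, m) \<otimes>\<^bsub>A\<^esub> mat_rep x (m, j) = \<zero>\<^bsub>A\<^esub>" if m: "m \<in> idx" for m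
      using ij xy mc m by (cases "m = i"; simp)+
    show "mat_rep (bracket L x y) (i, j) = \<zero>\<^bsub>A\<^esub>"
      using c ij by (simp add: mat_rep_hom(4) supercomm_Mat_app[OF g[THEN mat_rep_hom(5)] ij(1,2)] sum4_def z)
  qed (rule H_gens_homog)
  then have *: "h \<in> carrier L" "mat_rep (gpart L q h) (i, j) = \<zero>\<^bsub>A\<^esub>" for q using ij by blast+
  have "mat_rep (gpart L 0 h \<oplus>\<^bsub>L\<^esub> gpart L 1 h) (i, j) = \<zero>\<^bsub>A\<^esub>"
    using * ij by (simp add: mat_rep_hom(2) mat_app)
  then show ?thesis using * by (simp add: L.gpart_decomp)
qed

lemma brow_ne_bcol: "r \<in> {1..6} \<Longrightarrow> brow r s \<noteq> bcol r t"
  by (erule six_cases) (auto simp: brow_def bcol_def class_rep_def)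

lemma mat_psi_H:
  assumes "x \<in> carrier L" "y \<in> carrier L" "x \<in> stH K A \<or> y \<in> stH K A"
  shows "mat_psi x y = \<zero>\<^bsub>W\<^esub>"
proof (rule W_eqI)
  fix r :: nat assume r: "r \<in> {1..6}"
  have pz: "parity_inv \<zero>\<^bsub>A\<^esub> = \<zero>\<^bsub>A\<^esub>" using parity_inv_homog[OF grade_zero, of 0] by simp
  have Rz: "rc_block r (mat_rep h) s t = \<zero>\<^bsub>S r\<^esub>" "rc_block_inv r (mat_rep h) s t = \<zero>\<^bsub>S r\<^esub>" if "h \<in> stH K A" for h s t
    using mat_rep_H[OF that brow_idx(1) brow_idx(2) brow_ne_bcol[OF r]] by (simp_all add: rc_block_def rc_block_inv_def pz)
  show "mat_psi x y r = \<zero>\<^bsub>W\<^esub> r"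
    using assms r mat_rep_hom(1)[of x] mat_rep_hom(1)[of y] block_rc_block[of "mat_rep x" r] block_rc_block[of "mat_rep y" r]
    by (auto simp: mat_psi_app block_psi_def S.polar_det_def Rz W_zero_app)
qed (use assms W_closed in simp_all)

sublocale mat_psi: super_cocycle K L W mat_psi by (rule super_cocycle_mat_psi)

lemma is_psi_mat_psi: "is_psi K A mat_psi"
  unfolding is_psi_def Let_def
proof (intro conjI ballI allI impI)
  fix i j k l p q a b
  assume *: "i \<in> idx" "j \<in> idx" "k \<in> idx" "l \<in> idx" "a \<in> grade A p" "b \<in> grade A q" "i \<noteq> j" "k \<noteq> l"
  have [simp]: "a \<otimes>\<^bsub>A\<^esub> b \<in> carrier A" using * by (auto dest: grade_carrier)
  show "mat_psi (F i j p a) (F k l q b) = (if \<not> distinct [i, j, k, l] then \<zero>\<^bsub>W\<^esub>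
         else if quad_theta (i, j, k, l) \<le> 4
              then Winj A (quad_theta (i, j, k, l)) (Wclass A (quad_theta (i, j, k, l)) (a \<otimes>\<^bsub>A\<^esub> b))
              else [(ksgn q * quad_sigma (i, j, k, l))] \<cdot>\<^bsub>W\<^esub>
                   Winj A (quad_theta (i, j, k, l)) (Wclass A (quad_theta (i, j, k, l)) (a \<otimes>\<^bsub>A\<^esub> b)))"
  proof (cases "distinct [i, j, k, l]")
    case True
    obtain r where r: "(i, j, k, l) \<in> quad_class r" using quad_class_ex * True by blast
    note r6 = quad_class_range[OF r] and th = quad_theta_eq[OF r]
    have Wc: "Winj A r (cl r (a \<otimes>\<^bsub>A\<^esub> b)) \<in> carrier W" using r6 by (simp add: Winj_closed)
    have "sg W e (Winj A r (cl r (a \<otimes>\<^bsub>A\<^esub> b))) = Winj A r (cl r (a \<otimes>\<^bsub>A\<^esub> b))" if "r \<le> 4" for e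
      using Wc that by (intro W_eqI) (simp_all add: W_sg_app Winj_app S_char2)
    then show ?thesis using True Wc by (simp add: mat_psi_F * th ksgn_sigma W.M.ksgn_pow)
  next
    case False
    then show ?thesis using mat_psi_F[OF *(1,2,7) *(3,4,8) *(5,6)]
      by (simp only: False if_True if_False not_False_eq_True)
  qed
qed (simp_all add: mat_psi.psi_add_left mat_psi.psi_add_right mat_psi.psi_smult_left mat_psi.psi_smult_right mat_psi_H)

text \<open>The spanning theorem is used in one argument at a time.\<close>

lemma is_psi_unique:
  assumes "is_psi K A \<psi>" "is_psi K A \<psi>'" and xy: "x \<in> carrier L" "y \<in> carrier L"
  shows "\<psi> x y = \<psi>' x y"
proof -
  have closed: "f x y \<in> carrier W" and lin: "f (x \<oplus>\<^bsub>L\<^esub> z) y = f x y \<oplus>\<^bsub>W\<^esub> f z y" "f y (x \<oplus>\<^bsub>L\<^esub> z) = f y x \<oplus>\<^bsub>W\<^esub> f y z"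
    "k \<in> carrier K \<Longrightarrow> f (k \<odot>\<^bsub>L\<^esub> x) y = k \<odot>\<^bsub>W\<^esub> f x y" "k \<in> carrier K \<Longrightarrow> f y (k \<odot>\<^bsub>L\<^esub> x) = k \<odot>\<^bsub>W\<^esub> f y x"
    if "is_psi K A f" "x \<in> carrier L" "y \<in> carrier L" "z \<in> carrier L" for f x y z k
    using that unfolding is_psi_def Let_def by simp_all
  have H: "f x y = \<zero>\<^bsub>W\<^esub>" if f: "is_psi K A f" and "x \<in> carrier L" "y \<in> carrier L" "x \<in> stH K A \<or> y \<in> stH K A" for f x y
  proof -
    have "\<forall>x\<in>carrier L. \<forall>y\<in>carrier L. x \<in> stH K A \<or> y \<in> stH K A \<longrightarrow> f x y = \<zero>\<^bsub>W\<^esub>"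
      using f unfolding is_psi_def Let_def by (elim conjE)
    then show ?thesis using that by blast
  qed
  let ?R = "\<lambda>i j k l q a b. if \<not> distinct [i, j, k, l] then \<zero>\<^bsub>W\<^esub>
       else if quad_theta (i, j, k, l) \<le> 4
            then Winj A (quad_theta (i, j, k, l)) (Wclass A (quad_theta (i, j, k, l)) (a \<otimes>\<^bsub>A\<^esub> b))
            else [(ksgn q * quad_sigma (i, j, k, l))] \<cdot>\<^bsub>W\<^esub>
                 Winj A (quad_theta (i, j, k, l)) (Wclass A (quad_theta (i, j, k, l)) (a \<otimes>\<^bsub>A\<^esub> b))"
  have val: "f (F i j p a) (F k l q b) = ?R i j k l q a b" if f: "is_psi K A f"
    and "i \<in> idx" "j \<in> idx" "i \<noteq> j" "a \<in> grade A p" "k \<in> idx" "l \<in> idx" "k \<noteq> l" "b \<in> grade A q" for f i j p a k l q b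
  proof -
    have "\<forall>i\<in>idx. \<forall>j\<in>idx. \<forall>k\<in>idx. \<forall>l\<in>idx. \<forall>p q. \<forall>a\<in>grade A p. \<forall>b\<in>grade A q.
        i \<noteq> j \<longrightarrow> k \<noteq> l \<longrightarrow> f (F i j p a) (F k l q b) = ?R i j k l q a b"
      using f unfolding is_psi_def Let_def by (elim conjE)
    from this[rule_format, OF that(2,3,6,7,5,9,4,8)] show ?thesis .
  qed
  have FF: "\<psi> (F i j p a) (F k l q b) = \<psi>' (F i j p a) (F k l q b)"
    if "i \<in> idx" "j \<in> idx" "i \<noteq> j" "a \<in> grade A p" "k \<in> idx" "l \<in> idx" "k \<noteq> l" "b \<in> grade A q" for i j p a k l q b
    using val[OF assms(1) that] val[OF assms(2) that] by (rule HOL.trans[OF _ HOL.sym])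
  have sub: "submodule {x \<in> carrier L. f x = g x} K L"
    if fg: "\<And>x y. \<lbrakk>x \<in> carrier L; y \<in> carrier L\<rbrakk> \<Longrightarrow> f (x \<oplus>\<^bsub>L\<^esub> y) = f x \<oplus>\<^bsub>W\<^esub> f y"
      "\<And>x y. \<lbrakk>x \<in> carrier L; y \<in> carrier L\<rbrakk> \<Longrightarrow> g (x \<oplus>\<^bsub>L\<^esub> y) = g x \<oplus>\<^bsub>W\<^esub> g y"
      "\<And>k x. \<lbrakk>k \<in> carrier K; x \<in> carrier L\<rbrakk> \<Longrightarrow> f (k \<odot>\<^bsub>L\<^esub> x) = k \<odot>\<^bsub>W\<^esub> f x"
      "\<And>k x. \<lbrakk>k \<in> carrier K; x \<in> carrier L\<rbrakk> \<Longrightarrow> g (k \<odot>\<^bsub>L\<^esub> x) = k \<odot>\<^bsub>W\<^esub> g x"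
      "\<And>x. x \<in> carrier L \<Longrightarrow> f x \<in> carrier W" "\<And>x. x \<in> carrier L \<Longrightarrow> g x \<in> carrier W" for f g
  proof (rule L.submoduleI)
    have "f \<zero>\<^bsub>L\<^esub> = \<zero>\<^bsub>W\<^esub>" "g \<zero>\<^bsub>L\<^esub> = \<zero>\<^bsub>W\<^esub>"
      using fg(3,4)[of "\<zero>\<^bsub>K\<^esub>" "\<zero>\<^bsub>L\<^esub>"] fg(5,6)[of "\<zero>\<^bsub>L\<^esub>"] by simp_all
    then show "\<zero>\<^bsub>L\<^esub> \<in> {x \<in> carrier L. f x = g x}" by simp
    show "\<ominus>\<^bsub>L\<^esub> x \<in> {x \<in> carrier L. f x = g x}" if "x \<in> {x \<in> carrier L. f x = g x}" for x
      using that fg(3,4)[of "\<ominus>\<^bsub>K\<^esub> \<one>\<^bsub>K\<^esub>" x] by (simp add: L.smult_l_minus)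
  qed (use fg in auto)
  have step: "\<psi> (F i j p a) y = \<psi>' (F i j p a) y" if ij: "i \<in> idx" "j \<in> idx" "i \<noteq> j" "a \<in> grade A p" and y: "y \<in> carrier L" for i j p a y
  proof -
    let ?N = "{y \<in> carrier L. \<psi> (F i j p a) y = \<psi>' (F i j p a) y}"
    have Fc: "F i j p a \<in> carrier L" using ij by simp
    have "carrier L \<subseteq> ?N"
    proof (rule st_span)
      show "submodule ?N K L"
        by (rule sub) (use Fc lin(2,4) closed assms(1,2) in auto)
      show "stH K A \<subseteq> ?N" using stH_carrier H[OF assms(1) Fc] H[OF assms(2) Fc] by auto
    qed (use FF ij in auto)
    then show ?thesis using y by blast
  qed
  let ?N = "{x \<in> carrier L. \<psi> x y = \<psi>' x y}"
  have "carrier L \<subseteq> ?N"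
  proof (rule st_span)
    show "submodule ?N K L"
      by (rule sub) (use xy(2) lin(1,3) closed assms(1,2) in auto)
    show "stH K A \<subseteq> ?N" using stH_carrier H[OF assms(1) _ xy(2)] H[OF assms(2) _ xy(2)] by auto
  qed (use step xy in auto)
  then show ?thesis using xy by blast
qed

abbreviation psi where "psi \<equiv> st_psi K A"

lemma psi_eq: "\<lbrakk>x \<in> carrier L; y \<in> carrier L\<rbrakk> \<Longrightarrow> psi x y = mat_psi x y"
  unfolding st_psi_def by (rule is_psi_unique[OF someI[of "is_psi K A", OF is_psi_mat_psi] is_psi_mat_psi])

text \<open>The map \<open>\<psi>\<close> is given by its defining properties. These fix its
  values on the carrier, and there it agrees with the matrix formula.\<close>

lemma super_cocycle_psi: "super_cocycle K L W psi"
proof (intro super_cocycle.intro L.lie_superalgebra_axioms graded_module_W super_cocycle_axioms.intro)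
  fix x y p q assume g: "x \<in> grade L p" "y \<in> grade L q"
  note c = g[THEN L.grade_carrier]
  show "psi x y \<in> grade W (p + q)" "psi x y = sg W (p * q + 1) (psi y x)"
    using mat_psi.psi_even[OF g] mat_psi.psi_skew[OF g] c by (simp_all add: psi_eq)
next
  fix x assume "x \<in> grade L 0"
  then show "psi x x = \<zero>\<^bsub>W\<^esub>" using mat_psi.psi_alternating L.grade_carrier by (simp add: psi_eq)
next
  fix x y z p q r assume g: "x \<in> grade L p" "y \<in> grade L q" "z \<in> grade L r"
  show "sg W (p * r) (psi (bracket L x y) z) \<oplus>\<^bsub>W\<^esub> sg W (p * q) (psi (bracket L y z) x) \<oplus>\<^bsub>W\<^esub>
      sg W (q * r) (psi (bracket L z x) y) = \<zero>\<^bsub>W\<^esub>"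
    using mat_psi.psi_cocycle[OF g] g[THEN L.grade_carrier] by (simp add: psi_eq)
qed (simp_all add: psi_eq mat_psi.psi_add_left mat_psi.psi_add_right mat_psi.psi_smult_left mat_psi.psi_smult_right)

sublocale E: super_cocycle K L W psi by (rule super_cocycle_psi)

lemma sharp_eq: "st22_sharp K A = cocycle_ext L W psi"
  by (simp add: st22_sharp_def cocycle_ext_def Let_def)

lemma psi_F:
  assumes "i \<in> idx" "j \<in> idx" "i \<noteq> j" "k \<in> idx" "l \<in> idx" "k \<noteq> l" "a \<in> grade A p" "b \<in> grade A q"
  shows "psi (F i j p a) (F k l q b) = (if distinct [i, j, k, l] then
      sg W (q + sigma_bit (i, j, k, l)) (Winj A (quad_theta (i, j, k, l)) (cl (quad_theta (i, j, k, l)) (a \<otimes>\<^bsub>A\<^esub> b)))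
    else \<zero>\<^bsub>W\<^esub>)"
  using assms by (simp add: psi_eq mat_psi_F del: distinct.simps)

end

section \<open>Brackets in an arbitrary central extension\<close>

locale st_central_extension = super_W K A + X: lie_superalgebra K M
  for K :: "('k, 'y) ring_scheme" and A :: "('k, 'a, 'z) supermodule_scheme"
    and M :: "('k, 'n, 'z2) supermodule_scheme" +
  fixes \<tau> :: "'n \<Rightarrow> ('k, 'a) st_elem"
  assumes tau_hom: "\<tau> \<in> lie_super_hom K M L" and tau_surj: "\<tau> ` carrier M = carrier L"
    and tau_ker: "\<lbrakk>m \<in> carrier M; \<tau> m = \<zero>\<^bsub>L\<^esub>\<rbrakk> \<Longrightarrow> m \<in> lie_center M"
begin

lemmas tau = lie_super_homD[OF tau_hom]

definition lift where "lift x = (SOME m. m \<in> carrier M \<and> \<tau> m = x)"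

lemma lift:
  assumes "x \<in> carrier L" shows "lift x \<in> carrier M" "\<tau> (lift x) = x"
proof -
  have "\<exists>m. m \<in> carrier M \<and> \<tau> m = x" using assms tau_surj by (metis imageE)
  from someI_ex[OF this] show "lift x \<in> carrier M" "\<tau> (lift x) = x" unfolding lift_def by blast+
qed

definition beta where "beta x y = bracket M (lift x) (lift y)"

lemma tau_minus: "m \<in> carrier M \<Longrightarrow> \<tau> (\<ominus>\<^bsub>M\<^esub> m) = \<ominus>\<^bsub>L\<^esub> \<tau> m"
  using tau(3)[of "\<ominus>\<^bsub>K\<^esub> \<one>\<^bsub>K\<^esub>" m] tau(1)[of m] by (simp add: X.smult_l_minus L.smult_l_minus)

lemma tau_zero: "\<tau> \<zero>\<^bsub>M\<^esub> = \<zero>\<^bsub>L\<^esub>"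
  using tau(3)[of "\<zero>\<^bsub>K\<^esub>" "\<zero>\<^bsub>M\<^esub>"] tau(1)[of "\<zero>\<^bsub>M\<^esub>"] by simp

lemma same_tau:
  assumes "m \<in> carrier M" "n \<in> carrier M" "\<tau> m = \<tau> n" shows "m \<ominus>\<^bsub>M\<^esub> n \<in> lie_center M"
  using assms tau(1)[of n] by (intro tau_ker) (simp_all add: a_minus_def tau(2) tau_minus L.M.r_neg)

text \<open>Two lifts of an element differ by an element of the kernel, which is central.\<close>

lemma beta_eq:
  assumes "m \<in> carrier M" "n \<in> carrier M"
  shows "bracket M m n = beta (\<tau> m) (\<tau> n)"
  unfolding beta_def using assms lift[OF tau(1)[OF assms(1)]] lift[OF tau(1)[OF assms(2)]]
  by (intro X.bracket_mod_center same_tau) simp_all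

lemma beta_closed [simp]: "\<lbrakk>x \<in> carrier L; y \<in> carrier L\<rbrakk> \<Longrightarrow> beta x y \<in> carrier M"
  by (simp add: beta_def lift)

lemma tau_beta: "\<lbrakk>x \<in> carrier L; y \<in> carrier L\<rbrakk> \<Longrightarrow> \<tau> (beta x y) = bracket L x y"
  by (simp add: beta_def lift tau(4))

lemma beta_add_left:
  assumes "x \<in> carrier L" "y \<in> carrier L" "z \<in> carrier L"
  shows "beta (x \<oplus>\<^bsub>L\<^esub> y) z = beta x z \<oplus>\<^bsub>M\<^esub> beta y z"
  using assms beta_eq[of "lift x \<oplus>\<^bsub>M\<^esub> lift y" "lift z"]
  by (simp add: lift tau(2) X.bracket_add_left beta_def[of x z] beta_def[of y z])

lemma beta_smult_left:
  assumes "k \<in> carrier K" "x \<in> carrier L" "z \<in> carrier L"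
  shows "beta (k \<odot>\<^bsub>L\<^esub> x) z = k \<odot>\<^bsub>M\<^esub> beta x z"
  using assms beta_eq[of "k \<odot>\<^bsub>M\<^esub> lift x" "lift z"]
  by (simp add: lift tau(3) X.bracket_smult_left beta_def[of x z])

lemma beta_zero [simp]: "x \<in> carrier L \<Longrightarrow> beta \<zero>\<^bsub>L\<^esub> x = \<zero>\<^bsub>M\<^esub>" "x \<in> carrier L \<Longrightarrow> beta x \<zero>\<^bsub>L\<^esub> = \<zero>\<^bsub>M\<^esub>"
proof -
  show "x \<in> carrier L \<Longrightarrow> beta \<zero>\<^bsub>L\<^esub> x = \<zero>\<^bsub>M\<^esub>" using beta_eq[of "\<zero>\<^bsub>M\<^esub>" "lift x"] by (simp add: lift tau_zero)
  show "x \<in> carrier L \<Longrightarrow> beta x \<zero>\<^bsub>L\<^esub> = \<zero>\<^bsub>M\<^esub>" using beta_eq[of "lift x" "\<zero>\<^bsub>M\<^esub>"] by (simp add: lift tau_zero)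
qed

lemma homog_lift:
  assumes x: "x \<in> grade L p" obtains m where "m \<in> grade M p" "\<tau> m = x"
proof -
  note xc = L.grade_carrier[OF x] 
  note l = lift[OF xc]
  have "x = \<tau> (gpart M p (lift x)) \<oplus>\<^bsub>L\<^esub> \<tau> (gpart M (p + 1) (lift x))"
    using l by (simp add: X.gpart_decomp' flip: tau(2))
  then have "gpart L p x = \<tau> (gpart M p (lift x))"
    using l by (intro L.gpart_unique[where z = "\<tau> (gpart M (p + 1) (lift x))"] tau(5)) simp_all
  then have "\<tau> (gpart M p (lift x)) = x" using L.gpart_homog[OF x, of p] by simp
  with X.gpart_grade[OF l(1)] show thesis by (rule that)
qed

lemma beta_even: "\<lbrakk>x \<in> grade L p; y \<in> grade L q\<rbrakk> \<Longrightarrow> beta x y \<in> grade M (p + q)"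
  by (elim homog_lift) (metis X.bracket_even X.grade_carrier beta_eq)

lemma beta_skew:
  assumes "x \<in> grade L p" "y \<in> grade L q" shows "beta x y = sg M (p * q + 1) (beta y x)"
proof -
  obtain m n where m: "m \<in> grade M p" "\<tau> m = x" and n: "n \<in> grade M q" "\<tau> n = y"
    using homog_lift[OF assms(1)] homog_lift[OF assms(2)] by metis
  then show ?thesis
    using X.skew[OF m(1) n(1)] beta_eq[of m n] beta_eq[of n m] m(1)[THEN X.grade_carrier] n(1)[THEN X.grade_carrier] by simp
qed

text \<open>A bracket of lifts is a lift of the bracket, so the Jacobi identity of the extension
  becomes a cocycle identity for \<open>beta\<close>.\<close>

lemma beta_jacobi:
  assumes "x \<in> grade L p" "y \<in> grade L q" "z \<in> grade L r"
  shows "beta (bracket L x y) z = beta x (bracket L y z) \<oplus>\<^bsub>M\<^esub> sg M (p * q + 1) (beta y (bracket L x z))"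
proof -
  obtain m where m: "m \<in> grade M p" "\<tau> m = x" using homog_lift[OF assms(1)] .
  obtain n where n: "n \<in> grade M q" "\<tau> n = y" using homog_lift[OF assms(2)] .
  obtain u where u: "u \<in> grade M r" "\<tau> u = z" using homog_lift[OF assms(3)] .
  note c = m(1)[THEN X.grade_carrier] n(1)[THEN X.grade_carrier] u(1)[THEN X.grade_carrier]
  show ?thesis
    using X.jacobi_deriv[OF m(1) n(1) u(1)] c beta_eq[of "bracket M m n" u] beta_eq[of m "bracket M n u"]
      beta_eq[of n "bracket M m u"] m n u by (simp add: tau(4))
qed

lemma beta_jacobi':
  assumes "x \<in> grade L p" "y \<in> grade L q" "z \<in> grade L r"
  shows "beta x (bracket L y z) = beta (bracket L x y) z \<oplus>\<^bsub>M\<^esub> sg M (p * q) (beta y (bracket L x z))"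
proof -
  note c[simp] = assms[THEN L.grade_carrier]
  have "beta (bracket L x y) z \<oplus>\<^bsub>M\<^esub> sg M (p * q) (beta y (bracket L x z)) =
    beta x (bracket L y z) \<oplus>\<^bsub>M\<^esub> (sg M (p * q) (beta y (bracket L x z)) \<oplus>\<^bsub>M\<^esub> sg M (p * q + 1) (beta y (bracket L x z)))"
    unfolding beta_jacobi[OF assms] by (simp add: X.M.a_ac)
  then show ?thesis by (simp add: X.sg_cancel)
qed

subsection \<open>Root elements\<close>

lemma fourth_index:
  assumes "i \<in> idx" "j \<in> idx" "k \<in> idx" obtains m where "m \<in> idx" "m \<noteq> i" "m \<noteq> j" "m \<noteq> k"
proof -
  have "card {i, j, k} < card idx" by (rule le_less_trans[of _ 3]) (auto simp: card_insert_if)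
  then have "\<not> idx \<subseteq> {i, j, k}" using card_mono[of "{i, j, k}" idx] by auto
  then show thesis using that by blast
qed

lemma one_grade [simp]: "\<one>\<^bsub>A\<^esub> \<in> grade A 0"
  by (rule one_even)

lemma F_split:
  assumes "i \<in> idx" "j \<in> idx" "m \<in> idx" "i \<noteq> j" "m \<noteq> i" "m \<noteq> j" "a \<in> grade A p"
  shows "bracket L (F i m p a) (F m j 0 \<one>\<^bsub>A\<^esub>) = F i j p a" "bracket L (F i m 0 \<one>\<^bsub>A\<^esub>) (F m j p a) = F i j p a"
  using assms grade_carrier[OF assms(7)] by (simp_all add: F_chain)

text \<open>As the four indices take at most three values, the first argument can be written as a
  bracket through an index outside all of them, and both factors annihilate the second
  argument.\<close>

lemma beta_F_zero:
  assumes ij: "i \<in> idx" "j \<in> idx" "i \<noteq> j" "a \<in> grade A p" and kl: "k \<in> idx" "l \<in> idx" "k \<noteq> l" "b \<in> grade A q"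
    and ne: "j \<noteq> k" "i \<noteq> l" and eq: "i = k \<or> j = l"
  shows "beta (F i j p a) (F k l q b) = \<zero>\<^bsub>M\<^esub>"
proof -
  obtain m where m: "m \<in> idx" "m \<noteq> i" "m \<noteq> j" "m \<noteq> k" "m \<noteq> l"
    using fourth_index[of i j k] fourth_index[of i j l] ij kl eq by metis
  have g: "F i m p a \<in> grade L (ipar i + ipar m + p)" "F m j 0 \<one>\<^bsub>A\<^esub> \<in> grade L (ipar m + ipar j + 0)"
     "F k l q b \<in> grade L (ipar k + ipar l + q)"
    by (rule F_grade; use ij kl m in auto)+
  have z: "bracket L (F m j 0 \<one>\<^bsub>A\<^esub>) (F k l q b) = \<zero>\<^bsub>L\<^esub>" "bracket L (F i m p a) (F k l q b) = \<zero>\<^bsub>L\<^esub>"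
    by (rule F_bracket_zero; use ij kl m ne in auto)+
  show ?thesis
    using beta_jacobi[OF g] F_split(1)[of i j m a p] ij m g[THEN L.grade_carrier] by (simp add: z)
qed

text \<open>Splitting the first factor through \<open>l\<close> moves the middle index from
  \<open>k\<close> to \<open>l\<close>.\<close>

lemma beta_mid:
  assumes d: "i \<in> idx" "j \<in> idx" "k \<in> idx" "l \<in> idx" "distinct [i, j, k, l]" and ab: "a \<in> grade A p" "b \<in> grade A q"
  shows "beta (F i k p a) (F k j q b) = beta (F i l p a) (F l j q b)"
proof -
  have g: "F i l p a \<in> grade L (ipar i + ipar l + p)" "F l k 0 \<one>\<^bsub>A\<^esub> \<in> grade L (ipar l + ipar k + 0)"
     "F k j q b \<in> grade L (ipar k + ipar j + q)"
    by (rule F_grade; use d ab in auto)+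
  have z: "bracket L (F i l p a) (F k j q b) = \<zero>\<^bsub>L\<^esub>" by (rule F_bracket_zero; use d ab in auto)
  show ?thesis
    using beta_jacobi[OF g] F_split(1)[of i k l a p] F_split(2)[of l j k b q] d ab g[THEN L.grade_carrier] by (simp add: z)
qed

text \<open>Splitting the second factor through \<open>l\<close> instead collects the product
  \<open>a b\<close> in the first factor.\<close>

lemma beta_assoc:
  assumes d: "i \<in> idx" "j \<in> idx" "k \<in> idx" "l \<in> idx" "distinct [i, j, k, l]" and ab: "a \<in> grade A p" "b \<in> grade A q"
  shows "beta (F i k p a) (F k j q b) = beta (F i l (p + q) (a \<otimes>\<^bsub>A\<^esub> b)) (F l j 0 \<one>\<^bsub>A\<^esub>)"
proof -
  have g: "F i k p a \<in> grade L (ipar i + ipar k + p)" "F k l q b \<in> grade L (ipar k + ipar l + q)"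
     "F l j 0 \<one>\<^bsub>A\<^esub> \<in> grade L (ipar l + ipar j + 0)"
    by (rule F_grade; use d ab in auto)+
  have z: "bracket L (F i k p a) (F l j 0 \<one>\<^bsub>A\<^esub>) = \<zero>\<^bsub>L\<^esub>" by (rule F_bracket_zero; use d ab in auto)
  have "bracket L (F i k p a) (F k l q b) = F i l (p + q) (a \<otimes>\<^bsub>A\<^esub> b)" by (rule F_chain) (use d ab in auto)
  then show ?thesis
    using beta_jacobi'[OF g] F_split(1)[of k j l b q] d ab g[THEN L.grade_carrier] by (simp add: z mult_even)
qed

text \<open>A canonical lift of \<open>F\<^sub>i\<^sub>j(a)\<close>; the choice of the middle
  index turns out to be immaterial.\<close>

definition root_lift :: "nat \<Rightarrow> nat \<Rightarrow> bit \<Rightarrow> 'a \<Rightarrow> 'n"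
  where "root_lift i j p a = (let k = (SOME k. k \<in> idx \<and> k \<noteq> i \<and> k \<noteq> j) in beta (F i k p a) (F k j 0 \<one>\<^bsub>A\<^esub>))"

lemma beta_root_lift:
  assumes d: "i \<in> idx" "j \<in> idx" "k \<in> idx" "distinct [i, j, k]" and ab: "a \<in> grade A p" "b \<in> grade A q"
  shows "beta (F i k p a) (F k j q b) = root_lift i j (p + q) (a \<otimes>\<^bsub>A\<^esub> b)"
proof -
  define m where "m = (SOME k. k \<in> idx \<and> k \<noteq> i \<and> k \<noteq> j)"
  have "\<exists>k. k \<in> idx \<and> k \<noteq> i \<and> k \<noteq> j" using d by auto
  from someI_ex[OF this] have m: "m \<in> idx" "m \<noteq> i" "m \<noteq> j" unfolding m_def by auto
  have "beta (F i k p a) (F k j q b) = beta (F i m (p + q) (a \<otimes>\<^bsub>A\<^esub> b)) (F m j 0 \<one>\<^bsub>A\<^esub>)"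
  proof (cases "m = k")
    case False
    then show ?thesis using beta_assoc[of i j k m] m d ab by simp
  next
    case True
    \<comment> \<open>If the chosen index is \<open>k\<close> itself, the product is collected by a detour through the fourth index.\<close>
    obtain n where n: "n \<in> idx" "n \<noteq> i" "n \<noteq> j" "n \<noteq> k" using fourth_index d(1-3) by blast
    have "beta (F i k p a) (F k j q b) = beta (F i n (p + q) (a \<otimes>\<^bsub>A\<^esub> b)) (F n j 0 \<one>\<^bsub>A\<^esub>)"
      using beta_assoc[of i j k n] n d ab by simp
    also have "\<dots> = beta (F i k (p + q) (a \<otimes>\<^bsub>A\<^esub> b)) (F k j 0 \<one>\<^bsub>A\<^esub>)"
      using beta_mid[of i j n k] n d mult_even[OF ab] by simp
    finally show ?thesis using True by simp
  qed
  then show ?thesis by (simp add: root_lift_def m_def Let_def)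
qed

lemma root_lift_eq:
  assumes "i \<in> idx" "j \<in> idx" "k \<in> idx" "distinct [i, j, k]" "a \<in> grade A p"
  shows "root_lift i j p a = beta (F i k p a) (F k j 0 \<one>\<^bsub>A\<^esub>)"
  using beta_root_lift[OF assms(1-4,5) one_grade] grade_carrier[OF assms(5)] by simp

lemma root_lift_grade:
  assumes "i \<in> idx" "j \<in> idx" "i \<noteq> j" "a \<in> grade A p"
  shows "root_lift i j p a \<in> grade M (ipar i + ipar j + p)"
proof -
  obtain k where k: "k \<in> idx" "k \<noteq> i" "k \<noteq> j" using third_index assms(1,2) by blast
  have "beta (F i k p a) (F k j 0 \<one>\<^bsub>A\<^esub>) \<in> grade M ((ipar i + ipar k + p) + (ipar k + ipar j + 0))"
    using assms k by (intro beta_even F_grade) auto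
  also have "(ipar i + ipar k + p) + (ipar k + ipar j + 0) = ipar i + ipar j + p"
    by (cases "ipar k") (simp_all add: ac_simps)
  finally show ?thesis using root_lift_eq[of i j k a p] assms k by simp
qed

lemma root_lift_closed [simp]: "\<lbrakk>i \<in> idx; j \<in> idx; i \<noteq> j; a \<in> grade A p\<rbrakk> \<Longrightarrow> root_lift i j p a \<in> carrier M"
  using root_lift_grade X.grade_carrier by blast

lemma tau_root_lift:
  assumes "i \<in> idx" "j \<in> idx" "i \<noteq> j" "a \<in> grade A p" shows "\<tau> (root_lift i j p a) = F i j p a"
proof -
  obtain k where k: "k \<in> idx" "k \<noteq> i" "k \<noteq> j" using third_index assms(1,2) by blast
  show ?thesis using root_lift_eq[of i j k a p] assms k F_split(1)[of i j k a p] by (simp add: tau_beta)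
qed

lemma root_lift_linear:
  assumes ij: "i \<in> idx" "j \<in> idx" "i \<noteq> j" and a: "a \<in> grade A p"
  shows "b \<in> grade A p \<Longrightarrow> root_lift i j p (a \<oplus>\<^bsub>A\<^esub> b) = root_lift i j p a \<oplus>\<^bsub>M\<^esub> root_lift i j p b"
    and "k \<in> carrier K \<Longrightarrow> root_lift i j p (k \<odot>\<^bsub>A\<^esub> a) = k \<odot>\<^bsub>M\<^esub> root_lift i j p a"
proof -
  obtain m where m: "m \<in> idx" "m \<noteq> i" "m \<noteq> j" using third_index ij(1,2) by blast
  have r: "root_lift i j p a = beta (F i m p a) (F m j 0 \<one>\<^bsub>A\<^esub>)" if "a \<in> grade A p" for a
    using root_lift_eq[of i j m a p] ij m that by simp
  show "b \<in> grade A p \<Longrightarrow> root_lift i j p (a \<oplus>\<^bsub>A\<^esub> b) = root_lift i j p a \<oplus>\<^bsub>M\<^esub> root_lift i j p b"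
    using ij m a by (simp add: r F_add beta_add_left)
  show "k \<in> carrier K \<Longrightarrow> root_lift i j p (k \<odot>\<^bsub>A\<^esub> a) = k \<odot>\<^bsub>M\<^esub> root_lift i j p a"
    using ij m a by (simp add: r F_smult beta_smult_left)
qed

subsection \<open>Brackets of root elements with four distinct indices\<close>

text \<open>The obstruction: the one bracket of root elements that vanishes in the Steinberg Lie
  superalgebra and need not vanish for the lifts.\<close>

definition quad_bracket :: "nat \<Rightarrow> nat \<Rightarrow> nat \<Rightarrow> nat \<Rightarrow> bit \<Rightarrow> 'a \<Rightarrow> 'n"
  where "quad_bracket i j k l p a = beta (F i j p a) (F k l 0 \<one>\<^bsub>A\<^esub>)"

abbreviation quad where "quad i j k l \<equiv> i \<in> idx \<and> j \<in> idx \<and> k \<in> idx \<and> l \<in> idx \<and> distinct [i, j, k, l]"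

lemma quad_bracket_closed [simp]: "\<lbrakk>quad i j k l; a \<in> grade A p\<rbrakk> \<Longrightarrow> quad_bracket i j k l p a \<in> carrier M"
  by (simp add: quad_bracket_def)

text \<open>Splitting the first argument through \<open>k\<close> exchanges the first indices of
  the two arguments and carries \<open>a\<close> over to \<open>c\<close>.\<close>

lemma beta_row_swap:
  assumes q: "quad i j k l" and abc: "a \<in> grade A p" "b \<in> grade A q" "c \<in> grade A s"
  shows "beta (F i j (p + q) (a \<otimes>\<^bsub>A\<^esub> b)) (F k l s c) =
    sg M ((ipar i + ipar k + p) * (ipar k + ipar j + q) + 1) (beta (F k j q b) (F i l (p + s) (a \<otimes>\<^bsub>A\<^esub> c)))"
proof -
  have g: "F i k p a \<in> grade L (ipar i + ipar k + p)" "F k j q b \<in> grade L (ipar k + ipar j + q)"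
     "F k l s c \<in> grade L (ipar k + ipar l + s)"
    by (rule F_grade; use q abc in auto)+
  have z: "bracket L (F k j q b) (F k l s c) = \<zero>\<^bsub>L\<^esub>" by (rule F_bracket_zero; use q abc in auto)
  have e: "bracket L (F i k p a) (F k j q b) = F i j (p + q) (a \<otimes>\<^bsub>A\<^esub> b)"
    "bracket L (F i k p a) (F k l s c) = F i l (p + s) (a \<otimes>\<^bsub>A\<^esub> c)"
    using q abc by (simp_all add: F_chain)
  show ?thesis
    using beta_jacobi[OF g] q abc g[THEN L.grade_carrier] by (simp add: z e mult_even)
qed

text \<open>An exchange of rows followed by skew-symmetry.\<close>

lemma beta_col_swap:
  assumes q: "quad i j k l" and ab: "a \<in> grade A p" "b \<in> grade A q"
  shows "beta (F i j p a) (F k l q b) = sg M ((ipar j + ipar k) * (ipar k + ipar l + q)) (quad_bracket i l k j (p + q) (a \<otimes>\<^bsub>A\<^esub> b))"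
proof -
  have ac: "a \<in> carrier A" using ab by (auto dest: grade_carrier)
  have "beta (F i j p a) (F k l q b) = sg M ((ipar i + ipar k + p) * (ipar k + ipar j) + 1) (beta (F k j 0 \<one>\<^bsub>A\<^esub>) (F i l (p + q) (a \<otimes>\<^bsub>A\<^esub> b)))"
    using beta_row_swap[OF q ab(1) one_grade ab(2)] ac by simp
  also have "beta (F k j 0 \<one>\<^bsub>A\<^esub>) (F i l (p + q) (a \<otimes>\<^bsub>A\<^esub> b)) =
    sg M ((ipar k + ipar j + 0) * (ipar i + ipar l + (p + q)) + 1) (beta (F i l (p + q) (a \<otimes>\<^bsub>A\<^esub> b)) (F k j 0 \<one>\<^bsub>A\<^esub>))"
    using q ab by (intro beta_skew F_grade) (auto intro: mult_even)
  finally have "beta (F i j p a) (F k l q b) = sg M (((ipar i + ipar k + p) * (ipar k + ipar j) + 1) +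
      ((ipar k + ipar j + 0) * (ipar i + ipar l + (p + q)) + 1)) (quad_bracket i l k j (p + q) (a \<otimes>\<^bsub>A\<^esub> b))"
    using q ab by (simp add: quad_bracket_def mult_even)
  also have "((ipar i + ipar k + p) * (ipar k + ipar j) + 1) + ((ipar k + ipar j + 0) * (ipar i + ipar l + (p + q)) + 1) =
      (ipar j + ipar k) * (ipar k + ipar l + q)"
    by (cases "ipar i"; cases "ipar j"; cases "ipar k"; cases "ipar l"; cases p; cases q; simp)
  finally show ?thesis .
qed

lemma quad_bracket_col_swap:
  assumes q: "quad i j k l" and a: "a \<in> grade A p"
  shows "quad_bracket i j k l p a = sg M ((ipar j + ipar k) * (ipar k + ipar l)) (quad_bracket i l k j p a)"
  using beta_col_swap[OF q a one_grade] grade_carrier[OF a] by (simp add: quad_bracket_def)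

text \<open>Exchanging the columns twice returns to the same indices, with \<open>b\<close> moved
  into the first argument.\<close>

lemma beta_quad_bracket:
  assumes q: "quad i j k l" and ab: "a \<in> grade A p" "b \<in> grade A q"
  shows "beta (F i j p a) (F k l q b) = sg M ((ipar j + ipar k) * q) (quad_bracket i j k l (p + q) (a \<otimes>\<^bsub>A\<^esub> b))"
proof -
  have q': "quad i l k j" using q by auto
  have "beta (F i j p a) (F k l q b) = sg M ((ipar j + ipar k) * (ipar k + ipar l + q) + (ipar l + ipar k) * (ipar k + ipar j))
     (quad_bracket i j k l (p + q) (a \<otimes>\<^bsub>A\<^esub> b))"
    using beta_col_swap[OF q ab] quad_bracket_col_swap[OF q' mult_even[OF ab]] quad_bracket_closed[OF q mult_even[OF ab]] by simp
  also have "(ipar j + ipar k) * (ipar k + ipar l + q) + (ipar l + ipar k) * (ipar k + ipar j) = (ipar j + ipar k) * q"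
    by (cases "ipar j"; cases "ipar k"; cases "ipar l"; cases q; simp)
  finally show ?thesis .
qed

lemma quad_bracket_row_swap:
  assumes q: "quad i j k l" and b: "b \<in> grade A p"
  shows "quad_bracket i j k l p b = sg M ((ipar i + ipar k) * (ipar k + ipar j + p) + 1) (quad_bracket k j i l p b)"
  using beta_row_swap[OF q one_grade b one_grade] grade_carrier[OF b] by (simp add: quad_bracket_def)

text \<open>Exchanging the rows twice gives the same element back with the sign
  \<open>(-1)\<close> to the power \<open>|i| + |k|\<close>. For rows of different parity the
  element is therefore killed by 2.\<close>

lemma quad_bracket_torsion:
  assumes q: "quad i j k l" and b: "b \<in> grade A p"
  shows "quad_bracket i j k l p b = sg M (ipar i + ipar k) (quad_bracket i j k l p b)"
proof -
  have q': "quad k j i l" using q by auto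
  have "quad_bracket i j k l p b = sg M (((ipar i + ipar k) * (ipar k + ipar j + p) + 1) + ((ipar k + ipar i) * (ipar i + ipar j + p) + 1)) (quad_bracket i j k l p b)"
    using quad_bracket_row_swap[OF q b] quad_bracket_row_swap[OF q' b] quad_bracket_closed[OF q b] by (metis X.sg_sg)
  also have "((ipar i + ipar k) * (ipar k + ipar j + p) + 1) + ((ipar k + ipar i) * (ipar i + ipar j + p) + 1) = ipar i + ipar k"
    by (cases "ipar i"; cases "ipar j"; cases "ipar k"; cases p; simp)
  finally show ?thesis .
qed

text \<open>The bracket of \<open>F\<^sub>i\<^sub>j(a b)\<close> with
  \<open>F\<^sub>k\<^sub>l(c)\<close> is computed twice: directly, and after an exchange of rows
  that brings \<open>b\<close> in front of \<open>a\<close>.\<close>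

lemma quad_bracket_trace:
  assumes q: "quad i j k l" and abc: "a \<in> grade A p" "b \<in> grade A q" "c \<in> grade A s"
  shows "quad_bracket i j k l (p + q + s) (a \<otimes>\<^bsub>A\<^esub> b \<otimes>\<^bsub>A\<^esub> c) = sg M (p * q) (quad_bracket i j k l (p + q + s) (b \<otimes>\<^bsub>A\<^esub> a \<otimes>\<^bsub>A\<^esub> c))"
proof -
  have q': "quad k j i l" using q by auto
  note [simp] = abc[THEN grade_carrier]
  have m: "b \<otimes>\<^bsub>A\<^esub> (a \<otimes>\<^bsub>A\<^esub> c) \<in> grade A (p + q + s)" "a \<otimes>\<^bsub>A\<^esub> b \<otimes>\<^bsub>A\<^esub> c \<in> grade A (p + q + s)"
    using mult_even[OF abc(2) mult_even[OF abc(1,3)]] mult_even[OF mult_even[OF abc(1,2)] abc(3)] by (simp_all add: ac_simps)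
  note [simp] = quad_bracket_closed[OF q m(1)] quad_bracket_closed[OF q m(2)] quad_bracket_closed[OF q' m(1)]
  have "sg M ((ipar j + ipar k) * s) (quad_bracket i j k l (p + q + s) (a \<otimes>\<^bsub>A\<^esub> b \<otimes>\<^bsub>A\<^esub> c)) = beta (F i j (p + q) (a \<otimes>\<^bsub>A\<^esub> b)) (F k l s c)"
    using beta_quad_bracket[OF q mult_even[OF abc(1,2)] abc(3)] by simp
  also have "\<dots> = sg M ((ipar i + ipar k + p) * (ipar k + ipar j + q) + 1) (beta (F k j q b) (F i l (p + s) (a \<otimes>\<^bsub>A\<^esub> c)))"
    by (rule beta_row_swap[OF q abc])
  also have "beta (F k j q b) (F i l (p + s) (a \<otimes>\<^bsub>A\<^esub> c)) = sg M ((ipar j + ipar i) * (p + s)) (quad_bracket k j i l (p + q + s) (b \<otimes>\<^bsub>A\<^esub> (a \<otimes>\<^bsub>A\<^esub> c)))"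
    using beta_quad_bracket[OF q' abc(2) mult_even[OF abc(1,3)]] by (simp add: ac_simps)
  also have "quad_bracket k j i l (p + q + s) (b \<otimes>\<^bsub>A\<^esub> (a \<otimes>\<^bsub>A\<^esub> c)) =
      sg M ((ipar k + ipar i) * (ipar i + ipar j + (p + q + s)) + 1) (quad_bracket i j k l (p + q + s) (b \<otimes>\<^bsub>A\<^esub> (a \<otimes>\<^bsub>A\<^esub> c)))"
    by (rule quad_bracket_row_swap[OF q' m(1)])
  finally have "quad_bracket i j k l (p + q + s) (a \<otimes>\<^bsub>A\<^esub> b \<otimes>\<^bsub>A\<^esub> c) = sg M ((ipar j + ipar k) * s + (((ipar i + ipar k + p) * (ipar k + ipar j + q) + 1) +
      ((ipar j + ipar i) * (p + s) + ((ipar k + ipar i) * (ipar i + ipar j + (p + q + s)) + 1))))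
      (quad_bracket i j k l (p + q + s) (b \<otimes>\<^bsub>A\<^esub> (a \<otimes>\<^bsub>A\<^esub> c)))"
    by (simp add: X.sg_eq_iff)
  also have "(ipar j + ipar k) * s + (((ipar i + ipar k + p) * (ipar k + ipar j + q) + 1) +
      ((ipar j + ipar i) * (p + s) + ((ipar k + ipar i) * (ipar i + ipar j + (p + q + s)) + 1))) = p * q + (ipar i + ipar k)"
    by (cases "ipar i"; cases "ipar j"; cases "ipar k"; cases p; cases q; cases s; simp)
  also have "sg M (p * q + (ipar i + ipar k)) (quad_bracket i j k l (p + q + s) (b \<otimes>\<^bsub>A\<^esub> (a \<otimes>\<^bsub>A\<^esub> c))) = sg M (p * q) (quad_bracket i j k l (p + q + s) (b \<otimes>\<^bsub>A\<^esub> (a \<otimes>\<^bsub>A\<^esub> c)))"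
  proof -
    have "quad_bracket i j k l (p + q + s) (b \<otimes>\<^bsub>A\<^esub> (a \<otimes>\<^bsub>A\<^esub> c)) = sg M (ipar i + ipar k) (quad_bracket i j k l (p + q + s) (b \<otimes>\<^bsub>A\<^esub> (a \<otimes>\<^bsub>A\<^esub> c)))"
      by (rule quad_bracket_torsion[OF q m(1)])
    then show ?thesis by (metis X.sg_sg \<open>quad_bracket i j k l (p + q + s) (b \<otimes>\<^bsub>A\<^esub> (a \<otimes>\<^bsub>A\<^esub> c)) \<in> carrier M\<close>)
  qed
  finally show ?thesis by (simp add: m_assoc)
qed

end

context st_central_extension
begin

text \<open>The obstruction for the representative of the \<open>r\<close>-th class, extended from
  homogeneous elements to all of \<open>A\<close>.\<close>

definition quad_inv :: "nat \<Rightarrow> 'a \<Rightarrow> 'n" where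
  "quad_inv r a = (case class_rep r of (i, j, k, l) \<Rightarrow> quad_bracket i j k l 0 (gpart A 0 a) \<oplus>\<^bsub>M\<^esub> quad_bracket i j k l 1 (gpart A 1 a))"

lemma class_rep_quad: "case class_rep r of (i, j, k, l) \<Rightarrow> quad i j k l"
  by (simp add: class_rep_def)

lemma quad_bracket_linear:
  assumes q: "quad i j k l" and a: "a \<in> grade A p"
  shows "b \<in> grade A p \<Longrightarrow> quad_bracket i j k l p (a \<oplus>\<^bsub>A\<^esub> b) = quad_bracket i j k l p a \<oplus>\<^bsub>M\<^esub> quad_bracket i j k l p b"
    and "c \<in> carrier K \<Longrightarrow> quad_bracket i j k l p (c \<odot>\<^bsub>A\<^esub> a) = c \<odot>\<^bsub>M\<^esub> quad_bracket i j k l p a"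
  using q a by (simp_all add: quad_bracket_def F_add F_smult beta_add_left beta_smult_left)

lemma quad_bracket_zero: "quad i j k l \<Longrightarrow> quad_bracket i j k l p \<zero>\<^bsub>A\<^esub> = \<zero>\<^bsub>M\<^esub>"
  by (simp add: quad_bracket_def F_zero)

lemma quad_inv_homog:
  assumes r: "class_rep r = (i, j, k, l)" and a: "a \<in> grade A p"
  shows "quad_inv r a = quad_bracket i j k l p a"
proof -
  have q: "quad i j k l" using class_rep_quad[of r] r by simp
  show ?thesis using quad_bracket_closed[OF q a]
    by (cases p) (simp_all add: quad_inv_def r gpart_homog[OF a] quad_bracket_zero[OF q])
qed

lemma quad_inv_closed [simp]: "a \<in> carrier A \<Longrightarrow> quad_inv r a \<in> carrier M"
proof -
  obtain i j k l where r: "class_rep r = (i, j, k, l)" by (cases "class_rep r")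
  then have q: "quad i j k l" using class_rep_quad[of r] by simp
  assume "a \<in> carrier A"
  then show ?thesis using quad_bracket_closed[OF q] by (simp add: quad_inv_def r)
qed

lemma quad_inv_add:
  assumes [simp]: "a \<in> carrier A" "b \<in> carrier A"
  shows "quad_inv r (a \<oplus>\<^bsub>A\<^esub> b) = quad_inv r a \<oplus>\<^bsub>M\<^esub> quad_inv r b"
proof -
  obtain i j k l where r: "class_rep r = (i, j, k, l)" by (cases "class_rep r")
  then have q: "quad i j k l" using class_rep_quad[of r] by simp
  note [simp] = quad_bracket_closed[OF q]
  show ?thesis by (simp add: quad_inv_def r gpart_add quad_bracket_linear[OF q] X.M.a_ac)
qed

lemma quad_inv_smult:
  assumes [simp]: "c \<in> carrier K" "a \<in> carrier A"
  shows "quad_inv r (c \<odot>\<^bsub>A\<^esub> a) = c \<odot>\<^bsub>M\<^esub> quad_inv r a"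
proof -
  obtain i j k l where r: "class_rep r = (i, j, k, l)" by (cases "class_rep r")
  then have q: "quad i j k l" using class_rep_quad[of r] by simp
  note [simp] = quad_bracket_closed[OF q]
  show ?thesis by (simp add: quad_inv_def r gpart_smult quad_bracket_linear[OF q] X.smult_r_distr)
qed

lemma quad_inv_zero [simp]: "quad_inv r \<zero>\<^bsub>A\<^esub> = \<zero>\<^bsub>M\<^esub>"
  using quad_inv_smult[of "\<zero>\<^bsub>K\<^esub>" "\<zero>\<^bsub>A\<^esub>" r] by simp

lemma quad_inv_minus: "a \<in> carrier A \<Longrightarrow> quad_inv r (\<ominus>\<^bsub>A\<^esub> a) = \<ominus>\<^bsub>M\<^esub> quad_inv r a"
  using quad_inv_smult[of "\<ominus>\<^bsub>K\<^esub> \<one>\<^bsub>K\<^esub>" a r] by (simp add: smult_l_minus X.smult_l_minus)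

lemma quad_inv_sg: "a \<in> carrier A \<Longrightarrow> quad_inv r (sg A p a) = sg M p (quad_inv r a)"
  by (simp add: sg_def quad_inv_minus)

lemma quad_inv_trace:
  assumes "a \<in> grade A p" "b \<in> grade A q" "c \<in> grade A s"
  shows "quad_inv r (a \<otimes>\<^bsub>A\<^esub> b \<otimes>\<^bsub>A\<^esub> c) = sg M (p * q) (quad_inv r (b \<otimes>\<^bsub>A\<^esub> a \<otimes>\<^bsub>A\<^esub> c))"
proof -
  obtain i j k l where r: "class_rep r = (i, j, k, l)" by (cases "class_rep r")
  then have q: "quad i j k l" using class_rep_quad[of r] by simp
  have m: "a \<otimes>\<^bsub>A\<^esub> b \<otimes>\<^bsub>A\<^esub> c \<in> grade A (p + q + s)" "b \<otimes>\<^bsub>A\<^esub> a \<otimes>\<^bsub>A\<^esub> c \<in> grade A (p + q + s)"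
    using assms mult_even[OF mult_even[OF assms(1,2)] assms(3)] mult_even[OF mult_even[OF assms(2,1)] assms(3)]
    by (simp_all add: add.commute)
  show ?thesis unfolding quad_inv_homog[OF r m(1)] quad_inv_homog[OF r m(2)] by (rule quad_bracket_trace[OF q assms])
qed

lemma quad_inv_torsion:
  assumes r: "r \<in> {1..6}" "r \<le> 4" and a: "a \<in> carrier A"
  shows "sg M p (quad_inv r a) = quad_inv r a"
proof -
  obtain i j k l where q: "class_rep r = (i, j, k, l)" by (cases "class_rep r")
  then have quad: "quad i j k l" using class_rep_quad[of r] by simp
  have par: "ipar i + ipar k = 1" using r(1) r(2) q by (cases rule: six_cases) (auto simp: class_rep_def)
  have "quad_bracket i j k l s (gpart A s a) = sg M 1 (quad_bracket i j k l s (gpart A s a))" for s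
    using quad_bracket_torsion[OF quad gpart_grade[OF a]] par by simp
  then have "sg M 1 (quad_inv r a) = quad_inv r a"
    using quad_bracket_closed[OF quad gpart_grade[OF a]] by (simp add: quad_inv_def q X.sg_add)
  then show ?thesis by (cases p) simp_all
qed

text \<open>The exchange rule moves \<open>c\<close> to the right of the supercommutator; then it
  is applied to the two factors of the supercommutator themselves.\<close>

lemma quad_inv_comm:
  assumes a: "a \<in> grade A p" and b: "b \<in> grade A q" and [simp]: "c \<in> carrier A" "d \<in> carrier A"
  shows "quad_inv r (c \<otimes>\<^bsub>A\<^esub> (a \<otimes>\<^bsub>A\<^esub> b \<ominus>\<^bsub>A\<^esub> sg A (p * q) (b \<otimes>\<^bsub>A\<^esub> a)) \<otimes>\<^bsub>A\<^esub> d) = \<zero>\<^bsub>M\<^esub>"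
proof -
  note [simp] = a[THEN grade_carrier] b[THEN grade_carrier]
  let ?x = "a \<otimes>\<^bsub>A\<^esub> b \<ominus>\<^bsub>A\<^esub> sg A (p * q) (b \<otimes>\<^bsub>A\<^esub> a)"
  have hom: "quad_inv r (c \<otimes>\<^bsub>A\<^esub> ?x \<otimes>\<^bsub>A\<^esub> d) = \<zero>\<^bsub>M\<^esub>" if c: "c \<in> grade A s" and d: "d \<in> grade A t" for c d s t
  proof -
    note [simp] = c[THEN grade_carrier] d[THEN grade_carrier]
    have 1: "quad_inv r (c \<otimes>\<^bsub>A\<^esub> (a \<otimes>\<^bsub>A\<^esub> b) \<otimes>\<^bsub>A\<^esub> d) = sg M (s * (p + q)) (quad_inv r (a \<otimes>\<^bsub>A\<^esub> b \<otimes>\<^bsub>A\<^esub> (c \<otimes>\<^bsub>A\<^esub> d)))"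
      using quad_inv_trace[OF c mult_even[OF a b] d, of r] by (simp add: m_assoc)
    have 2: "quad_inv r (c \<otimes>\<^bsub>A\<^esub> (b \<otimes>\<^bsub>A\<^esub> a) \<otimes>\<^bsub>A\<^esub> d) = sg M (s * (p + q)) (quad_inv r (b \<otimes>\<^bsub>A\<^esub> a \<otimes>\<^bsub>A\<^esub> (c \<otimes>\<^bsub>A\<^esub> d)))"
      using quad_inv_trace[OF c mult_even[OF b a] d, of r] by (simp add: m_assoc add.commute)
    have 3: "quad_inv r (a \<otimes>\<^bsub>A\<^esub> b \<otimes>\<^bsub>A\<^esub> (c \<otimes>\<^bsub>A\<^esub> d)) = sg M (p * q) (quad_inv r (b \<otimes>\<^bsub>A\<^esub> a \<otimes>\<^bsub>A\<^esub> (c \<otimes>\<^bsub>A\<^esub> d)))"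
      by (rule quad_inv_trace[OF a b mult_even[OF c d]])
    have "c \<otimes>\<^bsub>A\<^esub> ?x \<otimes>\<^bsub>A\<^esub> d = c \<otimes>\<^bsub>A\<^esub> (a \<otimes>\<^bsub>A\<^esub> b) \<otimes>\<^bsub>A\<^esub> d \<oplus>\<^bsub>A\<^esub> sg A (p * q + 1) (c \<otimes>\<^bsub>A\<^esub> (b \<otimes>\<^bsub>A\<^esub> a) \<otimes>\<^bsub>A\<^esub> d)"
      by (simp add: a_minus_def minus_sg r_distr l_distr mult_sg_left mult_sg_right)
    then have "quad_inv r (c \<otimes>\<^bsub>A\<^esub> ?x \<otimes>\<^bsub>A\<^esub> d) = sg M (s * (p + q) + p * q) (quad_inv r (b \<otimes>\<^bsub>A\<^esub> a \<otimes>\<^bsub>A\<^esub> (c \<otimes>\<^bsub>A\<^esub> d))) \<oplus>\<^bsub>M\<^esub>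
       sg M (s * (p + q) + p * q + 1) (quad_inv r (b \<otimes>\<^bsub>A\<^esub> a \<otimes>\<^bsub>A\<^esub> (c \<otimes>\<^bsub>A\<^esub> d)))"
      by (simp add: quad_inv_add quad_inv_sg 1 2 3 ac_simps)
    then show ?thesis by (simp add: X.sg_cancel)
  qed
  have xc: "?x \<in> carrier A" by simp
  have "quad_inv r ((gpart A 0 c \<oplus>\<^bsub>A\<^esub> gpart A 1 c) \<otimes>\<^bsub>A\<^esub> ?x \<otimes>\<^bsub>A\<^esub> (gpart A 0 d \<oplus>\<^bsub>A\<^esub> gpart A 1 d)) = \<zero>\<^bsub>M\<^esub>"
    using hom[OF gpart_grade gpart_grade] xc by (simp add: l_distr r_distr quad_inv_add del: minus_closed)
  then show ?thesis by (simp add: gpart_decomp)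
qed

text \<open>The elements that are killed after all multiplications from both sides form an ideal.
  It contains the generators of \<open>I\<^sub>r\<close>, where the multiples of 2 come from the
  torsion of the first four classes.\<close>

lemma quad_inv_ideal:
  assumes r: "r \<in> {1..6}" and x: "x \<in> Iw r"
  shows "quad_inv r x = \<zero>\<^bsub>M\<^esub>"
proof -
  define J where "J = {x \<in> carrier A. \<forall>c\<in>carrier A. \<forall>d\<in>carrier A. quad_inv r (c \<otimes>\<^bsub>A\<^esub> x \<otimes>\<^bsub>A\<^esub> d) = \<zero>\<^bsub>M\<^esub>}"
  have "ideal J A"
  proof (rule idealI[OF ring_axioms])
    show "subgroup J (add_monoid A)"
    proof (rule add.subgroupI)
      show "J \<noteq> {}" by (auto simp: J_def intro!: exI[of _ "\<zero>\<^bsub>A\<^esub>"])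
    qed (auto simp: J_def l_distr r_distr l_minus r_minus quad_inv_add quad_inv_minus)
    show "y \<otimes>\<^bsub>A\<^esub> a \<in> J" "a \<otimes>\<^bsub>A\<^esub> y \<in> J" if a: "a \<in> J" and y: "y \<in> carrier A" for a y
    proof -
      have ac: "a \<in> carrier A" using a by (simp add: J_def)
      have "quad_inv r (c \<otimes>\<^bsub>A\<^esub> (y \<otimes>\<^bsub>A\<^esub> a) \<otimes>\<^bsub>A\<^esub> d) = \<zero>\<^bsub>M\<^esub>" "quad_inv r (c \<otimes>\<^bsub>A\<^esub> (a \<otimes>\<^bsub>A\<^esub> y) \<otimes>\<^bsub>A\<^esub> d) = \<zero>\<^bsub>M\<^esub>"
        if "c \<in> carrier A" "d \<in> carrier A" for c d
      proof -
        have "quad_inv r ((c \<otimes>\<^bsub>A\<^esub> y) \<otimes>\<^bsub>A\<^esub> a \<otimes>\<^bsub>A\<^esub> d) = \<zero>\<^bsub>M\<^esub>" "quad_inv r (c \<otimes>\<^bsub>A\<^esub> a \<otimes>\<^bsub>A\<^esub> (y \<otimes>\<^bsub>A\<^esub> d)) = \<zero>\<^bsub>M\<^esub>"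
          using a y that by (auto simp: J_def)
        then show "quad_inv r (c \<otimes>\<^bsub>A\<^esub> (y \<otimes>\<^bsub>A\<^esub> a) \<otimes>\<^bsub>A\<^esub> d) = \<zero>\<^bsub>M\<^esub>" "quad_inv r (c \<otimes>\<^bsub>A\<^esub> (a \<otimes>\<^bsub>A\<^esub> y) \<otimes>\<^bsub>A\<^esub> d) = \<zero>\<^bsub>M\<^esub>"
          using ac y that by (simp_all add: m_assoc)
      qed
      then show "y \<otimes>\<^bsub>A\<^esub> a \<in> J" "a \<otimes>\<^bsub>A\<^esub> y \<in> J" using ac y by (simp_all add: J_def)
    qed
  qed
  moreover have "super_comm_gens (if r \<le> 4 then 2 else 0) \<subseteq> J"
  proof
    fix x assume x: "x \<in> super_comm_gens (if r \<le> 4 then 2 else 0)"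
    then have xc: "x \<in> carrier A" using super_comm_gens_carrier by blast
    from x have "quad_inv r (c \<otimes>\<^bsub>A\<^esub> x \<otimes>\<^bsub>A\<^esub> d) = \<zero>\<^bsub>M\<^esub>" if c[simp]: "c \<in> carrier A" "d \<in> carrier A" for c d
    proof (unfold super_comm_gens_def, elim UnE CollectE exE conjE)
      fix a assume a: "x = [(if r \<le> 4 then 2 else (0::nat))] \<cdot>\<^bsub>A\<^esub> a" "a \<in> carrier A"
      show ?thesis
      proof (cases "r \<le> 4")
        case True
        then have x: "x = a \<oplus>\<^bsub>A\<^esub> a" using a by (simp add: numeral_2_eq_2)
        have [simp]: "a \<in> carrier A" by fact
        let ?y = "quad_inv r (c \<otimes>\<^bsub>A\<^esub> a \<otimes>\<^bsub>A\<^esub> d)"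
        have "?y \<oplus>\<^bsub>M\<^esub> ?y = ?y \<oplus>\<^bsub>M\<^esub> \<ominus>\<^bsub>M\<^esub> ?y" using quad_inv_torsion[OF r True, of "c \<otimes>\<^bsub>A\<^esub> a \<otimes>\<^bsub>A\<^esub> d" 1] by (simp add: sg_1)
        then show ?thesis by (simp add: x l_distr r_distr quad_inv_add X.M.r_neg)
      next
        case False
        then show ?thesis using a by simp
      qed
    next
      fix a b p q assume *: "x = a \<otimes>\<^bsub>A\<^esub> b \<ominus>\<^bsub>A\<^esub> [ksgn (p * q)] \<cdot>\<^bsub>A\<^esub> (b \<otimes>\<^bsub>A\<^esub> a)" "a \<in> grade A p" "b \<in> grade A q"
      then show ?thesis using quad_inv_comm[OF *(2,3) c] *(2,3)[THEN grade_carrier] by (simp add: ksgn_pow)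
    qed
    then show "x \<in> J" using xc by (simp add: J_def)
  qed
  ultimately have "Iw r \<subseteq> J" by (rule super_comm_minimal)
  then have "x \<in> J" using x by blast
  then have "x \<in> carrier A" "quad_inv r (\<one>\<^bsub>A\<^esub> \<otimes>\<^bsub>A\<^esub> x \<otimes>\<^bsub>A\<^esub> \<one>\<^bsub>A\<^esub>) = \<zero>\<^bsub>M\<^esub>"
    unfolding J_def by blast+
  then show ?thesis by simp
qed

text \<open>Exchanges of rows and columns connect the four quadruples of a class, and the signs
  they produce in the last two classes are the values of \<open>\<sigma>\<close>.\<close>

lemma beta_quad:
  assumes t: "(i, j, k, l) \<in> quad_class r" and ab: "a \<in> grade A p" "b \<in> grade A q"
  shows "beta (F i j p a) (F k l q b) = sg M (q + sigma_bit (i, j, k, l)) (quad_inv r (a \<otimes>\<^bsub>A\<^esub> b))"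
proof -
  note r = quad_class_range[OF t]
  obtain i0 j0 k0 l0 where q: "class_rep r = (i0, j0, k0, l0)" by (cases "class_rep r")
  have q0: "quad i0 j0 k0 l0" using class_rep_quad[of r] q by simp
  have q1: "quad k0 j0 i0 l0" and q2: "quad i0 l0 k0 j0" and q3: "quad k0 l0 i0 j0" using q0 by auto
  note m = mult_even[OF ab] and mc = grade_carrier[OF mult_even[OF ab]]
  have o: "quad_bracket i0 j0 k0 l0 (p + q) (a \<otimes>\<^bsub>A\<^esub> b) = quad_inv r (a \<otimes>\<^bsub>A\<^esub> b)" by (rule quad_inv_homog[OF q m, symmetric])
  have e1: "quad_bracket k0 j0 i0 l0 (p + q) (a \<otimes>\<^bsub>A\<^esub> b) = sg M ((ipar k0 + ipar i0) * (ipar i0 + ipar j0 + (p + q)) + 1) (quad_inv r (a \<otimes>\<^bsub>A\<^esub> b))"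
    using quad_bracket_row_swap[OF q1 m] o by simp
  have e2: "quad_bracket i0 l0 k0 j0 (p + q) (a \<otimes>\<^bsub>A\<^esub> b) = sg M ((ipar l0 + ipar k0) * (ipar k0 + ipar j0)) (quad_inv r (a \<otimes>\<^bsub>A\<^esub> b))"
    using quad_bracket_col_swap[OF q2 m] o by simp
  have e3: "quad_bracket k0 l0 i0 j0 (p + q) (a \<otimes>\<^bsub>A\<^esub> b) = sg M ((ipar l0 + ipar i0) * (ipar i0 + ipar j0) +
      ((ipar k0 + ipar i0) * (ipar i0 + ipar j0 + (p + q)) + 1)) (quad_inv r (a \<otimes>\<^bsub>A\<^esub> b))"
    using quad_bracket_col_swap[OF q3 m] e1 mc by simp
  have cases: "(i, j, k, l) \<in> {(i0, j0, k0, l0), (k0, j0, i0, l0), (i0, l0, k0, j0), (k0, l0, i0, j0)}"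
    using t quad_class_class_rep[OF r] q by simp
  have quad: "quad i j k l" using cases q0 q1 q2 q3 by (elim insertE emptyE) simp_all
  show ?thesis
  proof (cases "r \<le> 4")
    case True
    note [simp] = quad_inv_torsion[OF r True mc]
    show ?thesis unfolding beta_quad_bracket[OF quad ab] using cases by (elim insertE emptyE) (simp_all add: o e1 e2 e3)
  next
    case False
    then have "(i0 = 1 \<and> j0 = 3 \<and> k0 = 2 \<and> l0 = 4) \<or> (i0 = 3 \<and> j0 = 1 \<and> k0 = 4 \<and> l0 = 2)"
      using q by (cases rule: six_cases[OF r]) (simp_all add: class_rep_def)
    then have par: "ipar i0 + ipar k0 = 0" "ipar j0 + ipar k0 = 1" "ipar l0 + ipar k0 = 1" "ipar l0 + ipar i0 = 1" "ipar i0 + ipar j0 = 1"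
      and s: "sigma_bit (i0, j0, k0, l0) = 0" "sigma_bit (k0, j0, i0, l0) = 1" "sigma_bit (i0, l0, k0, j0) = 1" "sigma_bit (k0, l0, i0, j0) = 0"
      by (elim disjE; simp add: sigma_bit_def quad_sigma_def)+
    have par': "ipar k0 + ipar i0 = 0" "ipar k0 + ipar j0 = 1" "ipar j0 + ipar i0 = 1" using par by (simp_all add: add.commute)
    show ?thesis unfolding beta_quad_bracket[OF quad ab] using cases mc
      by (elim insertE emptyE) (simp_all add: o e1 e2 e3 par par' s)
  qed
qed

section \<open>The universal property\<close>

definition sum6 :: "(nat \<Rightarrow> 'n) \<Rightarrow> 'n"
  where "sum6 f = f 1 \<oplus>\<^bsub>M\<^esub> (f 2 \<oplus>\<^bsub>M\<^esub> (f 3 \<oplus>\<^bsub>M\<^esub> (f 4 \<oplus>\<^bsub>M\<^esub> (f 5 \<oplus>\<^bsub>M\<^esub> f 6))))"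

lemma six_mem [simp]: "1 \<in> {1..6::nat}" "2 \<in> {1..6::nat}" "3 \<in> {1..6::nat}" "4 \<in> {1..6::nat}" "5 \<in> {1..6::nat}" "6 \<in> {1..6::nat}"
  by (auto simp: atLeastAtMost_iff)

lemma sum6_delta: "\<lbrakk>r \<in> {1..6}; x \<in> carrier M\<rbrakk> \<Longrightarrow> sum6 (\<lambda>s. if s = r then x else \<zero>\<^bsub>M\<^esub>) = x"
  by (erule six_cases) (simp_all add: sum6_def)

text \<open>The graph of the map from \<open>W\<close> to the centre of \<open>M\<close> that is
  given by \<open>quad_inv r\<close> on the \<open>r\<close>-th summand. It is described by
  representatives in \<open>A\<close>; that it is single-valued is the content of
  \<open>central_graph_fun\<close>.\<close>

definition central_graph :: "((('k, 'a) st_elem \<times> (nat \<Rightarrow> 'a set)) \<times> 'n) set" where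
  "central_graph = {((\<zero>\<^bsub>L\<^esub>, \<lambda>r\<in>{1..6}. cl r (a r)), sum6 (\<lambda>r. quad_inv r (a r))) |a. \<forall>r\<in>{1..6}. a r \<in> carrier A}"

lemma central_graphI: "(\<And>r. r \<in> {1..6} \<Longrightarrow> a r \<in> carrier A) \<Longrightarrow> w = (\<lambda>r\<in>{1..6}. cl r (a r)) \<Longrightarrow> m = sum6 (\<lambda>r. quad_inv r (a r)) \<Longrightarrow>
    ((\<zero>\<^bsub>L\<^esub>, w), m) \<in> central_graph"
  unfolding central_graph_def by blast

lemma central_graphE:
  assumes "(u, m) \<in> central_graph"
  obtains a where "\<And>r. r \<in> {1..6} \<Longrightarrow> a r \<in> carrier A" "u = (\<zero>\<^bsub>L\<^esub>, \<lambda>r\<in>{1..6}. cl r (a r))" "m = sum6 (\<lambda>r. quad_inv r (a r))"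
  using assms unfolding central_graph_def by blast

lemma central_graph_zero: "((\<zero>\<^bsub>L\<^esub>, \<zero>\<^bsub>W\<^esub>), \<zero>\<^bsub>M\<^esub>) \<in> central_graph"
  by (rule central_graphI[of "\<lambda>_. \<zero>\<^bsub>A\<^esub>"]) (simp_all add: sum6_def Wmod_def restrict_def)

lemma central_graph_fun:
  assumes "((x, \<zero>\<^bsub>W\<^esub>), m) \<in> central_graph" shows "m = \<zero>\<^bsub>M\<^esub>"
  using assms
proof (rule central_graphE)
  fix a assume a: "\<And>r. r \<in> {1..6} \<Longrightarrow> a r \<in> carrier A" and w: "(x, \<zero>\<^bsub>W\<^esub>) = (\<zero>\<^bsub>L\<^esub>, \<lambda>r\<in>{1..6}. cl r (a r))"
    and m: "m = sum6 (\<lambda>r. quad_inv r (a r))"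
  have "quad_inv r (a r) = \<zero>\<^bsub>M\<^esub>" if r: "r \<in> {1..6}" for r
  proof -
    have "(\<lambda>r\<in>{1..6}. cl r (a r)) r = \<zero>\<^bsub>W\<^esub> r" using w by (metis prod.inject)
    then have "cl r (a r) = \<zero>\<^bsub>S r\<^esub>" using r by (simp add: W_zero_app)
    then show ?thesis using a[OF r] quad_inv_ideal[OF r] cl_zero_iff by blast
  qed
  then show "m = \<zero>\<^bsub>M\<^esub>" by (simp add: m sum6_def)
qed

lemma tau_quad_inv: "a \<in> carrier A \<Longrightarrow> \<tau> (quad_inv r a) = \<zero>\<^bsub>L\<^esub>"
proof -
  obtain i j k l where r: "class_rep r = (i, j, k, l)" by (cases "class_rep r")
  then have q: "quad i j k l" using class_rep_quad[of r] by simp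
  assume a: "a \<in> carrier A"
  have "bracket L (F i j p (gpart A p a)) (F k l 0 \<one>\<^bsub>A\<^esub>) = \<zero>\<^bsub>L\<^esub>" for p
    by (rule F_bracket_zero; use q a in auto)
  then show ?thesis using q a quad_bracket_closed[OF q gpart_grade[OF a]]
    by (simp add: quad_inv_def r tau(2)) (simp add: quad_bracket_def tau_beta)
qed

lemma central_graph_center:
  assumes "(u, m) \<in> central_graph" shows "u \<in> lie_center E.E \<and> m \<in> lie_center M"
  using assms
proof (rule central_graphE)
  fix a assume a: "\<And>r. r \<in> {1..6} \<Longrightarrow> a r \<in> carrier A" and u: "u = (\<zero>\<^bsub>L\<^esub>, \<lambda>r\<in>{1..6}. cl r (a r))"
    and m: "m = sum6 (\<lambda>r. quad_inv r (a r))"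
  have "(\<lambda>r\<in>{1..6}. cl r (a r)) \<in> carrier W" using a by (auto simp: carrier_W)
  moreover have "m \<in> lie_center M" unfolding m
    by (rule tau_ker) (simp_all add: sum6_def a tau(2) tau_quad_inv)
  ultimately show ?thesis by (simp add: u E.center_E)
qed

fun gen_sharp :: "'a st_gen \<Rightarrow> ('k, 'a) st_elem \<times> (nat \<Rightarrow> 'a set)"
  where "gen_sharp (i, j, p, a) = (F i j p a, \<zero>\<^bsub>W\<^esub>)"

fun gen_ext :: "'a st_gen \<Rightarrow> 'n"
  where "gen_ext (i, j, p, a) = root_lift i j p a"

abbreviation eval_sharp where "eval_sharp \<equiv> eval_term E.E gen_sharp"
abbreviation eval_ext where "eval_ext \<equiv> eval_term M gen_ext"

lemma gen_sharp_grade: "x \<in> st_gens A \<Longrightarrow> gen_sharp x \<in> grade E.E (st_deg x)"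
  by (erule gens_E) (simp add: F_grade)

lemma gen_ext_grade: "x \<in> st_gens A \<Longrightarrow> gen_ext x \<in> grade M (st_deg x)"
  by (erule gens_E) (simp add: root_lift_grade)

lemma lie_superalgebra_E: "lie_superalgebra K E.E"
  by (rule E.lie_superalgebra_E)

sublocale sharp: lie_superalgebra K E.E by (rule lie_superalgebra_E)

lemma eval_sharp_closed [simp]: "t \<in> st.T \<Longrightarrow> eval_sharp t \<in> carrier E.E"
  using sharp.eval_term_closed[of "st_gens A" gen_sharp t] gen_sharp_grade sharp.grade_carrier by blast

lemma eval_ext_closed [simp]: "t \<in> st.T \<Longrightarrow> eval_ext t \<in> carrier M"
  using X.eval_term_closed[of "st_gens A" gen_ext t] gen_ext_grade X.grade_carrier by blast

lemmas cls_L = st.zero_P[folded L_eq] st.add_P[folded L_eq] st.smult_P[folded L_eq] st.br_P[folded L_eq]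

lemma fst_eval_sharp: "t \<in> st.T \<Longrightarrow> fst (eval_sharp t) = st.cls t"
proof (induction rule: lie_terms.induct)
  case (gen x)
  then show ?case by (elim gens_E) (simp add: F_eq)
next
  case zero
  show ?case by (simp add: cls_L)
next
  case (add s t)
  then show ?case by (cases "eval_sharp s"; cases "eval_sharp t") (simp add: cls_L)
next
  case (smult k t)
  then show ?case by (cases "eval_sharp t") (simp add: cls_L)
next
  case (br s t)
  then show ?case by (cases "eval_sharp s"; cases "eval_sharp t") (simp add: cls_L)
qed

lemma tau_eval_ext: "t \<in> st.T \<Longrightarrow> \<tau> (eval_ext t) = st.cls t"
proof (induction rule: lie_terms.induct)
  case (gen x)
  then show ?case by (elim gens_E) (simp add: tau_root_lift flip: F_eq)
next
  case zero
  then show ?case by (simp add: tau_zero cls_L)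
next
  case (add s t)
  then show ?case by (simp add: tau(2) cls_L)
next
  case (smult k t)
  then show ?case by (simp add: tau(3) cls_L)
next
  case (br s t)
  then show ?case by (simp add: tau(4) cls_L)
qed

text \<open>The lifts satisfy all relations, in the extension by \<open>W\<close> as well as in
  \<open>M\<close>, except the one for four distinct indices. That relation fails in both, by
  amounts that correspond under the graph.\<close>

lemma rel_central_graph:
  assumes "(s, t) \<in> st_rels K A"
  shows "(eval_sharp s \<ominus>\<^bsub>E.E\<^esub> eval_sharp t, eval_ext s \<ominus>\<^bsub>M\<^esub> eval_ext t) \<in> central_graph"
proof -
  have eq: "(u \<ominus>\<^bsub>E.E\<^esub> u', m \<ominus>\<^bsub>M\<^esub> m') \<in> central_graph" if "u = u'" "m = m'" "u \<in> carrier E.E" "m \<in> carrier M" for u u' m m'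
    using that central_graph_zero E.E.M.r_neg[of u] X.M.r_neg[of m] by (simp add: a_minus_def)
  from assms show ?thesis
  proof cases
    case (gen_add i j a p b)
    then show ?thesis by (intro eq) (simp_all add: F_add root_lift_linear)
  next
    case (gen_smult i j k a p)
    then show ?thesis by (intro eq) (simp_all add: F_smult root_lift_linear)
  next
    case (br_chain i j k a p b q)
    have nd: "\<not> distinct [i, j, j, k]" by simp
    have "psi (F i j p a) (F j k q b) = \<zero>\<^bsub>W\<^esub>"
      using psi_F[of i j j k a p b q] br_chain by simp
    moreover have "bracket M (root_lift i j p a) (root_lift j k q b) = root_lift i k (p + q) (a \<otimes>\<^bsub>A\<^esub> b)"
      using br_chain by (simp add: beta_eq tau_root_lift beta_root_lift)
    ultimately show ?thesis using br_chain by (intro eq) (simp_all add: F_chain mult_even)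
  next
    case (br_zero i j k l a p b q)
    have M: "bracket M (root_lift i j p a) (root_lift k l q b) = beta (F i j p a) (F k l q b)"
      using br_zero by (simp add: beta_eq tau_root_lift)
    have ev: "eval_sharp s \<ominus>\<^bsub>E.E\<^esub> eval_sharp t = (\<zero>\<^bsub>L\<^esub>, psi (F i j p a) (F k l q b))" "eval_ext s \<ominus>\<^bsub>M\<^esub> eval_ext t = beta (F i j p a) (F k l q b)"
      using br_zero F_bracket_zero[OF br_zero(3-12)] E.psi_closed[of "F i j p a" "F k l q b"]
      by (simp_all add: a_minus_def M)
    show ?thesis
    proof (cases "distinct [i, j, k, l]")
      case False
      then have "psi (F i j p a) (F k l q b) = \<zero>\<^bsub>W\<^esub>"
        using psi_F[OF br_zero(3-8,11,12)] by (simp only: False if_False)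
      moreover have "beta (F i j p a) (F k l q b) = \<zero>\<^bsub>M\<^esub>"
        using False br_zero by (intro beta_F_zero) auto
      ultimately show ?thesis unfolding ev by (simp add: central_graph_zero)
    next
      case True
      then obtain r where r: "(i, j, k, l) \<in> quad_class r" using quad_class_ex[of i j k l] br_zero by blast
      note r6 = quad_class_range[OF r] and th = quad_theta_eq[OF r]
      let ?e = "q + sigma_bit (i, j, k, l)"
      \<comment> \<open>The element of \<open>W\<close> is concentrated in the summand of the class, hence so is its representative.\<close>
      let ?a = "\<lambda>s. if s = r then sg A ?e (a \<otimes>\<^bsub>A\<^esub> b) else \<zero>\<^bsub>A\<^esub>"
      have ab: "a \<in> carrier A" "b \<in> carrier A" using br_zero by (auto dest: grade_carrier)
      have p: "psi (F i j p a) (F k l q b) = sg W ?e (Winj A r (cl r (a \<otimes>\<^bsub>A\<^esub> b)))"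
        using psi_F[OF br_zero(3-8,11,12)] by (simp only: True if_True th)
      have b: "beta (F i j p a) (F k l q b) = sg M ?e (quad_inv r (a \<otimes>\<^bsub>A\<^esub> b))"
        by (rule beta_quad[OF r]) (use br_zero in simp_all)
      have Wc: "Winj A r (cl r (a \<otimes>\<^bsub>A\<^esub> b)) \<in> carrier W" using r6 ab by (simp add: Winj_closed)
      show ?thesis unfolding ev p b
      proof (rule central_graphI[of ?a])
        show "sg W ?e (Winj A r (cl r (a \<otimes>\<^bsub>A\<^esub> b))) = (\<lambda>s\<in>{1..6}. cl s (?a s))"
        proof (rule W_eqI)
          show "(\<lambda>s\<in>{1..6}. cl s (?a s)) \<in> carrier W" using ab by (simp add: carrier_W)
          show "sg W ?e (Winj A r (cl r (a \<otimes>\<^bsub>A\<^esub> b))) s = (\<lambda>s\<in>{1..6}. cl s (?a s)) s" if "s \<in> {1..6}" for s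
            using Wc ab that by (simp add: W_sg_app Winj_app cl_sg)
        qed (use Wc in simp)
        have "(\<lambda>s. quad_inv s (?a s)) = (\<lambda>s. if s = r then sg M ?e (quad_inv r (a \<otimes>\<^bsub>A\<^esub> b)) else \<zero>\<^bsub>M\<^esub>)"
          using ab by (auto simp: quad_inv_sg)
        then show "sg M ?e (quad_inv r (a \<otimes>\<^bsub>A\<^esub> b)) = sum6 (\<lambda>s. quad_inv s (?a s))"
          using ab r6 by (simp add: sum6_delta)
      qed (use ab in simp)
    qed
  qed
qed

lemma cong_central_graph:
  assumes "(s, t) \<in> st.r" shows "(eval_sharp s \<ominus>\<^bsub>E.E\<^esub> eval_sharp t, eval_ext s \<ominus>\<^bsub>M\<^esub> eval_ext t) \<in> central_graph"
proof (rule eval_term_cong_mod_center[OF lie_superalgebra_E X.lie_superalgebra_axioms gen_sharp_grade gen_ext_grade _ _ _ central_graph_center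
      rel_central_graph st.lie_presentation_axioms assms])
  show "(\<zero>\<^bsub>E.E\<^esub>, \<zero>\<^bsub>M\<^esub>) \<in> central_graph" using central_graph_zero by simp
  fix u v u' v' assume "(u, v) \<in> central_graph" "(u', v') \<in> central_graph"
  then show "(u \<oplus>\<^bsub>E.E\<^esub> u', v \<oplus>\<^bsub>M\<^esub> v') \<in> central_graph"
  proof (elim central_graphE)
    fix a b assume a: "\<And>r. r \<in> {1..6} \<Longrightarrow> a r \<in> carrier A" "u = (\<zero>\<^bsub>L\<^esub>, \<lambda>r\<in>{1..6}. cl r (a r))" "v = sum6 (\<lambda>r. quad_inv r (a r))"
      and b: "\<And>r. r \<in> {1..6} \<Longrightarrow> b r \<in> carrier A" "u' = (\<zero>\<^bsub>L\<^esub>, \<lambda>r\<in>{1..6}. cl r (b r))" "v' = sum6 (\<lambda>r. quad_inv r (b r))"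
    have "u \<oplus>\<^bsub>E.E\<^esub> u' = (\<zero>\<^bsub>L\<^esub>, (\<lambda>r\<in>{1..6}. cl r (a r)) \<oplus>\<^bsub>W\<^esub> (\<lambda>r\<in>{1..6}. cl r (b r)))"
      by (simp add: a b)
    also have "((\<zero>\<^bsub>L\<^esub>, (\<lambda>r\<in>{1..6}. cl r (a r)) \<oplus>\<^bsub>W\<^esub> (\<lambda>r\<in>{1..6}. cl r (b r))), v \<oplus>\<^bsub>M\<^esub> v') \<in> central_graph"
    proof (rule central_graphI[of "\<lambda>r. a r \<oplus>\<^bsub>A\<^esub> b r"])
      show "(\<lambda>r\<in>{1..6}. cl r (a r)) \<oplus>\<^bsub>W\<^esub> (\<lambda>r\<in>{1..6}. cl r (b r)) = (\<lambda>r\<in>{1..6}. cl r (a r \<oplus>\<^bsub>A\<^esub> b r))"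
        using a(1) b(1) by (simp add: Wmod_def cl_add restrict_def fun_eq_iff)
      show "v \<oplus>\<^bsub>M\<^esub> v' = sum6 (\<lambda>r. quad_inv r (a r \<oplus>\<^bsub>A\<^esub> b r))"
        using a(1) b(1) by (simp add: a(3) b(3) sum6_def quad_inv_add X.M.a_ac)
    qed (use a(1) b(1) in simp)
    finally show ?thesis .
  qed
next
  fix k u v assume k: "k \<in> carrier K" and "(u, v) \<in> central_graph"
  then show "(k \<odot>\<^bsub>E.E\<^esub> u, k \<odot>\<^bsub>M\<^esub> v) \<in> central_graph"
  proof (elim central_graphE)
    fix a assume a: "\<And>r. r \<in> {1..6} \<Longrightarrow> a r \<in> carrier A" "u = (\<zero>\<^bsub>L\<^esub>, \<lambda>r\<in>{1..6}. cl r (a r))" "v = sum6 (\<lambda>r. quad_inv r (a r))"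
    have "k \<odot>\<^bsub>E.E\<^esub> u = (\<zero>\<^bsub>L\<^esub>, k \<odot>\<^bsub>W\<^esub> (\<lambda>r\<in>{1..6}. cl r (a r)))" using k by (simp add: a)
    also have "((\<zero>\<^bsub>L\<^esub>, k \<odot>\<^bsub>W\<^esub> (\<lambda>r\<in>{1..6}. cl r (a r))), k \<odot>\<^bsub>M\<^esub> v) \<in> central_graph"
    proof (rule central_graphI[of "\<lambda>r. k \<odot>\<^bsub>A\<^esub> a r"])
      show "k \<odot>\<^bsub>W\<^esub> (\<lambda>r\<in>{1..6}. cl r (a r)) = (\<lambda>r\<in>{1..6}. cl r (k \<odot>\<^bsub>A\<^esub> a r))"
        using a(1) k by (simp add: Wmod_def cl_smult restrict_def fun_eq_iff)
      show "k \<odot>\<^bsub>M\<^esub> v = sum6 (\<lambda>r. quad_inv r (k \<odot>\<^bsub>A\<^esub> a r))"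
        using a(1) k by (simp add: a(3) sum6_def quad_inv_smult X.smult_r_distr)
    qed (use a(1) k in simp)
    finally show ?thesis .
  qed
qed

lemma eval_ext_wd:
  assumes st: "s \<in> st.T" "t \<in> st.T" and eq: "eval_sharp s = eval_sharp t" shows "eval_ext s = eval_ext t"
proof -
  have "(s, t) \<in> st.r" using fst_eval_sharp[OF st(1)] fst_eval_sharp[OF st(2)] eq st.cls_eq_iff[OF st] by simp
  from cong_central_graph[OF this] have "((\<zero>\<^bsub>L\<^esub>, \<zero>\<^bsub>W\<^esub>), eval_ext s \<ominus>\<^bsub>M\<^esub> eval_ext t) \<in> central_graph"
    using eq E.E.M.r_neg[OF eval_sharp_closed[OF st(2)]] by (simp add: a_minus_def)
  then have "eval_ext s \<ominus>\<^bsub>M\<^esub> eval_ext t = \<zero>\<^bsub>M\<^esub>" by (rule central_graph_fun)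
  then show ?thesis using st by (simp add: X.M.eq_minus_iff)
qed

lemma homog_Gen: "\<lbrakk>i \<in> idx; j \<in> idx; i \<noteq> j; a \<in> grade A p\<rbrakk> \<Longrightarrow> st.homog (ipar i + ipar j + p) (Gen (i, j, p, a))"
  using homog_term.gen[OF gens_mem, of i j a p K st_deg] by simp

text \<open>The brackets of root elements for the class representatives already fill the six
  summands.\<close>

lemma W_generated:
  assumes w: "w \<in> grade W p" shows "\<exists>t. st.homog p t \<and> eval_sharp t = (\<zero>\<^bsub>L\<^esub>, w)"
proof -
  have one: "\<exists>t. st.homog p t \<and> eval_sharp t = (\<zero>\<^bsub>L\<^esub>, Winj A r (w r))" if r: "r \<in> {1..6}" for r
  proof -
    have "w r \<in> grade (S r) p" using w r by (auto simp: grade_W)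
    then obtain a where a: "a \<in> grade A p" "w r = cl r a" by (auto simp: grade_S)
    obtain i j k l where q: "class_rep r = (i, j, k, l)" by (cases "class_rep r")
    have quad: "quad i j k l" using class_rep_quad[of r] q by simp
    have qc: "(i, j, k, l) \<in> quad_class r" using quad_class_class_rep[OF r] q by simp
    have s0: "sigma_bit (i, j, k, l) = 0" using r q by (cases rule: six_cases) (auto simp: class_rep_def sigma_bit_def quad_sigma_def)
    have ac: "a \<in> carrier A" by (rule grade_carrier[OF a(1)])
    let ?t = "Br (Gen (i, j, p, a)) (Gen (k, l, 0, \<one>\<^bsub>A\<^esub>))"
    have "bracket L (F i j p a) (F k l 0 \<one>\<^bsub>A\<^esub>) = \<zero>\<^bsub>L\<^esub>" by (rule F_bracket_zero; use quad a in auto)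
    moreover have "psi (F i j p a) (F k l 0 \<one>\<^bsub>A\<^esub>) = Winj A r (w r)"
      using psi_F[of i j k l a p "\<one>\<^bsub>A\<^esub>" 0] quad a ac quad_theta_eq[OF qc] s0 by simp
    moreover have deg: "(ipar i + ipar j + p) + (ipar k + ipar l + 0) = p"
      using r q by (cases rule: six_cases) (auto simp: class_rep_def ac_simps)
    have "st.homog ((ipar i + ipar j + p) + (ipar k + ipar l + 0)) ?t"
      by (rule homog_term.br[OF homog_Gen homog_Gen]) (use quad a in auto)
    then have "st.homog p ?t" unfolding deg .
    ultimately show ?thesis by (intro exI[of _ ?t]) simp
  qed
  obtain t where t: "\<And>r. r \<in> {1..6} \<Longrightarrow> st.homog p (t r)" "\<And>r. r \<in> {1..6} \<Longrightarrow> eval_sharp (t r) = (\<zero>\<^bsub>L\<^esub>, Winj A r (w r))"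
    using one by metis
  let ?t = "Add (t 1) (Add (t 2) (Add (t 3) (Add (t 4) (Add (t 5) (t 6)))))"
  have wc: "w \<in> carrier W" by (rule W.grade_carrier[OF w])
  have c: "Winj A r (w r) \<in> carrier W" if "r \<in> {1..6}" for r using wc that by (simp add: Winj_closed W_mem)
  have "Winj A 1 (w 1) \<oplus>\<^bsub>W\<^esub> (Winj A 2 (w 2) \<oplus>\<^bsub>W\<^esub> (Winj A 3 (w 3) \<oplus>\<^bsub>W\<^esub> (Winj A 4 (w 4) \<oplus>\<^bsub>W\<^esub> (Winj A 5 (w 5) \<oplus>\<^bsub>W\<^esub> Winj A 6 (w 6))))) = w"
  proof (rule W_eqI[OF _ wc])
    fix r :: nat assume r: "r \<in> {1..6}"
    have "w r \<in> carrier (S r)" using wc r by (simp add: W_mem)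
    then show "(Winj A 1 (w 1) \<oplus>\<^bsub>W\<^esub> (Winj A 2 (w 2) \<oplus>\<^bsub>W\<^esub> (Winj A 3 (w 3) \<oplus>\<^bsub>W\<^esub> (Winj A 4 (w 4) \<oplus>\<^bsub>W\<^esub> (Winj A 5 (w 5) \<oplus>\<^bsub>W\<^esub> Winj A 6 (w 6)))))) r = w r"
      by (cases rule: six_cases[OF r]) (simp_all add: W_add_app Winj_app)
  qed (simp add: W_closed(1) c)
  then have "eval_sharp ?t = (\<zero>\<^bsub>L\<^esub>, w)" by (simp add: t(2))
  moreover have "st.homog p ?t" by (intro homog_term.add t(1) six_mem)
  ultimately show ?thesis by blast
qed

lemma E_generated:
  assumes X: "X \<in> grade E.E p" shows "\<exists>t. st.homog p t \<and> eval_sharp t = X"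
proof -
  obtain x w where Xe: "X = (x, w)" "x \<in> grade L p" "w \<in> grade W p" using X by auto
  from Xe(2) obtain t where t: "st.homog p t" "x = st.cls t" unfolding L_eq by (rule st.grade_P_E)
  note tT = st.homog_terms[OF t(1)]
  have g: "eval_sharp t \<in> grade E.E p" by (rule sharp.eval_term_homog[OF gen_sharp_grade t(1)])
  then have g: "snd (eval_sharp t) \<in> grade W p" and e: "eval_sharp t = (x, snd (eval_sharp t))"
    using fst_eval_sharp[OF tT] t(2) by (auto simp: prod_eq_iff)
  have "w \<ominus>\<^bsub>W\<^esub> snd (eval_sharp t) \<in> grade W p" using Xe g by (simp add: a_minus_def)
  then obtain s where s: "st.homog p s" "eval_sharp s = (\<zero>\<^bsub>L\<^esub>, w \<ominus>\<^bsub>W\<^esub> snd (eval_sharp t))" using W_generated by blast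
  have "eval_sharp (Add t s) = eval_sharp t \<oplus>\<^bsub>E.E\<^esub> eval_sharp s" by simp
  also have "\<dots> = (x, snd (eval_sharp t)) \<oplus>\<^bsub>E.E\<^esub> (\<zero>\<^bsub>L\<^esub>, w \<ominus>\<^bsub>W\<^esub> snd (eval_sharp t))" using e s(2) by simp
  also have "\<dots> = X"
    using Xe g[THEN W.grade_carrier] Xe(2)[THEN L.grade_carrier] Xe(3)[THEN W.grade_carrier]
    by (simp add: a_minus_def W.M.a_lcomm W.M.r_neg)
  finally show ?thesis using homog_term.add[OF t(1) s(1)] by blast
qed

lemma E_generated':
  assumes X: "X \<in> carrier E.E" shows "\<exists>t. t \<in> st.T \<and> eval_sharp t = X"
proof -
  obtain s t where s: "st.homog 0 s" "eval_sharp s = gpart E.E 0 X" and t: "st.homog 1 t" "eval_sharp t = gpart E.E 1 X"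
    using E_generated[OF sharp.gpart_grade[OF X, of 0]] E_generated[OF sharp.gpart_grade[OF X, of 1]] by blast
  have "eval_sharp (Add s t) = eval_sharp s \<oplus>\<^bsub>E.E\<^esub> eval_sharp t" by simp
  also have "\<dots> = X" unfolding s(2) t(2) by (rule sharp.gpart_decomp(2)[OF X])
  finally have "eval_sharp (Add s t) = X" .
  then show ?thesis using lie_terms.add[OF st.homog_terms[OF s(1)] st.homog_terms[OF t(1)]] by blast
qed

text \<open>An element of the extension is sent to the value in \<open>M\<close> of any term that
  represents it.\<close>

definition rho where "rho = (\<lambda>X\<in>carrier E.E. eval_ext (SOME t. t \<in> st.T \<and> eval_sharp t = X))"

lemma rho_eval_sharp: 
  assumes t: "t \<in> st.T" shows "rho (eval_sharp t) = eval_ext t"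
proof -
  define s where "s = (SOME s. s \<in> st.T \<and> eval_sharp s = eval_sharp t)"
  have "\<exists>s. s \<in> st.T \<and> eval_sharp s = eval_sharp t" using t by blast
  from someI_ex[OF this] have s: "s \<in> st.T" "eval_sharp s = eval_sharp t" unfolding s_def by blast+
  have "rho (eval_sharp t) = eval_ext s" unfolding rho_def s_def by (rule restrict_apply'[OF eval_sharp_closed[OF t]])
  then show ?thesis using eval_ext_wd[OF s(1) t s(2)] by (rule HOL.trans)
qed

lemma rho_hom: "rho \<in> lie_super_hom K E.E M \<inter> extensional (carrier E.E)"
proof -
  have *: "\<exists>t. t \<in> st.T \<and> X = eval_sharp t" if "X \<in> carrier E.E" for X using E_generated'[OF that] by blast
  have "rho \<in> lie_super_hom K E.E M"
    unfolding lie_super_hom_def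
  proof (intro CollectI conjI ballI allI)
    show "rho \<in> carrier E.E \<rightarrow> carrier M" using * rho_eval_sharp by (metis Pi_I eval_ext_closed)
    show "rho (X \<oplus>\<^bsub>E.E\<^esub> Y) = rho X \<oplus>\<^bsub>M\<^esub> rho Y" if X: "X \<in> carrier E.E" and Y: "Y \<in> carrier E.E" for X Y
    proof -
      obtain s t where st: "s \<in> st.T" "X = eval_sharp s" "t \<in> st.T" "Y = eval_sharp t" using *[OF X] *[OF Y] by blast
      then show ?thesis using rho_eval_sharp[OF lie_terms.add[OF st(1,3)]] by (simp add: rho_eval_sharp)
    qed
    show "rho (k \<odot>\<^bsub>E.E\<^esub> X) = k \<odot>\<^bsub>M\<^esub> rho X" if k: "k \<in> carrier K" and X: "X \<in> carrier E.E" for k X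
    proof -
      obtain s where st: "s \<in> st.T" "X = eval_sharp s" using *[OF X] by blast
      then show ?thesis using rho_eval_sharp[OF lie_terms.smult[OF k st(1)]] by (simp add: rho_eval_sharp)
    qed
    show "rho (bracket E.E X Y) = bracket M (rho X) (rho Y)" if X: "X \<in> carrier E.E" and Y: "Y \<in> carrier E.E" for X Y
    proof -
      obtain s t where st: "s \<in> st.T" "X = eval_sharp s" "t \<in> st.T" "Y = eval_sharp t" using *[OF X] *[OF Y] by blast
      then show ?thesis using rho_eval_sharp[OF lie_terms.br[OF st(1,3)]] by (simp add: rho_eval_sharp)
    qed
    show "rho ` grade E.E p \<subseteq> grade M p" for p
    proof
      fix m assume "m \<in> rho ` grade E.E p"
      then obtain t where t: "st.homog p t" "m = rho (eval_sharp t)" using E_generated by blast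
      then show "m \<in> grade M p"
        using X.eval_term_homog[OF gen_ext_grade t(1)] rho_eval_sharp[OF st.homog_terms[OF t(1)]] by simp
    qed
  qed
  then show ?thesis by (simp add: rho_def)
qed

lemma tau_rho: "X \<in> carrier E.E \<Longrightarrow> \<tau> (rho X) = fst X"
  using E_generated'[of X] rho_eval_sharp tau_eval_ext fst_eval_sharp by metis

text \<open>A homomorphism over \<open>L\<close> sends \<open>F\<^sub>i\<^sub>j(a)\<close>, being
  the bracket of \<open>F\<^sub>i\<^sub>k(a)\<close> and \<open>F\<^sub>k\<^sub>j(1)\<close>, to a
  bracket of lifts of these, and such a bracket is independent of the lifts.\<close>

lemma hom_eval_sharp:
  assumes f: "f \<in> lie_super_hom K E.E M" and tf: "\<And>X. X \<in> carrier E.E \<Longrightarrow> \<tau> (f X) = fst X" and t: "t \<in> st.T"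
  shows "f (eval_sharp t) = eval_ext t"
  using t
proof (induction rule: lie_terms.induct)
  note h = lie_super_homD[OF f]
  case (gen x)
  then obtain i j p a where x: "x = (i, j, p, a)" and ij: "i \<in> idx" "j \<in> idx" "i \<noteq> j" "a \<in> grade A p"
    by (rule gens_E)
  obtain k where k: "k \<in> idx" "k \<noteq> i" "k \<noteq> j" using third_index ij(1,2) by blast
  let ?u = "(F i k p a, \<zero>\<^bsub>W\<^esub>)" and ?v = "(F k j 0 \<one>\<^bsub>A\<^esub>, \<zero>\<^bsub>W\<^esub>)"
  have uv: "?u \<in> carrier E.E" "?v \<in> carrier E.E" using ij k by (simp_all add: W_closed(2))
  have "psi (F i k p a) (F k j 0 \<one>\<^bsub>A\<^esub>) = \<zero>\<^bsub>W\<^esub>" using psi_F[of i k k j a p "\<one>\<^bsub>A\<^esub>" 0] ij k by simp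
  then have "(F i j p a, \<zero>\<^bsub>W\<^esub>) = bracket E.E ?u ?v" using F_split(1)[of i j k a p] ij k by simp
  then have "f (F i j p a, \<zero>\<^bsub>W\<^esub>) = beta (\<tau> (f ?u)) (\<tau> (f ?v))"
    using h(4)[OF uv] beta_eq[OF h(1)[OF uv(1)] h(1)[OF uv(2)]] by simp
  also have "\<dots> = root_lift i j p a" using tf[OF uv(1)] tf[OF uv(2)] root_lift_eq[of i j k a p] ij k by simp
  finally show ?case by (simp add: x)
next
  note h = lie_super_homD[OF f]
  case zero
  show ?case using h(3)[of "\<zero>\<^bsub>K\<^esub>" "\<zero>\<^bsub>E.E\<^esub>"] h(1)[of "\<zero>\<^bsub>E.E\<^esub>"] W_closed(2) by simp
qed (simp_all add: lie_super_homD[OF f] del: E.E_simps)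

theorem rho_unique:
  "\<exists>!f. f \<in> lie_super_hom K E.E M \<inter> extensional (carrier E.E) \<and> (\<forall>X\<in>carrier E.E. \<tau> (f X) = fst X)"
proof (rule ex1I[of _ rho])
  show "rho \<in> lie_super_hom K E.E M \<inter> extensional (carrier E.E) \<and> (\<forall>X\<in>carrier E.E. \<tau> (rho X) = fst X)"
    using rho_hom tau_rho by blast
  fix f assume f: "f \<in> lie_super_hom K E.E M \<inter> extensional (carrier E.E) \<and> (\<forall>X\<in>carrier E.E. \<tau> (f X) = fst X)"
  show "f = rho"
  proof (rule extensionalityI[of _ "carrier E.E"])
    fix X assume "X \<in> carrier E.E"
    then obtain t where "t \<in> st.T" "eval_sharp t = X" using E_generated' by blast
    then show "f X = rho X" using hom_eval_sharp[of f t] f rho_eval_sharp by auto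
  qed (use f rho_hom in auto)
qed

end

theorem theorem6p2:
  fixes K :: "('k, 'y) ring_scheme" and A :: "('k, 'a, 'z) supermodule_scheme"
  assumes "cring K"
    and "superalgebra K A"
    and "\<exists>B. module_basis K A B \<and> \<one>\<^bsub>A\<^esub> \<in> B"
  shows "universal_central_extension TYPE('n) K (st22_sharp K A) (st22 K A) fst"
proof -
  interpret super_W K A by (rule super_W.intro[OF assms(2)])
  show ?thesis
    unfolding universal_central_extension_def sharp_eq
  proof (intro conjI allI impI E.central_extension_E)
    fix M :: "('k, 'n) supermodule" and \<tau>
    assume ce: "central_extension K M (st22 K A) \<tau>"
    then have M: "lie_superalgebra K M" unfolding central_extension_def by blast
    interpret st_central_extension K A M \<tau>
    proof (intro st_central_extension.intro super_W_axioms M st_central_extension_axioms.intro)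
      fix m assume "m \<in> carrier M" "\<tau> m = \<zero>\<^bsub>st22 K A\<^esub>"
      then show "m \<in> lie_center M" using ce unfolding central_extension_def a_kernel_def' by blast
    qed (use ce in \<open>auto simp: central_extension_def\<close>)
    show "\<exists>!\<rho>. \<rho> \<in> lie_super_hom K (cocycle_ext L W psi) M \<inter> extensional (carrier (cocycle_ext L W psi)) \<and>
        (\<forall>x\<in>carrier (cocycle_ext L W psi). \<tau> (\<rho> x) = fst x)"
      by (rule rho_unique)
  qed
qed

end
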